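(* Let $(M,L)$ be a pseudo-Finsler manifold with $L:A\to\mathbb{R}$. Let $\gamma:[a,b]\rightarrow M$ be an $L$-admissible smooth curve, let $\Lambda: [a,b]\times (-\varepsilon,\varepsilon)\rightarrow M$ be an $L$-admissible two parameter map such that $\Lambda(\cdot,0)=\gamma$, and let $W$ be a smooth vector field along $\Lambda$. Let $U(t)=\Lambda_s(t,0)$ be the variational vector field of $\Lambda$ along $\gamma$. Then, along $\gamma$ (that is, at $(t,0)$ for every $t\in[a,b]$), $$R^\Lambda(W)=R_{\dot\gamma}(\dot\gamma,U)W+P_{\dot\gamma}(U,W,D_\gamma^{\dot\gamma}\dot\gamma)-P_{\dot\gamma}(\dot\gamma,W,D_\gamma^{\dot\gamma}U).$$
   Context: Pseudo-Finsler manifold: $M$ is a smooth manifold, $\pi:TM\to M$ the tangent bundle, $A\subset TM\setminus 0$ an open conic subset ($v\in A,\lambda>0\Rightarrow \lambda v\in A$), and $L:A\to\mathbb{R}$ is smooth with $L(\lambda v)=\lambda^2L(v)$ for $\lambda>0$ and such that for every $v\in A$ the fundamental tensor $g_v(u,w)=\frac12\frac{\partial^2}{\partial t\,\partial s}L(v+tu+sw)|_{t=s=0}$ ($u,w\in T_{\pi(v)}M$) is nondegenerate. The Cartan tensor is $C_v(w_1,w_2,w_3)=\frac14\frac{\partial^3}{\partial s_1\partial s_2\partial s_3}L(v+s_1w_1+s_2w_2+s_3w_3)|_{s_1=s_2=s_3=0}$. Chern connection: a vector field $V$ on an open set $\Omega\subset M$ is $L$-admissible if $V(p)\in A$ for all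 $p\in\Omega$. For such $V$, $\nabla^V$ is the unique torsion-free affine connection on $\Omega$ with $X(g_V(Y,Z))=g_V(\nabla^V_XY,Z)+g_V(Y,\nabla^V_XZ)+2C_V(\nabla^V_XV,Y,Z)$ for all smooth vector fields $X,Y,Z$ on $\Omega$. In a chart $(\Omega,(u^i))$ of $M$ with induced chart $(x^i,y^i)$ on $TM$ ($x^i=u^i\circ\pi$, $y^i(v)=v(u^i)$), the Christoffel symbols are the functions $\Gamma^i_{\,jk}:A\cap\pi^{-1}(\Omega)\to\mathbb{R}$, symmetric in $j,k$, with $\nabla^V_{\partial/\partial u^j}\frac{\partial}{\partial u^k}=\Gamma^i_{\,jk}(V)\frac{\partial}{\partial u^i}$ for every $L$-admissible $V$. Put $N^i_{\,j}=y^k\Gamma^i_{\,kj}$ and $\frac{\delta}{\delta x^k}=\frac{\partial}{\partial x^k}-N^i_{\,k}\frac{\partial}{\partial y^i}$. Chern tensor: for $v\in A$ and $X,Y,Z\in T_{\pi(v)}M$, $P_v(X,Y,Z)=X^jY^kZ^l\frac{\partial\Gamma^i_{\,jk}}{\partial y^l}(v)\frac{\partial}{\partial u^i}$; equivalently, for vector fields on $\Omega$ and $L$-admissible $V$, $P_V(X,Y,Z)=\frac{\partial}{\partial t}(\nabla^{V+tZ}_XY)|_{t=0}$. Chern curvature: for $v\in A$ and $X,Y,Z\in T_{\pi(v)}M$, $R_v(X,Y)Z=X^kY^lZ^jR_{j\ kl}^{\ i}(v)\frac{\partial}{\partial u^i}$ with $R_{j\ kl}^{\ i}=\frac{\delta\Gamma^i_{\,jl}}{\delta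 x^k}-\frac{\delta\Gamma^i_{\,jk}}{\delta x^l}+\Gamma^i_{\,hk}\Gamma^h_{\,jl}-\Gamma^i_{\,hl}\Gamma^h_{\,jk}$. Covariant derivative along curves: for a smooth curve $\gamma$ in $M$, a smooth vector field $T$ along $\gamma$ with values in $A$, and a smooth vector field $X$ along $\gamma$, $D_\gamma^TX=\left(\frac{dX^i}{dt}+X^j\dot\gamma^k\Gamma^i_{\,jk}(T)\right)\frac{\partial}{\partial u^i}$ in coordinates. The curve $\gamma$ is $L$-admissible if $\dot\gamma(t)\in A$ for all $t$. Two parameter maps: $\Lambda:[a,b]\times(-\varepsilon,\varepsilon)\to M$, $(t,s)\mapsto\Lambda(t,s)$, is assumed to extend to a smooth map on $(\bar a,\bar b)\times(-\varepsilon,\varepsilon)$ for some $(\bar a,\bar b)\supset[a,b]$; $\Lambda_t,\Lambda_s$ denote its partial velocity fields; it is $L$-admissible if $\Lambda_t(t,s)\in A$ for all $(t,s)$. Write $\gamma_s(t)=\Lambda(t,s)=\beta_t(s)$. For a smooth vector field $W$ along $\Lambda$, $R^\Lambda(W):=D_{\gamma_s}^{\Lambda_t}D_{\beta_t}^{\Lambda_t}W-D_{\beta_t}^{\Lambda_t}D_{\gamma_s}^{\Lambda_t}W$. *)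

theory Defs
  imports "HOL-Analysis.Analysis"
begin

text \<open>Smooth functions. \<open>Ck_on k S f\<close> is meant for an open set \<open>S\<close>: the function is \<open>k\<close> times
  Frechet differentiable on \<open>S\<close>, all its iterated directional derivatives being continuous.\<close>

primrec Ck_on :: "nat \<Rightarrow> 'a::euclidean_space set \<Rightarrow> ('a \<Rightarrow> 'b::euclidean_space) \<Rightarrow> bool" where
  "Ck_on 0 S f \<longleftrightarrow> continuous_on S f"
| "Ck_on (Suc k) S f \<longleftrightarrow> (\<forall>x\<in>S. f differentiable (at x)) \<and>
     (\<forall>h. Ck_on k S (\<lambda>x. frechet_derivative f (at x) h))"

definition smooth_on :: "'a::euclidean_space set \<Rightarrow> ('a \<Rightarrow> 'b::euclidean_space) \<Rightarrow> bool" where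
  "smooth_on S f \<longleftrightarrow> (\<forall>k. Ck_on k S f)"

text \<open>A chart consists of its domain \<open>\<Omega>\<close> and of the map \<open>(u\<^sup>1, \<dots>, u\<^sup>n)\<close>; the values of the map
  outside \<open>\<Omega>\<close> are irrelevant.\<close>

type_synonym ('m, 'n) chart = "'m set \<times> ('m \<Rightarrow> real ^ 'n)"

abbreviation cdom :: "('m, 'n::finite) chart \<Rightarrow> 'm set" where
  "cdom c \<equiv> fst c"

abbreviation cmap :: "('m, 'n::finite) chart \<Rightarrow> 'm \<Rightarrow> real ^ 'n" where
  "cmap c \<equiv> snd c"

definition cinv :: "('m, 'n::finite) chart \<Rightarrow> real ^ 'n \<Rightarrow> 'm" where
  "cinv c = inv_into (cdom c) (cmap c)"

definition smooth_atlas ::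
  "('m::{t2_space,second_countable_topology}, 'n::finite) chart set \<Rightarrow> bool" where
  "smooth_atlas \<A> \<longleftrightarrow>
     (\<Union>c\<in>\<A>. cdom c) = UNIV \<and>
     (\<forall>c\<in>\<A>. open (cdom c) \<and> open (cmap c ` cdom c) \<and>
        homeomorphism (cdom c) (cmap c ` cdom c) (cmap c) (cinv c)) \<and>
     (\<forall>c\<in>\<A>. \<forall>c'\<in>\<A>. smooth_on (cmap c ` (cdom c \<inter> cdom c')) (cmap c' \<circ> cinv c))"

text \<open>A tangent vector at \<open>p\<close> is the family of its component vectors with respect to all the charts
  around \<open>p\<close>, related by the derivatives of the transition maps (and \<open>0\<close> for the charts that do not
  contain \<open>p\<close>). The type below contains all families; those that are tangent vectors at \<open>p\<close>
  are singled out by \<open>tangent_space\<close>.\<close>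

datatype ('m, 'n) tvec = Tvec (tcomp: "('m, 'n::finite) chart \<Rightarrow> real ^ 'n")

instantiation tvec :: (type, finite) real_vector
begin

definition "0 = Tvec (\<lambda>c. 0)"
definition "v + w = Tvec (\<lambda>c. tcomp v c + tcomp w c)"
definition "- v = Tvec (\<lambda>c. - tcomp v c)"
definition "v - w = Tvec (\<lambda>c. tcomp v c - tcomp w c)"
definition "r *\<^sub>R v = Tvec (\<lambda>c. r *\<^sub>R tcomp v c)"

instance
  by standard
    (auto simp: zero_tvec_def plus_tvec_def uminus_tvec_def minus_tvec_def scaleR_tvec_def
      algebra_simps intro!: tvec.expand)

end

text \<open>The data \<open>(M, A, L)\<close>: the manifold \<open>M\<close> is the whole type \<open>'m\<close> with the given atlas, \<open>adm\<close> is the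
  set \<open>A\<close>, and only the values of \<open>lagr p v = L(v)\<close> for \<open>(p, v) \<in> A\<close> are relevant.\<close>

record ('m, 'n) finsler =
  atlas :: "('m, 'n::finite) chart set"
  adm :: "('m \<times> ('m, 'n) tvec) set"
  lagr :: "'m \<Rightarrow> ('m, 'n) tvec \<Rightarrow> real"

definition charts_at :: "('m, 'n::finite) finsler \<Rightarrow> 'm \<Rightarrow> ('m, 'n) chart set" where
  "charts_at F p = {c \<in> atlas F. p \<in> cdom c}"

definition tangent_space :: "('m, 'n::finite) finsler \<Rightarrow> 'm \<Rightarrow> ('m, 'n) tvec set" where
  "tangent_space F p = {v.
     (\<forall>c. c \<notin> charts_at F p \<longrightarrow> tcomp v c = 0) \<and>
     (\<forall>c\<in>charts_at F p. \<forall>c'\<in>charts_at F p.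
        tcomp v c' = frechet_derivative (cmap c' \<circ> cinv c) (at (cmap c p)) (tcomp v c))}"

text \<open>\<open>vec_of F c p y\<close> is the tangent vector \<open>y\<^sup>i \<partial>/\<partial>u\<^sup>i\<close> at \<open>p\<close>, where \<open>u = cmap c\<close>.\<close>

definition vec_of ::
  "('m, 'n::finite) finsler \<Rightarrow> ('m, 'n) chart \<Rightarrow> 'm \<Rightarrow> real ^ 'n \<Rightarrow> ('m, 'n) tvec" where
  "vec_of F c p y = Tvec (\<lambda>c'. if c' \<in> charts_at F p
     then frechet_derivative (cmap c' \<circ> cinv c) (at (cmap c p)) y else 0)"

text \<open>Notions given by a coordinate formula that does not depend on the chart are defined by means of
  the following chart around the point in question.\<close>

definition chart_at :: "('m, 'n::finite) finsler \<Rightarrow> 'm \<Rightarrow> ('m, 'n) chart" where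
  "chart_at F p = (SOME c. c \<in> charts_at F p)"

text \<open>The representations of \<open>A\<close> and \<open>L\<close> in the chart \<open>(x\<^sup>i, y\<^sup>i)\<close> of \<open>TM\<close>.\<close>

definition adm_in ::
  "('m, 'n::finite) finsler \<Rightarrow> ('m, 'n) chart \<Rightarrow> ((real ^ 'n) \<times> (real ^ 'n)) set" where
  "adm_in F c = {(x, y). x \<in> cmap c ` cdom c \<and> (cinv c x, vec_of F c (cinv c x) y) \<in> adm F}"

definition lagr_in ::
  "('m, 'n::finite) finsler \<Rightarrow> ('m, 'n) chart \<Rightarrow> (real ^ 'n) \<times> (real ^ 'n) \<Rightarrow> real" where
  "lagr_in F c = (\<lambda>(x, y). lagr F (cinv c x) (vec_of F c (cinv c x) y))"

definition fund_tensor ::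
  "('m, 'n::finite) finsler \<Rightarrow> 'm \<Rightarrow> ('m, 'n) tvec \<Rightarrow> ('m, 'n) tvec \<Rightarrow> ('m, 'n) tvec \<Rightarrow> real" where
  "fund_tensor F p v u w =
     1 / 2 * deriv (\<lambda>t. deriv (\<lambda>s. lagr F p (v + t *\<^sub>R u + s *\<^sub>R w)) 0) 0"

definition cartan_tensor ::
  "('m, 'n::finite) finsler \<Rightarrow> 'm \<Rightarrow> ('m, 'n) tvec \<Rightarrow>
     ('m, 'n) tvec \<Rightarrow> ('m, 'n) tvec \<Rightarrow> ('m, 'n) tvec \<Rightarrow> real" where
  "cartan_tensor F p v w1 w2 w3 =
     1 / 4 * deriv (\<lambda>s1. deriv (\<lambda>s2. deriv (\<lambda>s3.
       lagr F p (v + s1 *\<^sub>R w1 + s2 *\<^sub>R w2 + s3 *\<^sub>R w3)) 0) 0) 0"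

text \<open>Openness of \<open>A\<close> in \<open>TM\<close> and smoothness of \<open>L\<close> are expressed in the charts of \<open>TM\<close>.\<close>

definition pseudo_finsler ::
  "('m::{t2_space,second_countable_topology}, 'n::finite) finsler \<Rightarrow> bool" where
  "pseudo_finsler F \<longleftrightarrow>
     smooth_atlas (atlas F) \<and>
     (\<forall>(p, v)\<in>adm F. v \<in> tangent_space F p \<and> v \<noteq> 0) \<and>
     (\<forall>(p, v)\<in>adm F. \<forall>r>0. (p, r *\<^sub>R v) \<in> adm F) \<and>
     (\<forall>c\<in>atlas F. open (adm_in F c)) \<and>
     (\<forall>c\<in>atlas F. smooth_on (adm_in F c) (lagr_in F c)) \<and>
     (\<forall>(p, v)\<in>adm F. \<forall>r>0. lagr F p (r *\<^sub>R v) = r\<^sup>2 * lagr F p v) \<and>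
     (\<forall>(p, v)\<in>adm F. \<forall>u\<in>tangent_space F p.
        (\<forall>w\<in>tangent_space F p. fund_tensor F p v u w = 0) \<longrightarrow> u = 0)"

text \<open>Functions and vector fields on an open set \<open>\<Omega>\<close> are total; only their values on \<open>\<Omega>\<close> matter.\<close>

type_synonym ('m, 'n) vfield = "'m \<Rightarrow> ('m, 'n) tvec"

definition smooth_fun ::
  "('m, 'n::finite) finsler \<Rightarrow> 'm set \<Rightarrow> ('m \<Rightarrow> real) \<Rightarrow> bool" where
  "smooth_fun F \<Omega> f \<longleftrightarrow> (\<forall>c\<in>atlas F. smooth_on (cmap c ` (cdom c \<inter> \<Omega>)) (f \<circ> cinv c))"

definition smooth_vfield ::
  "('m, 'n::finite) finsler \<Rightarrow> 'm set \<Rightarrow> ('m, 'n) vfield \<Rightarrow> bool" where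
  "smooth_vfield F \<Omega> X \<longleftrightarrow> (\<forall>p\<in>\<Omega>. X p \<in> tangent_space F p) \<and>
     (\<forall>c\<in>atlas F. smooth_on (cmap c ` (cdom c \<inter> \<Omega>)) (\<lambda>x. tcomp (X (cinv c x)) c))"

text \<open>The function \<open>X(f)\<close>.\<close>

definition vf_apply ::
  "('m, 'n::finite) finsler \<Rightarrow> ('m, 'n) vfield \<Rightarrow> ('m \<Rightarrow> real) \<Rightarrow> 'm \<Rightarrow> real" where
  "vf_apply F X f p = (let c = chart_at F p in
     frechet_derivative (f \<circ> cinv c) (at (cmap c p)) (tcomp (X p) c))"

definition admissible_vfield ::
  "('m, 'n::finite) finsler \<Rightarrow> 'm set \<Rightarrow> ('m, 'n) vfield \<Rightarrow> bool" where
  "admissible_vfield F \<Omega> V \<longleftrightarrow> smooth_vfield F \<Omega> V \<and> (\<forall>p\<in>\<Omega>. (p, V p) \<in> adm F)"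

type_synonym ('m, 'n) connection = "('m, 'n) vfield \<Rightarrow> ('m, 'n) vfield \<Rightarrow> ('m, 'n) vfield"

definition affine_connection ::
  "('m, 'n::finite) finsler \<Rightarrow> 'm set \<Rightarrow> ('m, 'n) connection \<Rightarrow> bool" where
  "affine_connection F \<Omega> D \<longleftrightarrow>
     (\<forall>X Y. smooth_vfield F \<Omega> X \<and> smooth_vfield F \<Omega> Y \<longrightarrow> smooth_vfield F \<Omega> (D X Y)) \<and>
     (\<forall>X Y Z. smooth_vfield F \<Omega> X \<and> smooth_vfield F \<Omega> Y \<and> smooth_vfield F \<Omega> Z \<longrightarrow>
        (\<forall>p\<in>\<Omega>. D (\<lambda>q. X q + Y q) Z p = D X Z p + D Y Z p \<and>
               D X (\<lambda>q. Y q + Z q) p = D X Y p + D X Z p)) \<and>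
     (\<forall>X Y f. smooth_vfield F \<Omega> X \<and> smooth_vfield F \<Omega> Y \<and> smooth_fun F \<Omega> f \<longrightarrow>
        (\<forall>p\<in>\<Omega>. D (\<lambda>q. f q *\<^sub>R X q) Y p = f p *\<^sub>R D X Y p \<and>
               D X (\<lambda>q. f q *\<^sub>R Y q) p = vf_apply F X f p *\<^sub>R Y p + f p *\<^sub>R D X Y p))"

text \<open>\<open>\<nabla>\<^sub>X Y - \<nabla>\<^sub>Y X = [X, Y]\<close>, both sides being viewed as derivations: \<open>[X, Y](f) = X(Y(f)) - Y(X(f))\<close>.\<close>

definition torsion_free ::
  "('m, 'n::finite) finsler \<Rightarrow> 'm set \<Rightarrow> ('m, 'n) connection \<Rightarrow> bool" where
  "torsion_free F \<Omega> D \<longleftrightarrow>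
     (\<forall>X Y f. smooth_vfield F \<Omega> X \<and> smooth_vfield F \<Omega> Y \<and> smooth_fun F \<Omega> f \<longrightarrow>
        (\<forall>p\<in>\<Omega>. vf_apply F (\<lambda>q. D X Y q - D Y X q) f p =
           vf_apply F X (vf_apply F Y f) p - vf_apply F Y (vf_apply F X f) p))"

definition chern_connection ::
  "('m, 'n::finite) finsler \<Rightarrow> 'm set \<Rightarrow> ('m, 'n) vfield \<Rightarrow> ('m, 'n) connection \<Rightarrow> bool" where
  "chern_connection F \<Omega> V D \<longleftrightarrow>
     affine_connection F \<Omega> D \<and> torsion_free F \<Omega> D \<and>
     (\<forall>X Y Z. smooth_vfield F \<Omega> X \<and> smooth_vfield F \<Omega> Y \<and> smooth_vfield F \<Omega> Z \<longrightarrow>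
        (\<forall>p\<in>\<Omega>. vf_apply F X (\<lambda>q. fund_tensor F q (V q) (Y q) (Z q)) p =
           fund_tensor F p (V p) (D X Y p) (Z p) + fund_tensor F p (V p) (Y p) (D X Z p) +
           2 * cartan_tensor F p (V p) (D X V p) (Y p) (Z p)))"

text \<open>\<open>G p v i j k\<close> stands for \<open>\<Gamma>\<^sup>i\<^sub>j\<^sub>k(v)\<close>. The field \<open>V\<close> ranges over the admissible fields on all open
  subsets of the chart domain, since there need not be any on the whole domain.\<close>

definition is_christoffel ::
  "('m::topological_space, 'n::finite) finsler \<Rightarrow> ('m, 'n) chart \<Rightarrow>
     ('m \<Rightarrow> ('m, 'n) tvec \<Rightarrow> 'n \<Rightarrow> 'n \<Rightarrow> 'n \<Rightarrow> real) \<Rightarrow> bool" where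
  "is_christoffel F c G \<longleftrightarrow>
     (\<forall>(p, v)\<in>adm F. p \<in> cdom c \<longrightarrow> (\<forall>i j k. G p v i j k = G p v i k j)) \<and>
     (\<forall>\<Omega> V D. open \<Omega> \<and> \<Omega> \<subseteq> cdom c \<and> admissible_vfield F \<Omega> V \<and> chern_connection F \<Omega> V D \<longrightarrow>
        (\<forall>p\<in>\<Omega>. \<forall>j k.
           D (\<lambda>q. vec_of F c q (axis j 1)) (\<lambda>q. vec_of F c q (axis k 1)) p =
           vec_of F c p (\<chi> i. G p (V p) i j k)))"

text \<open>These conditions determine the Christoffel symbols on \<open>A \<inter> \<pi>\<^sup>-\<^sup>1(\<Omega>)\<close>, the only place where
  they are used.\<close>

definition christoffel ::
  "('m::topological_space, 'n::finite) finsler \<Rightarrow> ('m, 'n) chart \<Rightarrow>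
     'm \<Rightarrow> ('m, 'n) tvec \<Rightarrow> 'n \<Rightarrow> 'n \<Rightarrow> 'n \<Rightarrow> real" where
  "christoffel F c = (SOME G. is_christoffel F c G)"

text \<open>\<open>\<Gamma>\<^sup>i\<^sub>j\<^sub>k\<close> as a function of the coordinates \<open>(x, y)\<close> on \<open>TM\<close>, and the operators \<open>\<partial>/\<partial>y\<^sup>l\<close> and
  \<open>\<delta>/\<delta>x\<^sup>k = \<partial>/\<partial>x\<^sup>k - N\<^sup>h\<^sub>k \<partial>/\<partial>y\<^sup>h\<close> acting on it.\<close>

definition Gam ::
  "('m::topological_space, 'n::finite) finsler \<Rightarrow> ('m, 'n) chart \<Rightarrow> real ^ 'n \<Rightarrow> real ^ 'n \<Rightarrow>
     'n \<Rightarrow> 'n \<Rightarrow> 'n \<Rightarrow> real" where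
  "Gam F c x y i j k = christoffel F c (cinv c x) (vec_of F c (cinv c x) y) i j k"

definition nonlin ::
  "('m::topological_space, 'n::finite) finsler \<Rightarrow> ('m, 'n) chart \<Rightarrow> real ^ 'n \<Rightarrow> real ^ 'n \<Rightarrow>
     'n \<Rightarrow> 'n \<Rightarrow> real" where
  "nonlin F c x y i j = (\<Sum>k\<in>UNIV. y $ k * Gam F c x y i k j)"

definition dy_Gam ::
  "('m::topological_space, 'n::finite) finsler \<Rightarrow> ('m, 'n) chart \<Rightarrow> real ^ 'n \<Rightarrow> real ^ 'n \<Rightarrow>
     'n \<Rightarrow> 'n \<Rightarrow> 'n \<Rightarrow> 'n \<Rightarrow> real" where
  "dy_Gam F c x y l i j k = deriv (\<lambda>h. Gam F c x (y + h *\<^sub>R axis l 1) i j k) 0"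

definition delta_Gam ::
  "('m::topological_space, 'n::finite) finsler \<Rightarrow> ('m, 'n) chart \<Rightarrow> real ^ 'n \<Rightarrow> real ^ 'n \<Rightarrow>
     'n \<Rightarrow> 'n \<Rightarrow> 'n \<Rightarrow> 'n \<Rightarrow> real" where
  "delta_Gam F c x y l i j k =
     deriv (\<lambda>h. Gam F c (x + h *\<^sub>R axis l 1) y i j k) 0
     - (\<Sum>h\<in>UNIV. nonlin F c x y h l * dy_Gam F c x y h i j k)"

definition curv_coeff ::
  "('m::topological_space, 'n::finite) finsler \<Rightarrow> ('m, 'n) chart \<Rightarrow> real ^ 'n \<Rightarrow> real ^ 'n \<Rightarrow>
     'n \<Rightarrow> 'n \<Rightarrow> 'n \<Rightarrow> 'n \<Rightarrow> real" where
  "curv_coeff F c x y j i k l =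
     delta_Gam F c x y k i j l - delta_Gam F c x y l i j k
     + (\<Sum>h\<in>UNIV. Gam F c x y i h k * Gam F c x y h j l)
     - (\<Sum>h\<in>UNIV. Gam F c x y i h l * Gam F c x y h j k)"

text \<open>\<open>chern_tensor F p v X Y Z\<close> is \<open>P\<^sub>v(X, Y, Z)\<close>, and \<open>chern_curvature F p v X Y Z\<close> is
  \<open>R\<^sub>v(X, Y)Z\<close>, with \<open>\<pi>(v) = p\<close>.\<close>

definition chern_tensor ::
  "('m::topological_space, 'n::finite) finsler \<Rightarrow> 'm \<Rightarrow> ('m, 'n) tvec \<Rightarrow>
     ('m, 'n) tvec \<Rightarrow> ('m, 'n) tvec \<Rightarrow> ('m, 'n) tvec \<Rightarrow> ('m, 'n) tvec" where
  "chern_tensor F p v X Y Z = (let c = chart_at F p in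
     vec_of F c p (\<chi> i. \<Sum>j\<in>UNIV. \<Sum>k\<in>UNIV. \<Sum>l\<in>UNIV.
       tcomp X c $ j * tcomp Y c $ k * tcomp Z c $ l * dy_Gam F c (cmap c p) (tcomp v c) l i j k))"

definition chern_curvature ::
  "('m::topological_space, 'n::finite) finsler \<Rightarrow> 'm \<Rightarrow> ('m, 'n) tvec \<Rightarrow>
     ('m, 'n) tvec \<Rightarrow> ('m, 'n) tvec \<Rightarrow> ('m, 'n) tvec \<Rightarrow> ('m, 'n) tvec" where
  "chern_curvature F p v X Y Z = (let c = chart_at F p in
     vec_of F c p (\<chi> i. \<Sum>k\<in>UNIV. \<Sum>l\<in>UNIV. \<Sum>j\<in>UNIV.
       tcomp X c $ k * tcomp Y c $ l * tcomp Z c $ j * curv_coeff F c (cmap c p) (tcomp v c) j i k l))"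

text \<open>Curves and fields along them are functions on an interval \<open>I\<close>; at end points that belong to \<open>I\<close>
  the derivatives are one-sided.\<close>

definition velocity ::
  "('m, 'n::finite) finsler \<Rightarrow> real set \<Rightarrow> (real \<Rightarrow> 'm) \<Rightarrow> real \<Rightarrow> ('m, 'n) tvec" where
  "velocity F I \<gamma> t = (let c = chart_at F (\<gamma> t) in
     vec_of F c (\<gamma> t) (vector_derivative (cmap c \<circ> \<gamma>) (at t within I)))"

text \<open>\<open>cov_deriv F I \<gamma> T X t\<close> is the value of \<open>D\<^sub>\<gamma>\<^sup>T X\<close> at the parameter \<open>t\<close>.\<close>

definition cov_deriv ::
  "('m::topological_space, 'n::finite) finsler \<Rightarrow> real set \<Rightarrow> (real \<Rightarrow> 'm) \<Rightarrow>
     (real \<Rightarrow> ('m, 'n) tvec) \<Rightarrow> (real \<Rightarrow> ('m, 'n) tvec) \<Rightarrow> real \<Rightarrow> ('m, 'n) tvec" where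
  "cov_deriv F I \<gamma> T X t = (let c = chart_at F (\<gamma> t) in
     vec_of F c (\<gamma> t) (\<chi> i.
       vector_derivative (\<lambda>\<tau>. tcomp (X \<tau>) c) (at t within I) $ i
       + (\<Sum>j\<in>UNIV. \<Sum>k\<in>UNIV. tcomp (X t) c $ j * tcomp (velocity F I \<gamma> t) c $ k *
            christoffel F c (\<gamma> t) (T t) i j k)))"

text \<open>Smoothness of maps and of fields along maps on an arbitrary set \<open>S\<close> of parameters means, as
  usual, that around each point of \<open>S\<close> the coordinate representations have smooth extensions.\<close>

definition smooth_map ::
  "('m, 'n::finite) finsler \<Rightarrow> 'a::euclidean_space set \<Rightarrow> ('a \<Rightarrow> 'm) \<Rightarrow> bool" where
  "smooth_map F S f \<longleftrightarrow> (\<forall>x\<in>S. \<forall>c\<in>charts_at F (f x). \<exists>U g. open U \<and> x \<in> U \<and> smooth_on U g \<and>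
     (\<forall>y\<in>U \<inter> S. f y \<in> cdom c \<and> cmap c (f y) = g y))"

definition smooth_field_along ::
  "('m, 'n::finite) finsler \<Rightarrow> 'a::euclidean_space set \<Rightarrow> ('a \<Rightarrow> 'm) \<Rightarrow>
     ('a \<Rightarrow> ('m, 'n) tvec) \<Rightarrow> bool" where
  "smooth_field_along F S f X \<longleftrightarrow> (\<forall>x\<in>S. X x \<in> tangent_space F (f x)) \<and>
     (\<forall>x\<in>S. \<forall>c\<in>charts_at F (f x). \<exists>U g. open U \<and> x \<in> U \<and> smooth_on U g \<and>
        (\<forall>y\<in>U \<inter> S. f y \<in> cdom c \<and> tcomp (X y) c = g y))"

definition admissible_curve ::
  "('m, 'n::finite) finsler \<Rightarrow> real set \<Rightarrow> (real \<Rightarrow> 'm) \<Rightarrow> bool" where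
  "admissible_curve F I \<gamma> \<longleftrightarrow> smooth_map F I \<gamma> \<and> (\<forall>t\<in>I. (\<gamma> t, velocity F I \<gamma> t) \<in> adm F)"

definition two_param_map ::
  "('m, 'n::finite) finsler \<Rightarrow> real \<Rightarrow> real \<Rightarrow> real \<Rightarrow> (real \<Rightarrow> real \<Rightarrow> 'm) \<Rightarrow> bool" where
  "two_param_map F a b \<epsilon> \<Lambda> \<longleftrightarrow> (\<exists>a' b' \<Lambda>'. a' < a \<and> b < b' \<and>
     smooth_map F ({a'<..<b'} \<times> {-\<epsilon><..<\<epsilon>}) \<Lambda>' \<and>
     (\<forall>t\<in>{a..b}. \<forall>s\<in>{-\<epsilon><..<\<epsilon>}. \<Lambda>' (t, s) = \<Lambda> t s))"

definition Lam_t ::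
  "('m, 'n::finite) finsler \<Rightarrow> real \<Rightarrow> real \<Rightarrow> (real \<Rightarrow> real \<Rightarrow> 'm) \<Rightarrow> real \<Rightarrow> real \<Rightarrow> ('m, 'n) tvec" where
  "Lam_t F a b \<Lambda> t s = velocity F {a..b} (\<lambda>\<tau>. \<Lambda> \<tau> s) t"

definition Lam_s ::
  "('m, 'n::finite) finsler \<Rightarrow> real \<Rightarrow> (real \<Rightarrow> real \<Rightarrow> 'm) \<Rightarrow> real \<Rightarrow> real \<Rightarrow> ('m, 'n) tvec" where
  "Lam_s F \<epsilon> \<Lambda> t s = velocity F {-\<epsilon><..<\<epsilon>} (\<lambda>\<sigma>. \<Lambda> t \<sigma>) s"

definition admissible_two_param_map ::
  "('m, 'n::finite) finsler \<Rightarrow> real \<Rightarrow> real \<Rightarrow> real \<Rightarrow> (real \<Rightarrow> real \<Rightarrow> 'm) \<Rightarrow> bool" where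
  "admissible_two_param_map F a b \<epsilon> \<Lambda> \<longleftrightarrow> two_param_map F a b \<epsilon> \<Lambda> \<and>
     (\<forall>t\<in>{a..b}. \<forall>s\<in>{-\<epsilon><..<\<epsilon>}. (\<Lambda> t s, Lam_t F a b \<Lambda> t s) \<in> adm F)"

text \<open>The derivatives of a field \<open>W\<close> along \<open>\<Lambda>\<close> in the directions of the curves \<open>\<gamma>\<^sub>s\<close> and \<open>\<beta>\<^sub>t\<close>, with
  reference vector \<open>\<Lambda>\<^sub>t\<close>, and the operator \<open>R\<^sup>\<Lambda>\<close>.\<close>

definition D_gam ::
  "('m::topological_space, 'n::finite) finsler \<Rightarrow> real \<Rightarrow> real \<Rightarrow> (real \<Rightarrow> real \<Rightarrow> 'm) \<Rightarrow>
     (real \<Rightarrow> real \<Rightarrow> ('m, 'n) tvec) \<Rightarrow> real \<Rightarrow> real \<Rightarrow> ('m, 'n) tvec" where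
  "D_gam F a b \<Lambda> W t s =
     cov_deriv F {a..b} (\<lambda>\<tau>. \<Lambda> \<tau> s) (\<lambda>\<tau>. Lam_t F a b \<Lambda> \<tau> s) (\<lambda>\<tau>. W \<tau> s) t"

definition D_bet ::
  "('m::topological_space, 'n::finite) finsler \<Rightarrow> real \<Rightarrow> real \<Rightarrow> real \<Rightarrow> (real \<Rightarrow> real \<Rightarrow> 'm) \<Rightarrow>
     (real \<Rightarrow> real \<Rightarrow> ('m, 'n) tvec) \<Rightarrow> real \<Rightarrow> real \<Rightarrow> ('m, 'n) tvec" where
  "D_bet F a b \<epsilon> \<Lambda> W t s =
     cov_deriv F {-\<epsilon><..<\<epsilon>} (\<lambda>\<sigma>. \<Lambda> t \<sigma>) (\<lambda>\<sigma>. Lam_t F a b \<Lambda> t \<sigma>) (\<lambda>\<sigma>. W t \<sigma>) s"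

definition R_Lam ::
  "('m::topological_space, 'n::finite) finsler \<Rightarrow> real \<Rightarrow> real \<Rightarrow> real \<Rightarrow> (real \<Rightarrow> real \<Rightarrow> 'm) \<Rightarrow>
     (real \<Rightarrow> real \<Rightarrow> ('m, 'n) tvec) \<Rightarrow> real \<Rightarrow> real \<Rightarrow> ('m, 'n) tvec" where
  "R_Lam F a b \<epsilon> \<Lambda> W t s =
     D_gam F a b \<Lambda> (D_bet F a b \<epsilon> \<Lambda> W) t s - D_bet F a b \<epsilon> \<Lambda> (D_gam F a b \<Lambda> W) t s"

end

(* In a chart, the Koszul formula for the Chern connection of an admissible field V involves V only through its
   value: the Cartan terms containing the derivatives of V cancel, and since the Cartan tensor vanishes on the
   reference vector, inserting that vector first for two arguments and then for one of them determines the
   remaining Cartan terms. This solves for the Christoffel symbols, which are therefore smooth on A, and for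
   a field V with constant components the connection with these symbols is indeed the Chern connection.
   Computing its derivatives of the coordinate fields of a second chart yields the transformation law of the
   Christoffel symbols, by which the covariant derivative along curves does not depend on the chart.
   R^Lambda(W) can then be computed in a single chart: the second derivatives of W and Lambda commute, and the
   derivatives of Gamma in the fibre direction combine, after adding and subtracting the nonlinear connection, to
   the two terms with the Chern tensor. *)

theory Submission
  imports Defs
begin

text \<open>\<open>christoffel\<close> is a Hilbert choice and, apart from symmetry,
  \<open>is_christoffel\<close> constrains it at a vector \<open>v\<close> only through admissible
  fields with value \<open>v\<close> that have a Chern connection. So two facts are needed before
  the symbols can be computed: every Chern connection has the coefficients \<open>chr\<close>, which
  makes the condition satisfiable, and through every admissible \<open>v\<close> passes a local
  field with a Chern connection, which makes it binding. Constant components suffice for such a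
  field, since \<open>A\<close> is open. A second obstacle is that \<open>cov_deriv\<close> works in
  the chart \<open>chart_at\<close>, which may change uncontrollably from point to point.
  \<open>R_Lam\<close> differentiates such values along curves, so they must be read in one chart at
  all neighbouring points. The transformation law used for this comes from uniqueness: a connection
  built in one chart is evaluated in another. Finally, at the end points of \<open>[a,b]\<close>
  derivatives are one-sided; mixed derivatives are therefore commuted for a smooth representative on
  an open parameter set.\<close>

section \<open>Smooth functions\<close>

text \<open>The point comes last, so that \<open>dd f h\<close> is again a function on the same
  space and directional derivatives iterate as \<open>dd (dd f h) k\<close>; \<open>Ck_on\<close>
  recurses in the same shape.\<close>

definition dd :: "('a::euclidean_space \<Rightarrow> 'b::euclidean_space) \<Rightarrow> 'a \<Rightarrow> 'a \<Rightarrow> 'b" where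
  "dd f h = (\<lambda>x. frechet_derivative f (at x) h)"

lemma has_derivative_dd:
  assumes "f differentiable (at x)"
  shows "(f has_derivative (\<lambda>h. dd f h x)) (at x)"
  using assms by (simp add: dd_def frechet_derivative_works)

lemma dd_eqI:
  assumes "(f has_derivative f') (at x)"
  shows "dd f h x = f' h"
  using frechet_derivative_at[OF assms] by (simp add: dd_def)

lemma linear_dd: "f differentiable (at x) \<Longrightarrow> linear (\<lambda>h. dd f h x)"
  using has_derivative_dd has_derivative_linear by blast

lemma has_derivative_cong_open:
  assumes "open S" "x \<in> S" "\<And>y. y \<in> S \<Longrightarrow> f y = g y"
  shows "(f has_derivative f') (at x) \<longleftrightarrow> (g has_derivative f') (at x)"
  using assms has_derivative_transform_within_open[of f f' x UNIV S g]
    has_derivative_transform_within_open[of g f' x UNIV S f] by auto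

lemma differentiable_cong_open:
  assumes "open S" "x \<in> S" "\<And>y. y \<in> S \<Longrightarrow> f y = g y"
  shows "f differentiable (at x) \<longleftrightarrow> g differentiable (at x)"
  using has_derivative_cong_open[OF assms] by (auto simp: differentiable_def)

lemma dd_cong_open:
  assumes "open S" "x \<in> S" "\<And>y. y \<in> S \<Longrightarrow> f y = g y"
  shows "dd f h x = dd g h x"
  using has_derivative_cong_open[OF assms] by (simp add: dd_def frechet_derivative_def)

lemma Ck_on_Suc: "Ck_on (Suc k) S f \<longleftrightarrow> (\<forall>x\<in>S. f differentiable (at x)) \<and> (\<forall>h. Ck_on k S (dd f h))"
  by (simp add: dd_def)

declare Ck_on.simps(2) [simp del]

lemma Ck_on_SucD: "Ck_on (Suc k) S f \<Longrightarrow> Ck_on k S f"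
proof (induction k arbitrary: f)
  case 0
  then show ?case
    by (auto simp: Ck_on_Suc intro!: continuous_at_imp_continuous_on differentiable_imp_continuous_within)
next
  case (Suc k)
  from Suc.prems have "\<And>h. Ck_on (Suc k) S (dd f h)" unfolding Ck_on_Suc[of "Suc k"] by blast
  then have "\<And>h. Ck_on k S (dd f h)" using Suc.IH by blast
  then show ?case using Suc.prems unfolding Ck_on_Suc by blast
qed

text \<open>A derivative sees a whole neighbourhood, so agreement on \<open>S\<close> passes on to
  \<open>dd\<close> because \<open>S\<close> is open.\<close>

lemma Ck_on_cong:
  assumes "open S" "\<And>x. x \<in> S \<Longrightarrow> f x = g x"
  shows "Ck_on k S f \<longleftrightarrow> Ck_on k S g"
  using assms(2)
proof (induction k arbitrary: f g)
  case 0
  then show ?case by (simp cong: continuous_on_cong)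
next
  case (Suc k)
  have "\<And>h. Ck_on k S (dd f h) = Ck_on k S (dd g h)"
    by (rule Suc.IH) (rule dd_cong_open[OF assms(1)], use Suc.prems in auto)
  moreover have "(\<forall>x\<in>S. f differentiable (at x)) \<longleftrightarrow> (\<forall>x\<in>S. g differentiable (at x))"
    using differentiable_cong_open[OF assms(1)] Suc.prems by blast
  ultimately show ?case by (simp add: Ck_on_Suc)
qed

lemma Ck_on_subset: "Ck_on k S f \<Longrightarrow> T \<subseteq> S \<Longrightarrow> Ck_on k T f"
proof (induction k arbitrary: f)
  case 0
  then show ?case using continuous_on_subset by auto
next
  case (Suc k)
  then show ?case unfolding Ck_on_Suc by blast
qed

lemma Ck_on_const: "Ck_on k S (\<lambda>x. c)"
proof (induction k arbitrary: c)
  case (Suc k)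
  have "dd (\<lambda>x. c) h = (\<lambda>x. 0)" for h :: 'a
    by (auto simp: dd_def)
  with Suc show ?case by (auto simp: Ck_on_Suc)
qed simp

lemma Ck_on_bounded_linear:
  assumes "bounded_linear T"
  shows "Ck_on k S T"
proof (cases k)
  case 0
  then show ?thesis using linear_continuous_on[OF assms] by simp
next
  case (Suc m)
  have "dd T h = (\<lambda>x. T h)" for h
    using dd_eqI[OF bounded_linear.has_derivative[OF assms has_derivative_ident]] by auto
  with Suc show ?thesis
    using assms bounded_linear_imp_differentiable by (auto simp: Ck_on_Suc Ck_on_const)
qed

lemma Ck_on_add:
  assumes "open S"
  shows "Ck_on k S f \<Longrightarrow> Ck_on k S g \<Longrightarrow> Ck_on k S (\<lambda>x. f x + g x)"
proof (induction k arbitrary: f g)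
  case 0
  then show ?case by (simp add: continuous_on_add)
next
  case (Suc k)
  have d: "dd (\<lambda>x. f x + g x) h x = dd f h x + dd g h x" if "x \<in> S" for h x
    by (rule dd_eqI, rule has_derivative_add)
      (use Suc.prems that in \<open>auto simp: Ck_on_Suc intro: has_derivative_dd\<close>)
  have "Ck_on k S (\<lambda>x. dd f h x + dd g h x)" for h
    using Suc by (auto simp: Ck_on_Suc)
  then have "Ck_on k S (dd (\<lambda>x. f x + g x) h)" for h
    using Ck_on_cong[OF assms, of "dd (\<lambda>x. f x + g x) h" "\<lambda>x. dd f h x + dd g h x"] d by auto
  with Suc.prems show ?case by (auto simp: Ck_on_Suc)
qed

lemma Ck_on_sum:
  assumes "open S" "\<And>i. i \<in> I \<Longrightarrow> Ck_on k S (f i)"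
  shows "Ck_on k S (\<lambda>x. \<Sum>i\<in>I. f i x)"
  using assms(2) by (induction I rule: infinite_finite_induct) (auto intro!: Ck_on_const Ck_on_add assms(1))

lemma Ck_on_scaleR:
  fixes f :: "'a::euclidean_space \<Rightarrow> real" and g :: "'a \<Rightarrow> 'b::euclidean_space"
  assumes "open S"
  shows "Ck_on k S f \<Longrightarrow> Ck_on k S g \<Longrightarrow> Ck_on k S (\<lambda>x. f x *\<^sub>R g x)"
proof (induction k arbitrary: f g)
  case 0
  then show ?case by (simp add: continuous_on_scaleR)
next
  case (Suc k)
  have d: "dd (\<lambda>x. f x *\<^sub>R g x) h x = f x *\<^sub>R dd g h x + dd f h x *\<^sub>R g x" if "x \<in> S" for h x
    by (rule dd_eqI, rule has_derivative_scaleR)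
      (use Suc.prems that in \<open>auto simp: Ck_on_Suc intro: has_derivative_dd\<close>)
  have "Ck_on k S (\<lambda>x. f x *\<^sub>R dd g h x + dd f h x *\<^sub>R g x)" for h
    using Suc.prems Suc.prems[THEN Ck_on_SucD]
    by (intro Ck_on_add assms Suc.IH) (auto simp: Ck_on_Suc)
  then have "Ck_on k S (dd (\<lambda>x. f x *\<^sub>R g x) h)" for h
    using Ck_on_cong[OF assms, of "dd (\<lambda>x. f x *\<^sub>R g x) h"] d by auto
  with Suc.prems show ?case by (auto simp: Ck_on_Suc)
qed

lemma linear_euclidean_sum:
  fixes T :: "'a::euclidean_space \<Rightarrow> 'b::real_vector"
  assumes "linear T"
  shows "T h = (\<Sum>b\<in>Basis. (h \<bullet> b) *\<^sub>R T b)"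
  using linear_sum[OF assms, of "\<lambda>b. (h \<bullet> b) *\<^sub>R b" Basis]
  by (simp add: euclidean_representation linear_scale[OF assms])

lemma Ck_on_linear_image:
  assumes "open S" "bounded_linear T"
  shows "Ck_on k S f \<Longrightarrow> Ck_on k S (\<lambda>x. T (f x))"
proof (induction k arbitrary: f)
  case 0
  then show ?case using bounded_linear.continuous_on[OF assms(2)] by simp
next
  case (Suc k)
  have d: "((\<lambda>x. T (f x)) has_derivative (\<lambda>h. T (dd f h x))) (at x)" if "x \<in> S" for x
    using Suc.prems that
    by (auto simp: Ck_on_Suc intro!: bounded_linear.has_derivative[OF assms(2)] has_derivative_dd)
  have "Ck_on k S (\<lambda>x. T (dd f h x))" for h
    using Suc by (auto simp: Ck_on_Suc)
  then have "Ck_on k S (dd (\<lambda>x. T (f x)) h)" for h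
    using Ck_on_cong[OF assms(1), of "dd (\<lambda>x. T (f x)) h"] dd_eqI[OF d] by auto
  with d show ?case by (auto simp: Ck_on_Suc differentiable_def)
qed

text \<open>The chain rule evaluates the derivative of \<open>g\<close> in the direction
  \<open>dd f h x\<close>, which moves with \<open>x\<close>, whereas \<open>Ck_on\<close> speaks of
  fixed directions. Expanding over the basis leaves products of components of \<open>dd f h\<close>
  with composites of \<open>dd g b\<close> and \<open>f\<close>, to which the induction hypothesis,
  general in \<open>g\<close>, applies.\<close>

lemma Ck_on_compose:
  fixes f :: "'a::euclidean_space \<Rightarrow> 'b::euclidean_space" and g :: "'b \<Rightarrow> 'c::euclidean_space"
  assumes "open S" "f ` S \<subseteq> T"
  shows "Ck_on k T g \<Longrightarrow> Ck_on k S f \<Longrightarrow> Ck_on k S (\<lambda>x. g (f x))"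
proof (induction k arbitrary: g)
  case 0
  then show ?case using assms(2) by (auto intro: continuous_on_compose2)
next
  case (Suc k)
  have g: "g differentiable (at (f x))" and f: "f differentiable (at x)" if "x \<in> S" for x
    using Suc.prems assms(2) that by (auto simp: Ck_on_Suc)
  have d: "dd (\<lambda>x. g (f x)) h x = (\<Sum>b\<in>Basis. (dd f h x \<bullet> b) *\<^sub>R dd g b (f x))" if "x \<in> S" for h x
    using dd_eqI[OF diff_chain_at[OF has_derivative_dd[OF f[OF that]] has_derivative_dd[OF g[OF that]]], of h]
      linear_euclidean_sum[OF linear_dd[OF g[OF that]], of "dd f h x"]
    by (simp add: o_def)
  have "Ck_on k S (\<lambda>x. dd f h x \<bullet> b)" for h b
    using Suc.prems(2) by (intro Ck_on_linear_image[OF assms(1) bounded_linear_inner_left]) (auto simp: Ck_on_Suc)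
  moreover have "Ck_on k S (\<lambda>x. dd g b (f x))" for b
    using Suc.prems Suc.prems(2)[THEN Ck_on_SucD] by (intro Suc.IH) (auto simp: Ck_on_Suc)
  ultimately have "Ck_on k S (\<lambda>x. \<Sum>b\<in>Basis. (dd f h x \<bullet> b) *\<^sub>R dd g b (f x))" for h
    by (intro Ck_on_sum Ck_on_scaleR assms) auto
  then have "Ck_on k S (dd (\<lambda>x. g (f x)) h)" for h
    using Ck_on_cong[OF assms(1), of "dd (\<lambda>x. g (f x)) h"] d by auto
  moreover have "(\<lambda>x. g (f x)) differentiable (at x)" if "x \<in> S" for x
    using differentiable_chain_at[OF f g, OF that that] by (simp add: o_def)
  ultimately show ?case by (auto simp: Ck_on_Suc)
qed

lemma Ck_on_inverse:
  fixes f :: "'a::euclidean_space \<Rightarrow> real"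
  assumes "open S" "\<And>x. x \<in> S \<Longrightarrow> f x \<noteq> 0"
  shows "Ck_on k S f \<Longrightarrow> Ck_on k S (\<lambda>x. inverse (f x))"
proof (induction k)
  case 0
  then show ?case using assms(2) by (auto intro!: continuous_on_inverse)
next
  case (Suc k)
  have d: "((\<lambda>x. inverse (f x)) has_derivative (\<lambda>h. - (inverse (f x) * dd f h x * inverse (f x)))) (at x)"
    if "x \<in> S" for x
    using Suc.prems that assms(2)
    by (intro Deriv.has_derivative_inverse) (auto simp: Ck_on_Suc intro: has_derivative_dd)
  \<comment> \<open>Only \<open>inverse (f x)\<close> and \<open>dd f h x\<close> occur, so the
    induction hypothesis and the product rule at order \<open>k\<close> suffice.\<close>
  have eq: "dd (\<lambda>x. inverse (f x)) h x = ((-1) * inverse (f x)) *\<^sub>R (inverse (f x) *\<^sub>R dd f h x)" if "x \<in> S" for h x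
    using dd_eqI[OF d[OF that]] by simp
  have "Ck_on k S (\<lambda>x. inverse (f x))" using Suc Ck_on_SucD by blast
  then have "Ck_on k S (\<lambda>x. ((-1) * inverse (f x)) *\<^sub>R (inverse (f x) *\<^sub>R dd f h x))" for h
    using Suc.prems Ck_on_linear_image[OF assms(1) bounded_linear_mult_right, of k "\<lambda>x. inverse (f x)" "-1"]
    by (intro Ck_on_scaleR assms(1)) (auto simp: Ck_on_Suc)
  then have "Ck_on k S (dd (\<lambda>x. inverse (f x)) h)" for h
    using Ck_on_cong[OF assms(1), of "dd (\<lambda>x. inverse (f x)) h"] eq by auto
  with d show ?case by (auto simp: Ck_on_Suc differentiable_def)
qed

lemma smooth_on_imp_differentiable: "smooth_on S f \<Longrightarrow> x \<in> S \<Longrightarrow> f differentiable (at x)"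
  unfolding smooth_on_def using Ck_on_Suc[of 0 S f] by blast

lemma smooth_on_has_derivative:
  "smooth_on S f \<Longrightarrow> x \<in> S \<Longrightarrow> (f has_derivative (\<lambda>h. dd f h x)) (at x)"
  by (simp add: has_derivative_dd smooth_on_imp_differentiable)

lemma smooth_on_continuous: "smooth_on S f \<Longrightarrow> x \<in> S \<Longrightarrow> isCont f x"
  using smooth_on_imp_differentiable differentiable_imp_continuous_within by blast

lemma smooth_on_dd: "smooth_on S f \<Longrightarrow> smooth_on S (dd f h)"
  unfolding smooth_on_def using Ck_on_Suc by blast

lemma smooth_on_cong: "open S \<Longrightarrow> (\<And>x. x \<in> S \<Longrightarrow> f x = g x) \<Longrightarrow> smooth_on S f \<longleftrightarrow> smooth_on S g"
  unfolding smooth_on_def using Ck_on_cong by blast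

lemma smooth_on_subset: "smooth_on S f \<Longrightarrow> T \<subseteq> S \<Longrightarrow> smooth_on T f"
  unfolding smooth_on_def using Ck_on_subset by blast

lemma smooth_on_const: "smooth_on S (\<lambda>x. c)"
  by (simp add: smooth_on_def Ck_on_const)

lemma smooth_on_bounded_linear: "bounded_linear T \<Longrightarrow> smooth_on S T"
  by (simp add: smooth_on_def Ck_on_bounded_linear)

lemma smooth_on_linear_image: "open S \<Longrightarrow> bounded_linear T \<Longrightarrow> smooth_on S f \<Longrightarrow> smooth_on S (\<lambda>x. T (f x))"
  by (simp add: smooth_on_def Ck_on_linear_image)

lemma smooth_on_add: "open S \<Longrightarrow> smooth_on S f \<Longrightarrow> smooth_on S g \<Longrightarrow> smooth_on S (\<lambda>x. f x + g x)"
  by (simp add: smooth_on_def Ck_on_add)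

lemma smooth_on_diff: "open S \<Longrightarrow> smooth_on S f \<Longrightarrow> smooth_on S g \<Longrightarrow> smooth_on S (\<lambda>x. f x - g x)"
  using smooth_on_add[of S f "\<lambda>x. - g x"] smooth_on_linear_image[of S uminus g]
  by (simp add: bounded_linear_minus bounded_linear_ident)

lemma smooth_on_sum: "open S \<Longrightarrow> (\<And>i. i \<in> I \<Longrightarrow> smooth_on S (f i)) \<Longrightarrow> smooth_on S (\<lambda>x. \<Sum>i\<in>I. f i x)"
  by (simp add: smooth_on_def Ck_on_sum)

lemma smooth_on_scaleR: "open S \<Longrightarrow> smooth_on S f \<Longrightarrow> smooth_on S g \<Longrightarrow> smooth_on S (\<lambda>x. f x *\<^sub>R g x)"
  by (simp add: smooth_on_def Ck_on_scaleR)

lemma smooth_on_mult: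
  fixes f g :: "'a::euclidean_space \<Rightarrow> real"
  shows "open S \<Longrightarrow> smooth_on S f \<Longrightarrow> smooth_on S g \<Longrightarrow> smooth_on S (\<lambda>x. f x * g x)"
  using smooth_on_scaleR[of S f g] by simp

lemma smooth_on_prod:
  fixes f :: "'i \<Rightarrow> 'a::euclidean_space \<Rightarrow> real"
  assumes "open S" "\<And>i. i \<in> I \<Longrightarrow> smooth_on S (f i)"
  shows "smooth_on S (\<lambda>x. \<Prod>i\<in>I. f i x)"
  using assms(2) by (induction I rule: infinite_finite_induct) (auto intro!: smooth_on_const smooth_on_mult assms(1))

lemma smooth_on_divide:
  fixes f g :: "'a::euclidean_space \<Rightarrow> real"
  assumes "open S" "smooth_on S f" "smooth_on S g" "\<And>x. x \<in> S \<Longrightarrow> g x \<noteq> 0"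
  shows "smooth_on S (\<lambda>x. f x / g x)"
  using smooth_on_mult[of S f "\<lambda>x. inverse (g x)"] Ck_on_inverse[of S g] assms
  by (simp add: smooth_on_def divide_inverse)

lemma smooth_on_compose:
  "open S \<Longrightarrow> f ` S \<subseteq> T \<Longrightarrow> smooth_on T g \<Longrightarrow> smooth_on S f \<Longrightarrow> smooth_on S (\<lambda>x. g (f x))"
  unfolding smooth_on_def using Ck_on_compose[of S f T] by blast

lemma smooth_on_Pair:
  assumes "open S" "smooth_on S f" "smooth_on S g"
  shows "smooth_on S (\<lambda>x. (f x, g x))"
proof -
  have "smooth_on S (\<lambda>x. (f x, 0) + (0, g x))"
    by (intro smooth_on_add assms(1) smooth_on_linear_image[of S "\<lambda>x. (x, 0)"]
        smooth_on_linear_image[of S "\<lambda>x. (0, x)"] assms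
        bounded_linear_Pair bounded_linear_ident bounded_linear_zero)
  then show ?thesis by simp
qed

lemma smooth_on_vec_iff:
  fixes f :: "'a::euclidean_space \<Rightarrow> real ^ 'n"
  assumes "open S"
  shows "smooth_on S f \<longleftrightarrow> (\<forall>i. smooth_on S (\<lambda>x. f x $ i))"
proof
  assume "smooth_on S f"
  then show "\<forall>i. smooth_on S (\<lambda>x. f x $ i)"
    by (intro allI smooth_on_linear_image[of S "\<lambda>v. v $ _"] assms bounded_linear_vec_nth)
next
  assume "\<forall>i. smooth_on S (\<lambda>x. f x $ i)"
  then have "smooth_on S (\<lambda>x. \<Sum>i\<in>UNIV. f x $ i *\<^sub>R (axis i 1 :: real ^ 'n))"
    by (intro smooth_on_sum smooth_on_scaleR smooth_on_const assms) auto
  moreover have "(\<lambda>x. \<Sum>i\<in>UNIV. f x $ i *\<^sub>R (axis i 1 :: real ^ 'n)) = f"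
    by (simp add: basis_expansion flip: scalar_mult_eq_scaleR)
  ultimately show "smooth_on S f" by simp
qed

text \<open>Expanding \<open>u z\<close> over the basis reduces the claim to fixed vectors. This is
  how variable vectors, such as the reference vector itself, are inserted into tensors that are
  known to be smooth for constant arguments only.\<close>

lemma smooth_on_linear_app:
  fixes T :: "'a::euclidean_space \<Rightarrow> 'b::euclidean_space \<Rightarrow> 'c::euclidean_space"
  assumes "open S" "\<And>z. z \<in> S \<Longrightarrow> linear (T z)" "\<And>h. smooth_on S (\<lambda>z. T z h)" "smooth_on S u"
  shows "smooth_on S (\<lambda>z. T z (u z))"
proof -
  have "smooth_on S (\<lambda>z. \<Sum>b\<in>Basis. (u z \<bullet> b) *\<^sub>R T z b)"
    by (intro smooth_on_sum smooth_on_scaleR assms smooth_on_linear_image[OF assms(1) bounded_linear_inner_left])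
  then show ?thesis
    by (rule smooth_on_cong[OF assms(1), THEN iffD1, rotated]) (rule linear_euclidean_sum[OF assms(2), symmetric])
qed

lemma smooth_on_det:
  fixes A :: "'a::euclidean_space \<Rightarrow> real ^ 'n ^ 'n"
  assumes "open S" "\<And>i j. smooth_on S (\<lambda>x. A x $ i $ j)"
  shows "smooth_on S (\<lambda>x. det (A x))"
  unfolding det_def by (intro smooth_on_sum smooth_on_mult smooth_on_prod smooth_on_const assms)

section \<open>Symmetry of second derivatives\<close>

lemma second_difference_mvt:
  fixes f :: "'a::euclidean_space \<Rightarrow> real"
  assumes "open S" "smooth_on S f" "0 < t"
    and "\<And>r s. r \<in> {0..t} \<Longrightarrow> s \<in> {0..t} \<Longrightarrow> z + r *\<^sub>R h + s *\<^sub>R k \<in> S"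
  obtains r s where "r \<in> {0..t}" "s \<in> {0..t}"
    "f (z + t *\<^sub>R h + t *\<^sub>R k) - f (z + t *\<^sub>R h) - f (z + t *\<^sub>R k) + f z =
      t * (t * dd (dd f h) k (z + r *\<^sub>R h + s *\<^sub>R k))"
proof -
  \<comment> \<open>The second difference is \<open>\<phi> t - \<phi> 0\<close>. The mean value
    theorem in \<open>r\<close>, and then in \<open>s\<close> for the resulting difference of
    \<open>dd f h\<close>, turns it into a mixed derivative at an intermediate point.\<close>
  define \<phi> where "\<phi> r = f (z + r *\<^sub>R h + t *\<^sub>R k) - f (z + r *\<^sub>R h)" for r
  have line: "((\<lambda>r. F (w + r *\<^sub>R u)) has_real_derivative dd F u (w + r *\<^sub>R u)) (at r)"
    if "smooth_on S F" "w + r *\<^sub>R u \<in> S" for F :: "'a \<Rightarrow> real" and r u w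
  proof -
    have "((\<lambda>r. w + r *\<^sub>R u) has_derivative (\<lambda>r. r *\<^sub>R u)) (at r)"
      by (auto intro!: derivative_eq_intros)
    from diff_chain_at[OF this smooth_on_has_derivative[OF that]]
    have "((\<lambda>r. F (w + r *\<^sub>R u)) has_derivative (\<lambda>x. dd F (x *\<^sub>R u) (w + r *\<^sub>R u))) (at r)"
      by (simp add: o_def)
    then show ?thesis
      using linear_scale[OF linear_dd[OF smooth_on_imp_differentiable[OF that]]]
      by (simp add: has_field_derivative_def mult_commute_abs)
  qed
  have d1: "(\<phi> has_real_derivative dd f h (z + r *\<^sub>R h + t *\<^sub>R k) - dd f h (z + r *\<^sub>R h)) (at r)"
    if "r \<in> {0..t}" for r
    unfolding \<phi>_def
    using line[OF assms(2), of "z + t *\<^sub>R k" r h] line[OF assms(2), of z r h]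
      assms(4)[of r t] assms(4)[of r 0] that assms(3)
    by (intro DERIV_diff) (auto simp: algebra_simps)
  obtain r where r: "0 < r" "r < t" "\<phi> t - \<phi> 0 = (t - 0) * (dd f h (z + r *\<^sub>R h + t *\<^sub>R k) - dd f h (z + r *\<^sub>R h))"
    using MVT2[OF assms(3), of \<phi> "\<lambda>r. dd f h (z + r *\<^sub>R h + t *\<^sub>R k) - dd f h (z + r *\<^sub>R h)"] d1
    by (metis atLeastAtMost_iff)
  have d2: "((\<lambda>s. dd f h (z + r *\<^sub>R h + s *\<^sub>R k)) has_real_derivative dd (dd f h) k (z + r *\<^sub>R h + s *\<^sub>R k)) (at s)"
    if "s \<in> {0..t}" for s
    using line[OF smooth_on_dd[OF assms(2)], of "z + r *\<^sub>R h" s k h] assms(4)[of r s] r that by auto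
  obtain s where s: "0 < s" "s < t" "dd f h (z + r *\<^sub>R h + t *\<^sub>R k) - dd f h (z + r *\<^sub>R h + 0 *\<^sub>R k) = (t - 0) * dd (dd f h) k (z + r *\<^sub>R h + s *\<^sub>R k)"
    using MVT2[OF assms(3), of "\<lambda>s. dd f h (z + r *\<^sub>R h + s *\<^sub>R k)" "\<lambda>s. dd (dd f h) k (z + r *\<^sub>R h + s *\<^sub>R k)"] d2
    by (metis atLeastAtMost_iff)
  show thesis
    by (rule that[of r s]) (use r s in \<open>auto simp: \<phi>_def\<close>)
qed

text \<open>The second difference is symmetric in \<open>h\<close> and \<open>k\<close>, so the two
  mixed derivatives take a common value, each at some point of a small parallelogram at
  \<open>z\<close>. The two points may differ; continuity of both derivatives closes the gap as the
  parallelogram shrinks.\<close>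

lemma dd_commute_real:
  fixes f :: "'a::euclidean_space \<Rightarrow> real"
  assumes "open S" "smooth_on S f" "z \<in> S"
  shows "dd (dd f h) k z = dd (dd f k) h z"
proof -
  obtain e where e: "e > 0" "ball z e \<subseteq> S" using assms open_contains_ball by blast
  \<comment> \<open>The summand 1 keeps \<open>K\<close> positive when both directions
    vanish.\<close>
  define K where "K = norm h + norm k + 1"
  have K: "K > 0" by (simp add: K_def add_nonneg_pos)
  have near: "dist (z + r *\<^sub>R h + s *\<^sub>R k) z \<le> t * K" if "r \<in> {0..t}" "s \<in> {0..t}" for r s t
  proof -
    have "dist (z + r *\<^sub>R h + s *\<^sub>R k) z = norm (r *\<^sub>R h + s *\<^sub>R k)"
      by (simp add: dist_norm add.assoc)
    also have "\<dots> \<le> r * norm h + s * norm k"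
      using norm_triangle_ineq[of "r *\<^sub>R h" "s *\<^sub>R k"] that by simp
    also have "\<dots> \<le> t * norm h + t * norm k" using that by (intro add_mono mult_right_mono) auto
    also have "\<dots> \<le> t * K" using that by (simp add: K_def algebra_simps)
    finally show ?thesis .
  qed
  have "\<bar>dd (dd f h) k z - dd (dd f k) h z\<bar> \<le> 2 * \<eta>" if "\<eta> > 0" for \<eta> :: real
  proof -
    have "isCont (dd (dd f h) k) z" "isCont (dd (dd f k) h) z"
      using assms smooth_on_continuous smooth_on_dd by blast+
    then obtain d1 d2 where d: "d1 > 0" "d2 > 0"
      "\<And>y. dist y z < d1 \<Longrightarrow> dist (dd (dd f h) k y) (dd (dd f h) k z) < \<eta>"
      "\<And>y. dist y z < d2 \<Longrightarrow> dist (dd (dd f k) h y) (dd (dd f k) h z) < \<eta>"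
      using \<open>\<eta> > 0\<close> unfolding continuous_at_eps_delta by metis
    \<comment> \<open>The factor 2 makes \<open>t * K\<close> strictly smaller than each of the
      three radii.\<close>
    define t where "t = Min {e, d1, d2} / (2 * K)"
    have t: "t > 0" using d e K by (simp add: t_def)
    have tK: "t * K < e" "t * K < d1" "t * K < d2" using d e K by (auto simp: t_def min_def)
    have inS: "z + r *\<^sub>R h + s *\<^sub>R k \<in> S" if "r \<in> {0..t}" "s \<in> {0..t}" for r s
      using near[OF that] tK e(2) by (auto simp: dist_commute)
    obtain r s where rs: "r \<in> {0..t}" "s \<in> {0..t}"
      "f (z + t *\<^sub>R h + t *\<^sub>R k) - f (z + t *\<^sub>R h) - f (z + t *\<^sub>R k) + f z = t * (t * dd (dd f h) k (z + r *\<^sub>R h + s *\<^sub>R k))"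
      using second_difference_mvt[OF assms(1,2) t, of z h k] inS by metis
    have inS': "z + r *\<^sub>R k + s *\<^sub>R h \<in> S" if "r \<in> {0..t}" "s \<in> {0..t}" for r s
      using inS[of s r] that by (simp add: algebra_simps)
    obtain r' s' where rs': "r' \<in> {0..t}" "s' \<in> {0..t}"
      "f (z + t *\<^sub>R k + t *\<^sub>R h) - f (z + t *\<^sub>R k) - f (z + t *\<^sub>R h) + f z = t * (t * dd (dd f k) h (z + r' *\<^sub>R k + s' *\<^sub>R h))"
      using second_difference_mvt[OF assms(1,2) t, of z k h] inS' by metis
    have "t * (t * dd (dd f h) k (z + r *\<^sub>R h + s *\<^sub>R k)) = t * (t * dd (dd f k) h (z + r' *\<^sub>R k + s' *\<^sub>R h))"
      using rs(3) rs'(3) by (simp add: algebra_simps)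
    with t have eq: "dd (dd f h) k (z + r *\<^sub>R h + s *\<^sub>R k) = dd (dd f k) h (z + s' *\<^sub>R h + r' *\<^sub>R k)"
      by (simp add: algebra_simps)
    show ?thesis
      using d(3)[OF order.strict_trans1[OF near[OF rs(1,2)] tK(2)]]
        d(4)[OF order.strict_trans1[OF near[OF rs'(2,1)] tK(3)]] eq
      by (simp add: dist_real_def)
  qed
  \<comment> \<open>A nonzero gap would be at most half of itself.\<close>
  from this[of "\<bar>dd (dd f h) k z - dd (dd f k) h z\<bar> / 4"] show ?thesis by fastforce
qed

lemma dd_linear_image:
  assumes "f differentiable (at z)" "bounded_linear T"
  shows "dd (\<lambda>x. T (f x)) h z = T (dd f h z)"
  by (rule dd_eqI) (rule bounded_linear.has_derivative[OF assms(2) has_derivative_dd[OF assms(1)]])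

lemma dd_commute:
  fixes f :: "'a::euclidean_space \<Rightarrow> 'b::euclidean_space"
  assumes "open S" "smooth_on S f" "z \<in> S"
  shows "dd (dd f h) k z = dd (dd f k) h z"
proof (rule euclidean_eqI)
  fix b :: 'b
  let ?F = "\<lambda>x. f x \<bullet> b"
  have F: "smooth_on S ?F"
    using assms by (intro smooth_on_linear_image[OF _ bounded_linear_inner_left])
  have *: "dd (dd ?F i) j z = dd (dd f i) j z \<bullet> b" for i j
  proof -
    have "dd (dd ?F i) j z = dd (\<lambda>x. dd f i x \<bullet> b) j z"
      by (rule dd_cong_open[OF assms(1,3)])
        (rule dd_linear_image[OF smooth_on_imp_differentiable[OF assms(2)] bounded_linear_inner_left])
    also have "\<dots> = dd (dd f i) j z \<bullet> b"
      by (rule dd_linear_image[OF smooth_on_imp_differentiable[OF smooth_on_dd[OF assms(2)] assms(3)] bounded_linear_inner_left])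
    finally show ?thesis .
  qed
  show "dd (dd f h) k z \<bullet> b = dd (dd f k) h z \<bullet> b"
    using dd_commute_real[OF assms(1) F assms(3), of h k] by (simp add: *)
qed

section \<open>The Koszul formula at a point\<close>

definition gram :: "(real ^ 'n \<Rightarrow> real ^ 'n \<Rightarrow> real) \<Rightarrow> real ^ 'n ^ 'n" where
  "gram g = (\<chi> i j. g (axis i 1) (axis j 1))"

text \<open>Cramer's rule for the vector \<open>S\<close> with \<open>g(Z, S) = \<theta>(Z)\<close> for all \<open>Z\<close>; in this form, smooth dependence on
  parameters is immediate.\<close>

definition sharp :: "(real ^ 'n \<Rightarrow> real ^ 'n \<Rightarrow> real) \<Rightarrow> (real ^ 'n \<Rightarrow> real) \<Rightarrow> real ^ 'n" where
  "sharp g \<theta> = (\<chi> k. det (\<chi> i j. if j = k then \<theta> (axis i 1) else g (axis i 1) (axis j 1)) / det (gram g))"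

lemma linear_eq_axis:
  fixes f h :: "real ^ 'n \<Rightarrow> 'b::real_vector"
  assumes "linear f" "linear h" "\<And>i. f (axis i 1) = h (axis i 1)"
  shows "f = h"
  by (rule linear_eq_stdbasis[OF assms(1,2)]) (auto simp: Basis_vec_def assms(3))

lemma linear_vec_sum:
  fixes f :: "real ^ 'n \<Rightarrow> 'b::real_vector"
  assumes "linear f"
  shows "f x = (\<Sum>i\<in>UNIV. x $ i *\<^sub>R f (axis i 1))"
proof -
  have "f x = f (\<Sum>i\<in>UNIV. x $ i *\<^sub>R axis i 1)"
    by (simp add: basis_expansion flip: scalar_mult_eq_scaleR)
  then show ?thesis by (simp add: linear_sum[OF assms] linear_scale[OF assms])
qed

locale nondegenerate_form =
  fixes g :: "real ^ 'n \<Rightarrow> real ^ 'n \<Rightarrow> real"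
  assumes g_linear: "linear (g Z)" and g_sym: "g u w = g w u"
    and g_nondeg: "(\<And>w. g u w = 0) \<Longrightarrow> u = 0"
begin

lemma g_linear': "linear (\<lambda>u. g u w)"
  using g_linear[of w] by (simp add: g_sym[of _ w])

lemma gram_mult: "(gram g *v u) $ i = g (axis i 1) u"
  unfolding gram_def matrix_vector_mult_def
  using linear_vec_sum[OF g_linear, of "axis i 1" u] by (simp add: mult.commute)

text \<open>A vector in the kernel of the Gram matrix pairs to zero with all basis vectors, hence
  with everything, and is zero by nondegeneracy.\<close>

lemma det_gram_nonzero: "det (gram g) \<noteq> 0"
proof -
  have "u = 0" if "gram g *v u = 0" for u
  proof (rule g_nondeg)
    have "g (axis i 1) u = 0" for i using that gram_mult[of u i] by simp
    then have "(\<lambda>w. g w u) = (\<lambda>w. 0)"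
      by (intro linear_eq_axis g_linear' linear_zero)
    then show "g u w = 0" for w using g_sym by metis
  qed
  then have "invertible (gram g)"
    using matrix_left_invertible_ker[of "gram g"] invertible_left_inverse by blast
  then show ?thesis by (simp add: invertible_det_nz)
qed

lemma g_sharp:
  assumes "linear \<theta>"
  shows "g (sharp g \<theta>) Z = \<theta> Z"
proof -
  have "gram g *v sharp g \<theta> = (\<chi> i. \<theta> (axis i 1))"
    unfolding cramer[OF det_gram_nonzero] sharp_def
    by (simp add: gram_def vec_eq_iff if_distrib cong: if_cong)
  then have "g (axis i 1) (sharp g \<theta>) = \<theta> (axis i 1)" for i
    using gram_mult[of "sharp g \<theta>" i] by simp
  then have "(\<lambda>Z. g Z (sharp g \<theta>)) = \<theta>"
    by (intro linear_eq_axis g_linear' assms)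
  then show ?thesis using g_sym by metis
qed

lemma g_eqI: "(\<And>w. g u w = g v w) \<Longrightarrow> u = v"
  using g_nondeg[of "u - v"] linear_diff[OF g_linear'] by fastforce

end

text \<open>\<open>g\<close> and \<open>C\<close> stand for the fundamental tensor and the Cartan tensor at the reference vector \<open>y\<close>, and
  \<open>q X u w\<close> for the derivative of \<open>g(u, w)\<close> in the direction \<open>X\<close> with the components of \<open>y\<close> held fixed.\<close>

locale cartan_form = nondegenerate_form g
  for g :: "real ^ 'n \<Rightarrow> real ^ 'n \<Rightarrow> real" +
  fixes C q :: "real ^ 'n \<Rightarrow> real ^ 'n \<Rightarrow> real ^ 'n \<Rightarrow> real" and y :: "real ^ 'n"
  assumes C_linear: "linear (C u v)"
    and C_sym: "C u v w = C v u w" "C u v w = C u w v"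
    and C_y: "C y v w = 0"
    and q_linear1: "linear (\<lambda>X. q X u w)" and q_linear: "linear (q X u)"
    and q_sym: "q X u w = q X w u"
begin

lemma q_linear2: "linear (\<lambda>u. q X u w)"
  using q_linear[of X w] by (simp add: q_sym[of X _ w])

lemma C_linear2: "linear (\<lambda>v. C u v w)"
  using C_linear[of u w] by (simp add: C_sym(2)[of u _ w])

lemma C_linear1: "linear (\<lambda>u. C u v w)"
  using C_linear2[of v w] by (simp add: C_sym(1)[of _ v w])

lemma C_y': "C u y w = 0" "C u w y = 0"
  using C_y C_sym by metis+

text \<open>The Koszul formula, in which \<open>nlc\<close> is the map \<open>X \<mapsto> \<nabla>\<^sub>X V\<close> up to the derivative of \<open>V\<close>. As \<open>C\<close> vanishes on \<open>y\<close>,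
  inserting \<open>y\<close> for both arguments determines \<open>nlc y\<close>, and inserting it for the second one determines \<open>nlc\<close>.\<close>

definition "spray = sharp g (\<lambda>Z. q y y Z - q Z y y / 2)"

definition "nlc X = sharp g (\<lambda>Z. (q X y Z + q y Z X - q Z X y) / 2 - C Z X spray)"

definition "gam X Y = sharp g (\<lambda>Z. (q X Y Z + q Y Z X - q Z X Y) / 2
  - C Y Z (nlc X) - C Z X (nlc Y) + C X Y (nlc Z))"

lemmas lin_simps = linear_add[OF g_linear] linear_add[OF g_linear'] linear_scale[OF g_linear] linear_scale[OF g_linear']
  linear_add[OF C_linear] linear_scale[OF C_linear] linear_add[OF C_linear2] linear_scale[OF C_linear2]
  linear_add[OF C_linear1] linear_scale[OF C_linear1]
  linear_add[OF q_linear] linear_scale[OF q_linear] linear_add[OF q_linear2] linear_scale[OF q_linear2]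
  linear_add[OF q_linear1] linear_scale[OF q_linear1]

lemma g_spray: "g spray Z = q y y Z - q Z y y / 2"
  unfolding spray_def by (rule g_sharp) (auto intro!: linearI simp: lin_simps field_simps)

lemma g_nlc: "g (nlc X) Z = (q X y Z + q y Z X - q Z X y) / 2 - C Z X spray"
  unfolding nlc_def by (rule g_sharp) (auto intro!: linearI simp: lin_simps field_simps)

lemma linear_nlc: "linear nlc"
  by (auto intro!: linearI g_eqI simp: lin_simps g_nlc field_simps)

lemmas nlc_simps = lin_simps linear_add[OF linear_nlc] linear_scale[OF linear_nlc]

lemma g_gam: "g (gam X Y) Z = (q X Y Z + q Y Z X - q Z X Y) / 2
  - C Y Z (nlc X) - C Z X (nlc Y) + C X Y (nlc Z)"
  unfolding gam_def by (rule g_sharp) (auto intro!: linearI simp: nlc_simps field_simps)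

lemma linear_gam: "linear (gam X)"
  by (auto intro!: linearI g_eqI simp: nlc_simps g_gam field_simps)

lemma gam_sym: "gam X Y = gam Y X"
  using C_sym q_sym by (intro g_eqI) (simp add: g_gam)

text \<open>For \<open>X = y\<close> the Cartan term has \<open>y\<close> in a slot and drops out,
  and the two equal terms in \<open>q\<close> merge.\<close>

lemma nlc_y: "nlc y = spray"
  by (rule g_eqI) (simp add: g_nlc g_spray C_y' q_sym[of y _ y] field_simps)

text \<open>Two of the three Cartan terms of \<open>g_gam\<close> contain \<open>y\<close>; the
  third contains \<open>nlc y\<close>, which is \<open>spray\<close>. So \<open>nlc\<close>,
  introduced before \<open>gam\<close>, is consistent with it.\<close>

lemma gam_y: "gam X y = nlc X"
  by (rule g_eqI) (simp add: g_nlc g_gam C_y C_y' nlc_y)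

text \<open>Adding the Koszul formulas for \<open>g (gam X Y) Z\<close> and
  \<open>g (gam X Z) Y\<close>, all terms cancel except \<open>q X Y Z\<close> and
  \<open>- 2 * C Y Z (nlc X)\<close>; the latter is compensated by the last summand because of
  \<open>gam_y\<close>.\<close>

lemma gam_compatible: "q X Y Z = g (gam X Y) Z + g Y (gam X Z) + 2 * C (gam X y) Y Z"
proof -
  have "g Y (gam X Z) = g (gam X Z) Y" by (rule g_sym)
  moreover have "C Z Y w = C Y Z w" "C X Y w = C Y X w" "C Z X w = C X Z w" "C w Y Z = C Y Z w" for w
    using C_sym by metis+
  ultimately show ?thesis
    using q_sym by (simp add: g_gam gam_y field_simps)
qed

text \<open>The Koszul formula for \<open>B\<close> still contains \<open>B\<close> in its Cartan
  terms. The identity \<open>C_y\<close> decouples it: first \<open>B y y\<close>, then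
  \<open>B X y\<close>, then \<open>B X Y\<close> is determined.\<close>

lemma gam_unique:
  assumes sym: "\<And>X Y. B X Y = B Y X"
    and comp: "\<And>X Y Z. q X Y Z = g (B X Y) Z + g Y (B X Z) + 2 * C (B X y) Y Z"
  shows "B X Y = gam X Y"
proof -
  \<comment> \<open>This is half of the compatibility for \<open>(X, Y, Z)\<close> plus that for
    \<open>(Y, Z, X)\<close> minus that for \<open>(Z, X, Y)\<close>.\<close>
  have kos: "g (B X Y) Z = (q X Y Z + q Y Z X - q Z X Y) / 2 - C Y Z (B X y) - C Z X (B Y y) + C X Y (B Z y)"
    for X Y Z
  proof -
    have "g X (B Y Z) = g (B Y Z) X" "g Y (B X Z) = g (B Z X) Y" "g X (B Z Y) = g (B Y Z) X" "g Z (B Y X) = g (B X Y) Z"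
      using g_sym sym by metis+
    moreover have "C (B X y) Y Z = C Y Z (B X y)" "C (B Y y) Z X = C Z X (B Y y)" "C (B Z y) X Y = C X Y (B Z y)"
      using C_sym by metis+
    ultimately show ?thesis
      using comp[of X Y Z] comp[of Y Z X] comp[of Z X Y] by (simp add: sym field_simps)
  qed
  \<comment> \<open>With \<open>y\<close> in both places every Cartan term vanishes. With
    \<open>y\<close> in the second place only, the surviving one involves \<open>B y y\<close>, by
    then known.\<close>
  have "B y y = spray"
    by (rule g_eqI) (simp add: kos g_spray C_y C_y' q_sym[of y _ y] field_simps)
  then have N: "B X y = nlc X" for X
    by (intro g_eqI) (simp add: kos g_nlc C_y C_y')
  show ?thesis by (rule g_eqI) (simp add: kos g_gam N)
qed

end

section \<open>Lagrangians in a chart\<close>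

text \<open>The derivative along \<open>w\<close> is the inner one, as in
  \<open>fund_tensor\<close>. Symmetry in \<open>u\<close> and \<open>w\<close> is a theorem, which
  rests on the smoothness of \<open>L\<close>.\<close>

definition fund :: "((real ^ 'n) \<times> (real ^ 'n) \<Rightarrow> real) \<Rightarrow> (real ^ 'n) \<times> (real ^ 'n) \<Rightarrow> real ^ 'n \<Rightarrow> real ^ 'n \<Rightarrow> real" where
  "fund L z u w = dd (dd L (0, w)) (0, u) z / 2"

definition cart ::
  "((real ^ 'n) \<times> (real ^ 'n) \<Rightarrow> real) \<Rightarrow> (real ^ 'n) \<times> (real ^ 'n) \<Rightarrow> real ^ 'n \<Rightarrow> real ^ 'n \<Rightarrow> real ^ 'n \<Rightarrow> real" where
  "cart L z u v w = dd (dd (dd L (0, w)) (0, v)) (0, u) z / 4"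

text \<open>The direction \<open>(X, 0)\<close> freezes the fibre coordinates, so this plays the
  part of \<open>q\<close> in \<open>cartan_form\<close>.\<close>

definition fundx ::
  "((real ^ 'n) \<times> (real ^ 'n) \<Rightarrow> real) \<Rightarrow> (real ^ 'n) \<times> (real ^ 'n) \<Rightarrow> real ^ 'n \<Rightarrow> real ^ 'n \<Rightarrow> real ^ 'n \<Rightarrow> real" where
  "fundx L z X u w = dd (\<lambda>z. fund L z u w) (X, 0) z"

text \<open>The vector with the components \<open>X\<^sup>j Y\<^sup>k \<Gamma>\<^sup>i\<^sub>j\<^sub>k(z)\<close>.\<close>

definition chr ::
  "((real ^ 'n) \<times> (real ^ 'n) \<Rightarrow> real) \<Rightarrow> (real ^ 'n) \<times> (real ^ 'n) \<Rightarrow> real ^ 'n \<Rightarrow> real ^ 'n \<Rightarrow> real ^ 'n" where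
  "chr L z = cartan_form.gam (fund L z) (cart L z) (fundx L z) (snd z)"

text \<open>By Cramer's rule the components are quotients of determinants with smooth entries, and
  the denominator is the nonvanishing Gram determinant.\<close>

lemma smooth_on_sharp:
  assumes "open U" "\<And>z. z \<in> U \<Longrightarrow> nondegenerate_form (g z)"
    and "\<And>u w. smooth_on U (\<lambda>z. g z u w)" "\<And>w. smooth_on U (\<lambda>z. \<theta> z w)"
  shows "smooth_on U (\<lambda>z. sharp (g z) (\<theta> z))"
  unfolding smooth_on_vec_iff[OF assms(1)] sharp_def vec_lambda_beta
proof (intro allI smooth_on_divide smooth_on_det assms(1))
  fix k i j
  show "smooth_on U (\<lambda>z. (\<chi> i j. if j = k then \<theta> z (axis i 1) else g z (axis i 1) (axis j 1)) $ i $ j)"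
    using assms(3,4) by (cases "j = k") simp_all
  show "smooth_on U (\<lambda>z. gram (g z) $ i $ j)"
    using assms(3) by (simp add: gram_def)
qed (use nondegenerate_form.det_gram_nonzero[OF assms(2)] in auto)

locale chart_lagrangian =
  fixes U :: "((real ^ 'n) \<times> (real ^ 'n)) set" and L :: "(real ^ 'n) \<times> (real ^ 'n) \<Rightarrow> real"
  assumes open_U: "open U" and L_smooth: "smooth_on U L"
    and conic: "(x, y) \<in> U \<Longrightarrow> r > 0 \<Longrightarrow> (x, r *\<^sub>R y) \<in> U"
    and homogeneous: "(x, y) \<in> U \<Longrightarrow> r > 0 \<Longrightarrow> L (x, r *\<^sub>R y) = r\<^sup>2 * L (x, y)"
    and fund_nondeg: "z \<in> U \<Longrightarrow> (\<And>w. fund L z u w = 0) \<Longrightarrow> u = 0"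
begin

lemmas dd_smooth = smooth_on_dd[OF L_smooth] smooth_on_dd[OF smooth_on_dd[OF L_smooth]]
  smooth_on_dd[OF smooth_on_dd[OF smooth_on_dd[OF L_smooth]]]

lemma linear_dd_snd: "smooth_on U f \<Longrightarrow> z \<in> U \<Longrightarrow> linear (\<lambda>w. dd f (0, w) z)"
  using linear_compose[of "\<lambda>w. (0, w)" "\<lambda>h. dd f h z"]
    linear_dd[OF smooth_on_imp_differentiable, of U f z] by (simp add: o_def linear_iff)

lemma linear_dd_fst: "smooth_on U f \<Longrightarrow> z \<in> U \<Longrightarrow> linear (\<lambda>w. dd f (w, 0) z)"
  using linear_compose[of "\<lambda>w. (w, 0)" "\<lambda>h. dd f h z"]
    linear_dd[OF smooth_on_imp_differentiable, of U f z] by (simp add: o_def linear_iff)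

lemma smooth_fund: "smooth_on U (\<lambda>z. fund L z u w)"
  unfolding fund_def by (rule smooth_on_linear_image[OF open_U bounded_linear_divide dd_smooth(2)])

lemma smooth_cart: "smooth_on U (\<lambda>z. cart L z u v w)"
  unfolding cart_def by (rule smooth_on_linear_image[OF open_U bounded_linear_divide dd_smooth(3)])

lemma smooth_fundx: "smooth_on U (\<lambda>z. fundx L z X u w)"
  unfolding fundx_def by (rule smooth_on_dd[OF smooth_fund])

lemma fund_sym: "z \<in> U \<Longrightarrow> fund L z u w = fund L z w u"
  unfolding fund_def using dd_commute[OF open_U L_smooth] by simp

lemma dd_fund: "z \<in> U \<Longrightarrow> dd (\<lambda>z. fund L z u w) h z = dd (dd (dd L (0, w)) (0, u)) h z / 2"
  unfolding fund_def
  by (rule dd_linear_image[OF smooth_on_imp_differentiable[OF dd_smooth(2)] bounded_linear_divide])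

lemma dd_fund_snd: "z \<in> U \<Longrightarrow> dd (\<lambda>z. fund L z u w) (0, h) z = 2 * cart L z h u w"
  by (simp add: dd_fund cart_def)

text \<open>The homogeneity identity is differentiated through the fibre dilation. The dilation also
  stretches the vertical direction by \<open>r\<close>, so each vertical derivative divides the
  factor by \<open>r\<close>.\<close>

lemma dd_homogeneous:
  assumes f: "smooth_on U f" and hom: "\<And>x y. (x, y) \<in> U \<Longrightarrow> f (x, r *\<^sub>R y) = c * f (x, y)"
    and r: "r > 0" and z: "(x, y) \<in> U"
  shows "dd f (0, w) (x, r *\<^sub>R y) = c / r * dd f (0, w) (x, y)"
proof -
  let ?m = "\<lambda>z :: (real ^ 'n) \<times> (real ^ 'n). (fst z, r *\<^sub>R snd z)"
  have "(?m has_derivative ?m) (at (x, y))"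
    by (auto intro!: derivative_eq_intros)
  moreover have "(f has_derivative (\<lambda>h. dd f h (?m (x, y)))) (at (?m (x, y)))"
    using smooth_on_has_derivative[OF f conic[OF z r]] by simp
  ultimately have "((\<lambda>z. f (?m z)) has_derivative (\<lambda>h. dd f (?m h) (?m (x, y)))) (at (x, y))"
    using diff_chain_at[of ?m ?m "(x, y)" f] by (simp add: o_def)
  then have "((\<lambda>z. c * f z) has_derivative (\<lambda>h. dd f (?m h) (?m (x, y)))) (at (x, y))"
    by (rule has_derivative_cong_open[OF open_U z, THEN iffD1, rotated]) (auto simp: hom)
  moreover have "((\<lambda>z. c * f z) has_derivative (\<lambda>h. c * dd f h (x, y))) (at (x, y))"
    using has_derivative_mult_right[OF smooth_on_has_derivative[OF f z]] by simp
  ultimately have "(\<lambda>h. dd f (?m h) (?m (x, y))) = (\<lambda>h. c * dd f h (x, y))"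
    by (rule has_derivative_unique)
  then have "dd f (?m h) (?m (x, y)) = c * dd f h (x, y)" for h
    by (rule fun_cong)
  from this[of "(0, w)"] have "dd f (0, r *\<^sub>R w) (x, r *\<^sub>R y) = c * dd f (0, w) (x, y)" by simp
  then show ?thesis
    using linear_scale[OF linear_dd_snd[OF f conic[OF z r]], of r w] r by (simp add: field_simps)
qed

lemma fund_homogeneous: "(x, y) \<in> U \<Longrightarrow> r > 0 \<Longrightarrow> fund L (x, r *\<^sub>R y) u w = fund L (x, y) u w"
proof -
  assume z: "(x, y) \<in> U" and r: "r > 0"
  have "dd (dd L (0, w)) (0, u) (x, r *\<^sub>R y) = r\<^sup>2 / r / r * dd (dd L (0, w)) (0, u) (x, y)"
    by (intro dd_homogeneous dd_smooth L_smooth homogeneous r z)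
  with r show ?thesis by (simp add: fund_def power2_eq_square)
qed

text \<open>Euler's relation: the fundamental tensor is homogeneous of degree 0 in the fibre, hence
  constant along the ray through \<open>y\<close>, and its derivative in the direction
  \<open>y\<close> is twice this Cartan term.\<close>

lemma cart_y: "z \<in> U \<Longrightarrow> cart L z (snd z) v w = 0"
proof -
  assume z: "z \<in> U"
  obtain x y where xy: "z = (x, y)" by (cases z)
  let ?f = "\<lambda>r. fund L (x, y + r *\<^sub>R y) v w"
  have "((\<lambda>r. (x, y + r *\<^sub>R y)) has_derivative (\<lambda>r. (0, r *\<^sub>R y))) (at 0)"
    by (auto intro!: derivative_eq_intros)
  moreover have "((\<lambda>z. fund L z v w) has_derivative (\<lambda>h. dd (\<lambda>z. fund L z v w) h z)) (at (x, y + 0 *\<^sub>R y))"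
    using smooth_on_has_derivative[OF smooth_fund z] xy by simp
  ultimately have "(?f has_derivative (\<lambda>r. dd (\<lambda>z. fund L z v w) (0, r *\<^sub>R y) z)) (at 0)"
    using diff_chain_at[of "\<lambda>r. (x, y + r *\<^sub>R y)" "\<lambda>r. (0, r *\<^sub>R y)" 0 "\<lambda>z. fund L z v w"]
    by (simp add: o_def)
  moreover have "(?f has_derivative (\<lambda>r. 0)) (at 0)"
  \<comment> \<open>For \<open>r > -1\<close> the factor \<open>1 + r\<close> is positive, as
    homogeneity requires.\<close>
  proof (rule has_derivative_transform_within_open[of "\<lambda>r. fund L (x, y) v w" _ _ _ "{-1<..}"])
    fix r :: real assume "r \<in> {-1<..}"
    then show "fund L (x, y) v w = ?f r"
      using fund_homogeneous[of x y "1 + r" v w] z xy by (simp add: scaleR_add_left)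
  qed auto
  ultimately have "(\<lambda>r. dd (\<lambda>z. fund L z v w) (0, r *\<^sub>R y) z) = (\<lambda>r. 0)"
    by (rule has_derivative_unique)
  then show ?thesis
    using fun_cong[of _ _ 1] z xy by (fastforce simp: dd_fund_snd)
qed

lemma nondegenerate_form_fund: "z \<in> U \<Longrightarrow> nondegenerate_form (fund L z)"
proof (rule nondegenerate_form.intro)
  fix Z u w assume z: "z \<in> U"
  show "linear (fund L z Z)"
    using linear_compose[OF linear_dd_snd[OF dd_smooth(1) z] bounded_linear.linear[OF bounded_linear_divide[of 2]], of "(0, Z)"]
    by (subst fund_sym[OF z, abs_def]) (simp add: o_def fund_def)
  show "fund L z u w = fund L z w u" by (rule fund_sym[OF z])
  show "u = 0" if "\<And>w. fund L z u w = 0" using fund_nondeg[OF z that] .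
qed

lemma linear_cart: "z \<in> U \<Longrightarrow> linear (\<lambda>u. cart L z u v w)"
  using linear_compose[OF linear_dd_snd[OF dd_smooth(2)] bounded_linear.linear[OF bounded_linear_divide[of 4]], of z]
  by (simp add: o_def cart_def)

lemma cart_sym:
  assumes z: "z \<in> U"
  shows "cart L z u v w = cart L z v u w" "cart L z u v w = cart L z u w v"
proof -
  show "cart L z u v w = cart L z v u w"
    unfolding cart_def using dd_commute[OF open_U dd_smooth(1) z] by simp
  have "dd (dd (dd L (0, w)) (0, v)) (0, u) z = dd (dd (dd L (0, v)) (0, w)) (0, u) z"
    by (rule dd_cong_open[OF open_U z]) (rule dd_commute[OF open_U L_smooth])
  then show "cart L z u v w = cart L z u w v" by (simp add: cart_def)
qed

lemma fundx_sym: "z \<in> U \<Longrightarrow> fundx L z X u w = fundx L z X w u"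
  unfolding fundx_def by (rule dd_cong_open[OF open_U]) (auto intro: fund_sym)

text \<open>In the definition \<open>w\<close> is the direction of an inner derivative, where
  linearity is not visible. Commuting derivatives makes it the outermost direction, and a Frechet
  derivative is linear in its direction.\<close>

lemma linear_fundx: "z \<in> U \<Longrightarrow> linear (fundx L z X u)"
proof -
  assume z: "z \<in> U"
  have "fundx L z X u = (\<lambda>w. dd (dd (dd L (0, u)) (X, 0)) (0, w) z / 2)"
  proof
    fix w
    have "fundx L z X u w = dd (dd (dd L (0, u)) (0, w)) (X, 0) z / 2"
      unfolding fundx_sym[OF z, of X u w] unfolding fundx_def by (rule dd_fund[OF z])
    then show "fundx L z X u w = dd (dd (dd L (0, u)) (X, 0)) (0, w) z / 2"
      by (simp only: dd_commute[OF open_U dd_smooth(1) z, of "(0, u)" "(0, w)"])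
  qed
  then show ?thesis
    using linear_compose[OF linear_dd_snd[OF dd_smooth(2) z] bounded_linear.linear[OF bounded_linear_divide[of 2]]]
    by (simp add: o_def)
qed

lemma linear_fundx1: "z \<in> U \<Longrightarrow> linear (\<lambda>X. fundx L z X u w)"
  unfolding fundx_def by (rule linear_dd_fst[OF smooth_fund])

lemma cartan_form: "z \<in> U \<Longrightarrow> cartan_form (fund L z) (cart L z) (fundx L z) (snd z)"
proof (intro cartan_form.intro cartan_form_axioms.intro nondegenerate_form_fund)
  fix u v w X assume z: "z \<in> U"
  have "cart L z u v = (\<lambda>w. cart L z w u v)"
    using cart_sym[OF z] by (intro ext) metis
  then show "linear (cart L z u v)" using linear_cart[OF z, of u v] by simp
qed (auto intro: cart_sym cart_y fundx_sym linear_fundx linear_fundx1)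

lemmas linear_chr = cartan_form.linear_gam[OF cartan_form, folded chr_def]
lemmas chr_sym = cartan_form.gam_sym[OF cartan_form, folded chr_def]
lemmas chr_compatible = cartan_form.gam_compatible[OF cartan_form, folded chr_def]
lemmas chr_unique = cartan_form.gam_unique[OF cartan_form, folded chr_def]

text \<open>Smoothness follows the construction \<open>spray\<close>, \<open>nlc\<close>,
  \<open>gam\<close>: \<open>smooth_on_sharp\<close> handles each solution of a linear system, and
  \<open>smooth_on_linear_app\<close> inserts the reference vector and the earlier solutions one
  slot at a time.\<close>

lemma smooth_chr: "smooth_on U (\<lambda>z. chr L z X Y)"
proof -
  have snd: "smooth_on U snd"
    by (rule smooth_on_bounded_linear[OF bounded_linear_snd])
  note lin = cartan_form.q_linear[OF cartan_form] cartan_form.q_linear1[OF cartan_form] cartan_form.q_linear2[OF cartan_form]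
    cartan_form.C_linear[OF cartan_form] cartan_form.C_linear2[OF cartan_form] cartan_form.C_linear1[OF cartan_form]
  note [intro!] = open_U lin smooth_fund smooth_cart smooth_fundx snd smooth_on_diff smooth_on_add
    smooth_on_sharp nondegenerate_form_fund smooth_on_linear_image[OF open_U bounded_linear_divide]
  have q2: "smooth_on U (\<lambda>z. fundx L z X (snd z) w)" for X w
    by (rule smooth_on_linear_app) auto
  have q3: "smooth_on U (\<lambda>z. fundx L z X w (snd z))" for X w
    by (rule smooth_on_linear_app) auto
  have q1: "smooth_on U (\<lambda>z. fundx L z (snd z) u w)" for u w
    by (rule smooth_on_linear_app[where T = "\<lambda>z X. fundx L z X u w"]) auto
  have q12: "smooth_on U (\<lambda>z. fundx L z (snd z) (snd z) w)" for w
    by (rule smooth_on_linear_app[where T = "\<lambda>z X. fundx L z X (snd z) w"]) (auto intro: q2)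
  have q23: "smooth_on U (\<lambda>z. fundx L z X (snd z) (snd z))" for X
    by (rule smooth_on_linear_app[where T = "\<lambda>z Y. fundx L z X (snd z) Y"]) (auto intro: q2)
  have S: "smooth_on U (\<lambda>z. cartan_form.spray (fund L z) (fundx L z) (snd z))"
    using q12 q23 by (subst smooth_on_cong[OF open_U cartan_form.spray_def[OF cartan_form]]) auto
  have N: "smooth_on U (\<lambda>z. cartan_form.nlc (fund L z) (cart L z) (fundx L z) (snd z) X)" for X
  proof (subst smooth_on_cong[OF open_U cartan_form.nlc_def[OF cartan_form]])
    have "smooth_on U (\<lambda>z. cart L z w X (cartan_form.spray (fund L z) (fundx L z) (snd z)))" for w
      by (rule smooth_on_linear_app) (auto intro: S)
    then show "smooth_on U (\<lambda>z. sharp (fund L z) (\<lambda>Z. (fundx L z X (snd z) Z + fundx L z (snd z) Z X - fundx L z Z X (snd z)) / 2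
        - cart L z Z X (cartan_form.spray (fund L z) (fundx L z) (snd z))))"
      using q1 q2 q3 by auto
  qed auto
  have CN: "smooth_on U (\<lambda>z. cart L z u v (cartan_form.nlc (fund L z) (cart L z) (fundx L z) (snd z) w))" for u v w
    by (rule smooth_on_linear_app) (auto intro: N)
  show ?thesis
    unfolding chr_def
    using CN by (subst smooth_on_cong[OF open_U cartan_form.gam_def[OF cartan_form]]) auto
qed

end

section \<open>Charts and tangent vectors\<close>

lemma tcomp_simps [simp]:
  "tcomp 0 c = 0" "tcomp (v + w) c = tcomp v c + tcomp w c" "tcomp (- v) c = - tcomp v c"
  "tcomp (v - w) c = tcomp v c - tcomp w c" "tcomp (r *\<^sub>R v) c = r *\<^sub>R tcomp v c"
  by (simp_all add: zero_tvec_def plus_tvec_def uminus_tvec_def minus_tvec_def scaleR_tvec_def)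

locale pseudo_finsler_manifold =
  fixes F :: "('m::{t2_space,second_countable_topology}, 'n::finite) finsler"
  assumes pseudo_finsler: "pseudo_finsler F"
begin

abbreviation trans :: "('m, 'n) chart \<Rightarrow> ('m, 'n) chart \<Rightarrow> real ^ 'n \<Rightarrow> real ^ 'n" where
  "trans c c' \<equiv> cmap c' \<circ> cinv c"

lemma atlas: "smooth_atlas (atlas F)"
  using pseudo_finsler by (simp add: pseudo_finsler_def)

lemma in_charts_at: "c \<in> charts_at F p \<longleftrightarrow> c \<in> atlas F \<and> p \<in> cdom c"
  by (simp add: charts_at_def)

lemma chart_at_in: "chart_at F p \<in> charts_at F p"
proof -
  have "\<exists>c. c \<in> charts_at F p" using atlas unfolding smooth_atlas_def in_charts_at by blast
  then show ?thesis unfolding chart_at_def by (rule someI_ex)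
qed

lemma chart_homeomorphism: "c \<in> atlas F \<Longrightarrow> homeomorphism (cdom c) (cmap c ` cdom c) (cmap c) (cinv c)"
  using atlas by (simp add: smooth_atlas_def)

lemma open_cdom: "c \<in> atlas F \<Longrightarrow> open (cdom c)"
  using atlas by (simp add: smooth_atlas_def)

lemma cinv_cmap: "c \<in> charts_at F p \<Longrightarrow> cinv c (cmap c p) = p"
  using chart_homeomorphism by (auto simp: in_charts_at homeomorphism_def)

lemma cmap_cinv: "c \<in> atlas F \<Longrightarrow> x \<in> cmap c ` cdom c \<Longrightarrow> cmap c (cinv c x) = x"
  using chart_homeomorphism by (fastforce simp: homeomorphism_def)

lemma cinv_in: "c \<in> atlas F \<Longrightarrow> x \<in> cmap c ` (cdom c \<inter> \<Omega>) \<Longrightarrow> cinv c x \<in> cdom c \<inter> \<Omega>"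
  by (auto simp del: split_paired_All simp: cinv_cmap[unfolded in_charts_at])

lemma open_cmap_image: "c \<in> atlas F \<Longrightarrow> open \<Omega> \<Longrightarrow> open (cmap c ` (cdom c \<inter> \<Omega>))"
proof -
  assume c: "c \<in> atlas F" and \<Omega>: "open \<Omega>"
  have "openin (top_of_set (cmap c ` cdom c)) (cmap c ` (cdom c \<inter> \<Omega>))"
    using homeomorphism_imp_open_map[OF chart_homeomorphism[OF c]] \<Omega> by (simp add: openin_open_Int)
  moreover have "open (cmap c ` cdom c)" using c atlas by (simp add: smooth_atlas_def)
  ultimately show ?thesis by (simp add: openin_open_eq)
qed

lemma smooth_trans:
  "c \<in> atlas F \<Longrightarrow> c' \<in> atlas F \<Longrightarrow> smooth_on (cmap c ` (cdom c \<inter> cdom c')) (trans c c')"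
  using atlas by (simp add: smooth_atlas_def)

lemma trans_differentiable:
  "c \<in> charts_at F p \<Longrightarrow> c' \<in> charts_at F p \<Longrightarrow> trans c c' differentiable (at (cmap c p))"
  using smooth_trans by (intro smooth_on_imp_differentiable[of "cmap c ` (cdom c \<inter> cdom c')"]) (auto simp: in_charts_at)

lemma has_derivative_trans:
  "c \<in> charts_at F p \<Longrightarrow> c' \<in> charts_at F p \<Longrightarrow>
    (trans c c' has_derivative (\<lambda>h. dd (trans c c') h (cmap c p))) (at (cmap c p))"
  by (intro has_derivative_dd trans_differentiable)

lemma linear_dd_trans:
  "c \<in> charts_at F p \<Longrightarrow> c' \<in> charts_at F p \<Longrightarrow> linear (\<lambda>h. dd (trans c c') h (cmap c p))"
  by (intro linear_dd trans_differentiable)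

text \<open>The chain rule for \<open>(f \<circ> cinv c') \<circ> trans c c'\<close>, which agrees
  with \<open>f \<circ> cinv c\<close> only over the overlap of the two charts; the overlap is open,
  and this is enough.\<close>

lemma dd_change_chart:
  fixes f :: "'m \<Rightarrow> 'b::euclidean_space"
  assumes "c \<in> charts_at F p" "c' \<in> charts_at F p" "(f \<circ> cinv c') differentiable (at (cmap c' p))"
  shows "dd (f \<circ> cinv c) h (cmap c p) = dd (f \<circ> cinv c') (dd (trans c c') h (cmap c p)) (cmap c' p)"
proof -
  have "((f \<circ> cinv c') has_derivative (\<lambda>h. dd (f \<circ> cinv c') h (cmap c' p))) (at (trans c c' (cmap c p)))"
    using has_derivative_dd[OF assms(3)] assms(1) by (simp add: cinv_cmap)
  from diff_chain_at[OF has_derivative_trans[OF assms(1,2)] this]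
  have "((f \<circ> cinv c') \<circ> trans c c' has_derivative (\<lambda>h. dd (f \<circ> cinv c') (dd (trans c c') h (cmap c p)) (cmap c' p))) (at (cmap c p))"
    by (simp add: o_def)
  then have "((f \<circ> cinv c) has_derivative (\<lambda>h. dd (f \<circ> cinv c') (dd (trans c c') h (cmap c p)) (cmap c' p))) (at (cmap c p))"
  proof (rule has_derivative_transform_within_open)
    show "open (cmap c ` (cdom c \<inter> cdom c'))"
      using assms open_cmap_image open_cdom by (simp add: in_charts_at)
    show "cmap c p \<in> cmap c ` (cdom c \<inter> cdom c')" using assms by (auto simp: in_charts_at)
    fix x assume "x \<in> cmap c ` (cdom c \<inter> cdom c')"
    then have "c' \<in> charts_at F (cinv c x)"
      using assms cinv_in[of c x "cdom c'"] by (simp add: in_charts_at)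
    then show "((f \<circ> cinv c') \<circ> trans c c') x = (f \<circ> cinv c) x"
      by (simp add: cinv_cmap)
  qed
  then show "dd (f \<circ> cinv c) h (cmap c p) = dd (f \<circ> cinv c') (dd (trans c c') h (cmap c p)) (cmap c' p)"
    by (rule dd_eqI)
qed

lemma dd_trans_trans:
  assumes "c \<in> charts_at F p" "c' \<in> charts_at F p" "c'' \<in> charts_at F p"
  shows "dd (trans c' c'') (dd (trans c c') h (cmap c p)) (cmap c' p) = dd (trans c c'') h (cmap c p)"
  using dd_change_chart[OF assms(1,2) trans_differentiable[OF assms(2,3)]] by simp

lemma dd_trans_self:
  assumes "c \<in> charts_at F p"
  shows "dd (trans c c) h (cmap c p) = h"
proof -
  have "((\<lambda>x. x) has_derivative (\<lambda>h. h)) (at (cmap c p))" by (rule has_derivative_ident)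
  then have "(trans c c has_derivative (\<lambda>h. h)) (at (cmap c p))"
    by (rule has_derivative_transform_within_open[of _ _ _ _ "cmap c ` (cdom c \<inter> UNIV)"])
      (use assms open_cmap_image[of c UNIV] cmap_cinv in \<open>auto simp: in_charts_at\<close>)
  then show ?thesis by (rule dd_eqI)
qed

lemma tcomp_vec_of: "c' \<in> charts_at F p \<Longrightarrow> tcomp (vec_of F c p y) c' = dd (trans c c') y (cmap c p)"
  by (simp add: vec_of_def dd_def)

lemma tcomp_vec_of_self [simp]: "c \<in> charts_at F p \<Longrightarrow> tcomp (vec_of F c p y) c = y"
  by (simp add: tcomp_vec_of dd_trans_self)

lemma tangent_space_iff:
  "v \<in> tangent_space F p \<longleftrightarrow> (\<forall>c. c \<notin> charts_at F p \<longrightarrow> tcomp v c = 0) \<and>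
    (\<forall>c\<in>charts_at F p. \<forall>c'\<in>charts_at F p. tcomp v c' = dd (trans c c') (tcomp v c) (cmap c p))"
  unfolding tangent_space_def dd_def by simp

lemma tangent_spaceI:
  assumes "\<And>c. c \<notin> charts_at F p \<Longrightarrow> tcomp v c = 0"
    and "\<And>c c'. c \<in> charts_at F p \<Longrightarrow> c' \<in> charts_at F p \<Longrightarrow> tcomp v c' = dd (trans c c') (tcomp v c) (cmap c p)"
  shows "v \<in> tangent_space F p"
  unfolding tangent_space_iff using assms by blast

lemma vec_of_tangent: "c \<in> charts_at F p \<Longrightarrow> vec_of F c p y \<in> tangent_space F p"
  by (auto simp: tangent_space_iff tcomp_vec_of dd_trans_trans) (simp add: vec_of_def)

lemma tcomp_tangent:
  "v \<in> tangent_space F p \<Longrightarrow> c \<in> charts_at F p \<Longrightarrow> c' \<in> charts_at F p \<Longrightarrow>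
    tcomp v c' = dd (trans c c') (tcomp v c) (cmap c p)"
  unfolding tangent_space_iff by blast

lemma tcomp_outside: "v \<in> tangent_space F p \<Longrightarrow> c \<notin> charts_at F p \<Longrightarrow> tcomp v c = 0"
  unfolding tangent_space_iff by blast

text \<open>The transition rule fixes all components of a tangent vector from those in one chart.
  Equations between tangent vectors are reduced to a single convenient chart in this way.\<close>

lemma tangent_eqI:
  assumes "v \<in> tangent_space F p" "w \<in> tangent_space F p" "c \<in> charts_at F p" "tcomp v c = tcomp w c"
  shows "v = w"
proof (rule tvec.expand, rule ext)
  fix c'
  show "tcomp v c' = tcomp w c'"
    using tcomp_tangent[OF assms(1,3)] tcomp_tangent[OF assms(2,3)] assms(4)
      tcomp_outside[OF assms(1)] tcomp_outside[OF assms(2)] by (cases "c' \<in> charts_at F p") auto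
qed

lemma vec_of_tcomp: "v \<in> tangent_space F p \<Longrightarrow> c \<in> charts_at F p \<Longrightarrow> vec_of F c p (tcomp v c) = v"
  by (rule tangent_eqI) (auto intro: vec_of_tangent)

lemma tangent_space_zero: "0 \<in> tangent_space F p"
  by (rule tangent_spaceI) (simp_all add: linear_0[OF linear_dd_trans])

lemma tangent_space_add: "v \<in> tangent_space F p \<Longrightarrow> w \<in> tangent_space F p \<Longrightarrow> v + w \<in> tangent_space F p"
proof (rule tangent_spaceI)
  fix c c'
  assume "v \<in> tangent_space F p" "w \<in> tangent_space F p" "c \<in> charts_at F p" "c' \<in> charts_at F p"
  then show "tcomp (v + w) c' = dd (trans c c') (tcomp (v + w) c) (cmap c p)"
    using tcomp_tangent[of v p c c'] tcomp_tangent[of w p c c'] by (simp add: linear_add[OF linear_dd_trans])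
qed (simp add: tcomp_outside)

lemma tangent_space_diff: "v \<in> tangent_space F p \<Longrightarrow> w \<in> tangent_space F p \<Longrightarrow> v - w \<in> tangent_space F p"
proof (rule tangent_spaceI)
  fix c c'
  assume "v \<in> tangent_space F p" "w \<in> tangent_space F p" "c \<in> charts_at F p" "c' \<in> charts_at F p"
  then show "tcomp (v - w) c' = dd (trans c c') (tcomp (v - w) c) (cmap c p)"
    using tcomp_tangent[of v p c c'] tcomp_tangent[of w p c c'] by (simp add: linear_diff[OF linear_dd_trans])
qed (simp add: tcomp_outside)

lemma tangent_space_scaleR: "v \<in> tangent_space F p \<Longrightarrow> r *\<^sub>R v \<in> tangent_space F p"
proof (rule tangent_spaceI)
  fix c c'
  assume "v \<in> tangent_space F p" "c \<in> charts_at F p" "c' \<in> charts_at F p"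
  then show "tcomp (r *\<^sub>R v) c' = dd (trans c c') (tcomp (r *\<^sub>R v) c) (cmap c p)"
    using tcomp_tangent[of v p c c'] by (simp add: linear_scale[OF linear_dd_trans])
qed (simp add: tcomp_outside)

lemma vec_of_scaleR: "c \<in> charts_at F p \<Longrightarrow> vec_of F c p (r *\<^sub>R y) = r *\<^sub>R vec_of F c p y"
  by (rule tangent_eqI) (auto intro: vec_of_tangent tangent_space_scaleR)

text \<open>Frees \<open>vf_apply\<close> from the chart \<open>chart_at\<close>: the components of
  \<open>X p\<close> and the derivative of \<open>f\<close> change by inverse rules.\<close>

lemma vf_apply_chart:
  assumes "c \<in> charts_at F p" "X p \<in> tangent_space F p" "(f \<circ> cinv c) differentiable (at (cmap c p))"
  shows "vf_apply F X f p = dd (f \<circ> cinv c) (tcomp (X p) c) (cmap c p)"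
  using dd_change_chart[OF chart_at_in assms(1,3)] tcomp_tangent[OF assms(2) chart_at_in assms(1)]
  by (simp add: vf_apply_def Let_def dd_def)

lemma adm_tangent: "(p, v) \<in> adm F \<Longrightarrow> v \<in> tangent_space F p"
  using pseudo_finsler by (auto simp: pseudo_finsler_def)

lemma adm_in_iff:
  assumes "c \<in> charts_at F p"
  shows "(cmap c p, y) \<in> adm_in F c \<longleftrightarrow> (p, vec_of F c p y) \<in> adm F"
  using assms by (auto simp: adm_in_def cinv_cmap in_charts_at)

lemma adm_inD: "(p, v) \<in> adm F \<Longrightarrow> c \<in> charts_at F p \<Longrightarrow> (cmap c p, tcomp v c) \<in> adm_in F c"
  by (simp add: adm_in_iff vec_of_tcomp adm_tangent)

lemma adm_inE:
  assumes "c \<in> atlas F" "(x, y) \<in> adm_in F c"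
  obtains p where "c \<in> charts_at F p" "x = cmap c p" "(p, vec_of F c p y) \<in> adm F"
proof -
  from assms obtain p where p: "p \<in> cdom c" "x = cmap c p" by (auto simp: adm_in_def)
  with assms have "c \<in> charts_at F p" by (simp add: in_charts_at)
  with that p assms show thesis using adm_in_iff by blast
qed

lemma open_adm_in: "c \<in> atlas F \<Longrightarrow> open (adm_in F c)"
  and smooth_lagr_in: "c \<in> atlas F \<Longrightarrow> smooth_on (adm_in F c) (lagr_in F c)"
  using pseudo_finsler by (auto simp: pseudo_finsler_def)

lemma lagr_eq_lagr_in:
  "v \<in> tangent_space F p \<Longrightarrow> c \<in> charts_at F p \<Longrightarrow> lagr F p v = lagr_in F c (cmap c p, tcomp v c)"
  by (simp add: lagr_in_def cinv_cmap vec_of_tcomp)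

end

section \<open>The fundamental and Cartan tensors as iterated derivatives in a chart\<close>

lemma deriv_line:
  fixes f :: "'a::euclidean_space \<Rightarrow> real"
  assumes "f differentiable (at z)"
  shows "deriv (\<lambda>s. f (z + s *\<^sub>R w)) 0 = dd f w z"
proof -
  have "((\<lambda>r. z + r *\<^sub>R w) has_derivative (\<lambda>r. r *\<^sub>R w)) (at 0)"
    by (auto intro!: derivative_eq_intros)
  from diff_chain_at[OF this, of f "\<lambda>h. dd f h z"]
  have "((\<lambda>r. f (z + r *\<^sub>R w)) has_derivative (\<lambda>r. dd f (r *\<^sub>R w) z)) (at 0)"
    using has_derivative_dd[OF assms] by (simp add: o_def)
  then have "((\<lambda>r. f (z + r *\<^sub>R w)) has_real_derivative dd f w z) (at 0)"
    unfolding linear_scale[OF linear_dd[OF assms]] by (simp add: has_field_derivative_def mult_commute_abs)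
  then show ?thesis by (rule DERIV_imp_deriv)
qed

lemma eventually_line:
  fixes z w :: "'a::real_normed_vector"
  assumes "open U" "z \<in> U"
  shows "\<forall>\<^sub>F t in nhds (0::real). z + t *\<^sub>R w \<in> U"
proof -
  have "((\<lambda>t::real. z + t *\<^sub>R w) \<longlongrightarrow> z + 0 *\<^sub>R w) (nhds 0)"
    by (intro tendsto_intros filterlim_ident)
  then show ?thesis using assms by (auto dest: topological_tendstoD)
qed

text \<open>The inner derivative is identified only while \<open>z + t *\<^sub>R u\<close> stays in
  \<open>U\<close>, that is for \<open>t\<close> near 0; the outer \<open>deriv\<close> depends on
  nothing else.\<close>

lemma deriv2_line:
  fixes f :: "'a::euclidean_space \<Rightarrow> real"
  assumes "open U" "smooth_on U f" "z \<in> U"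
  shows "deriv (\<lambda>t. deriv (\<lambda>s. f (z + t *\<^sub>R u + s *\<^sub>R w)) 0) 0 = dd (dd f w) u z"
proof -
  have "\<forall>\<^sub>F t in nhds 0. deriv (\<lambda>s. f (z + t *\<^sub>R u + s *\<^sub>R w)) 0 = dd f w (z + t *\<^sub>R u)"
    using eventually_line[OF assms(1,3)] by eventually_elim (intro deriv_line smooth_on_imp_differentiable[OF assms(2)])
  then have "deriv (\<lambda>t. deriv (\<lambda>s. f (z + t *\<^sub>R u + s *\<^sub>R w)) 0) 0 = deriv (\<lambda>t. dd f w (z + t *\<^sub>R u)) 0"
    by (intro deriv_cong_ev) auto
  then show ?thesis
    by (simp add: deriv_line smooth_on_imp_differentiable[OF smooth_on_dd[OF assms(2)] assms(3)])
qed

lemma deriv3_line: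
  fixes f :: "'a::euclidean_space \<Rightarrow> real"
  assumes "open U" "smooth_on U f" "z \<in> U"
  shows "deriv (\<lambda>r. deriv (\<lambda>t. deriv (\<lambda>s. f (z + r *\<^sub>R v + t *\<^sub>R u + s *\<^sub>R w)) 0) 0) 0 =
    dd (dd (dd f w) u) v z"
proof -
  have "\<forall>\<^sub>F r in nhds 0. deriv (\<lambda>t. deriv (\<lambda>s. f (z + r *\<^sub>R v + t *\<^sub>R u + s *\<^sub>R w)) 0) 0 = dd (dd f w) u (z + r *\<^sub>R v)"
    using eventually_line[OF assms(1,3)] by eventually_elim (intro deriv2_line[OF assms(1,2)])
  then have "deriv (\<lambda>r. deriv (\<lambda>t. deriv (\<lambda>s. f (z + r *\<^sub>R v + t *\<^sub>R u + s *\<^sub>R w)) 0) 0) 0 =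
      deriv (\<lambda>r. dd (dd f w) u (z + r *\<^sub>R v)) 0"
    by (intro deriv_cong_ev) auto
  then show ?thesis
    by (simp add: deriv_line smooth_on_imp_differentiable[OF smooth_on_dd[OF smooth_on_dd[OF assms(2)]] assms(3)])
qed

context pseudo_finsler_manifold
begin

lemma fund_tensor_chart:
  assumes "(p, v) \<in> adm F" "c \<in> charts_at F p" "u \<in> tangent_space F p" "w \<in> tangent_space F p"
  shows "fund_tensor F p v u w = fund (lagr_in F c) (cmap c p, tcomp v c) (tcomp u c) (tcomp w c)"
proof -
  have c: "c \<in> atlas F" using assms by (simp add: in_charts_at)
  have "lagr F p (v + t *\<^sub>R u + s *\<^sub>R w) = lagr_in F c (cmap c p, tcomp v c + t *\<^sub>R tcomp u c + s *\<^sub>R tcomp w c)" for t s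
    using lagr_eq_lagr_in[OF _ assms(2)] adm_tangent[OF assms(1)] assms
    by (simp add: tangent_space_add tangent_space_scaleR)
  then show ?thesis
    using deriv2_line[OF open_adm_in[OF c] smooth_lagr_in[OF c] adm_inD[OF assms(1,2)], of "(0, tcomp u c)" "(0, tcomp w c)"]
    by (simp add: fund_tensor_def fund_def)
qed

lemma cartan_tensor_chart:
  assumes "(p, v) \<in> adm F" "c \<in> charts_at F p"
    and "w1 \<in> tangent_space F p" "w2 \<in> tangent_space F p" "w3 \<in> tangent_space F p"
  shows "cartan_tensor F p v w1 w2 w3 =
    cart (lagr_in F c) (cmap c p, tcomp v c) (tcomp w1 c) (tcomp w2 c) (tcomp w3 c)"
proof -
  have c: "c \<in> atlas F" using assms by (simp add: in_charts_at)
  have "lagr F p (v + r *\<^sub>R w1 + t *\<^sub>R w2 + s *\<^sub>R w3) =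
      lagr_in F c (cmap c p, tcomp v c + r *\<^sub>R tcomp w1 c + t *\<^sub>R tcomp w2 c + s *\<^sub>R tcomp w3 c)" for r t s
    using lagr_eq_lagr_in[OF _ assms(2)] adm_tangent[OF assms(1)] assms
    by (simp add: tangent_space_add tangent_space_scaleR)
  then show ?thesis
    using deriv3_line[OF open_adm_in[OF c] smooth_lagr_in[OF c] adm_inD[OF assms(1,2)],
        of "(0, tcomp w1 c)" "(0, tcomp w2 c)" "(0, tcomp w3 c)"]
    by (simp add: cartan_tensor_def cart_def)
qed

lemma chart_lagrangian:
  assumes c: "c \<in> atlas F"
  shows "chart_lagrangian (adm_in F c) (lagr_in F c)"
proof (rule chart_lagrangian.intro)
  show "open (adm_in F c)" "smooth_on (adm_in F c) (lagr_in F c)"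
    using c open_adm_in smooth_lagr_in by auto
next
  fix x y and r :: real assume xy: "(x, y) \<in> adm_in F c" and r: "r > 0"
  obtain p where p: "c \<in> charts_at F p" "x = cmap c p" "(p, vec_of F c p y) \<in> adm F"
    using adm_inE[OF c xy] .
  then show "(x, r *\<^sub>R y) \<in> adm_in F c"
    using pseudo_finsler r by (auto simp: adm_in_iff vec_of_scaleR pseudo_finsler_def)
  have "lagr F p (r *\<^sub>R vec_of F c p y) = r\<^sup>2 * lagr F p (vec_of F c p y)"
    using pseudo_finsler r p(3) by (auto simp: pseudo_finsler_def)
  then show "lagr_in F c (x, r *\<^sub>R y) = r\<^sup>2 * lagr_in F c (x, y)"
    using p by (simp add: lagr_in_def cinv_cmap vec_of_scaleR)
next
  fix z u assume z: "z \<in> adm_in F c" and u: "\<And>w. fund (lagr_in F c) z u w = 0"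
  obtain x y where xy: "z = (x, y)" by (cases z)
  obtain p where p: "c \<in> charts_at F p" "x = cmap c p" "(p, vec_of F c p y) \<in> adm F"
    using adm_inE[OF c] z xy by metis
  have "fund_tensor F p (vec_of F c p y) (vec_of F c p u) w = 0" if "w \<in> tangent_space F p" for w
    using u p xy that by (simp add: fund_tensor_chart vec_of_tangent)
  then have "vec_of F c p u = 0"
    using pseudo_finsler p(3) vec_of_tangent[OF p(1)] unfolding pseudo_finsler_def by blast
  then show "u = 0" using tcomp_vec_of_self[OF p(1), of u] by simp
qed

end

section \<open>The Chern connection in a chart\<close>

text \<open>A product rule for a linear map and its argument varying together. Differentiability of
  \<open>T\<close> is assumed for fixed vectors only; expansion over the basis replaces joint
  differentiability.\<close>

lemma dd_linear_app:
  fixes T :: "'a::euclidean_space \<Rightarrow> 'b::euclidean_space \<Rightarrow> 'c::euclidean_space"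
  assumes "open S" "z \<in> S" and lin: "\<And>z. z \<in> S \<Longrightarrow> linear (T z)"
    and T: "\<And>v. (\<lambda>z. T z v) differentiable (at z)" and u: "u differentiable (at z)"
  shows "((\<lambda>z. T z (u z)) has_derivative (\<lambda>h. dd (\<lambda>w. T w (u z)) h z + T z (dd u h z))) (at z)"
proof -
  have expand: "(\<Sum>b\<in>Basis. (v x \<bullet> b) *\<^sub>R T x b) = T x (v x)" if "x \<in> S" for v x
    using linear_euclidean_sum[OF lin[OF that], of "v x"] by simp
  have d: "((\<lambda>x. \<Sum>b\<in>Basis. (v x \<bullet> b) *\<^sub>R T x b) has_derivative
      (\<lambda>h. \<Sum>b\<in>Basis. (v z \<bullet> b) *\<^sub>R dd (\<lambda>x. T x b) h z + (v' h \<bullet> b) *\<^sub>R T z b)) (at z)"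
    if "(v has_derivative v') (at z)" for v v'
    using that by (intro has_derivative_sum has_derivative_scaleR has_derivative_inner_left has_derivative_dd T)
  have e: "((\<lambda>x. T x (v x)) has_derivative
      (\<lambda>h. \<Sum>b\<in>Basis. (v z \<bullet> b) *\<^sub>R dd (\<lambda>x. T x b) h z + (v' h \<bullet> b) *\<^sub>R T z b)) (at z)"
    if "(v has_derivative v') (at z)" for v v'
    by (rule has_derivative_transform_within_open[OF d[OF that] assms(1,2) expand[of _ v]])
  \<comment> \<open>The general formula \<open>e\<close>, applied to a constant argument, identifies
    the part that comes from varying \<open>T\<close>.\<close>
  have "dd (\<lambda>x. T x (u z)) h z = (\<Sum>b\<in>Basis. (u z \<bullet> b) *\<^sub>R dd (\<lambda>x. T x b) h z)" for h
    using dd_eqI[OF e[OF has_derivative_const[of "u z"]], of h] by simp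
  moreover have "(\<Sum>b\<in>Basis. (dd u h z \<bullet> b) *\<^sub>R T z b) = T z (dd u h z)" for h
    using expand[OF assms(2), of "\<lambda>_. dd u h z"] .
  ultimately show ?thesis
    using e[OF has_derivative_dd[OF u]] by (simp add: sum.distrib)
qed

lemma tcomp_sum: "tcomp (\<Sum>i\<in>I. v i) c = (\<Sum>i\<in>I. tcomp (v i) c)"
  by (induction I rule: infinite_finite_induct) auto

context pseudo_finsler_manifold
begin

abbreviation \<Gamma> where "\<Gamma> c \<equiv> chr (lagr_in F c)"

definition comp :: "('m, 'n) chart \<Rightarrow> ('m, 'n) vfield \<Rightarrow> real ^ 'n \<Rightarrow> real ^ 'n" where
  "comp c X = (\<lambda>x. tcomp (X (cinv c x)) c)"

lemma comp_cmap [simp]: "c \<in> charts_at F p \<Longrightarrow> comp c X (cmap c p) = tcomp (X p) c"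
  by (simp add: comp_def cinv_cmap)

lemma cmap_imageE:
  assumes "c \<in> atlas F" "x \<in> cmap c ` (cdom c \<inter> \<Omega>)"
  obtains p where "p \<in> \<Omega>" "c \<in> charts_at F p" "x = cmap c p" "cinv c x = p"
  using assms cinv_cmap by (auto simp: in_charts_at)

text \<open>When one chart covers \<open>\<Omega>\<close>, smoothness in it suffices: the components
  in another chart are obtained by applying the derivative of the transition map and
  reparametrizing, and both operations are smooth.\<close>

lemma smooth_vfieldI:
  assumes "c \<in> atlas F" "open \<Omega>" "\<Omega> \<subseteq> cdom c" and tan: "\<And>p. p \<in> \<Omega> \<Longrightarrow> X p \<in> tangent_space F p"
    and smooth: "smooth_on (cmap c ` (cdom c \<inter> \<Omega>)) (comp c X)"
  shows "smooth_vfield F \<Omega> X"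
  unfolding smooth_vfield_def comp_def[symmetric]
proof (intro conjI ballI tan)
  fix c' assume c': "c' \<in> atlas F"
  let ?S = "cmap c ` (cdom c \<inter> (cdom c' \<inter> \<Omega>))" and ?S' = "cmap c' ` (cdom c' \<inter> \<Omega>)"
  have oS: "open ?S" "open ?S'" by (intro open_cmap_image open_Int assms(1,2) c' open_cdom)+
  have tr: "smooth_on ?S (trans c c')" by (rule smooth_on_subset[OF smooth_trans[OF assms(1) c']]) auto
  have tr': "smooth_on ?S' (trans c' c)"
    by (rule smooth_on_subset[OF smooth_trans[OF c' assms(1)]]) (use assms(3) in auto)
  have "smooth_on ?S (\<lambda>x. dd (trans c c') (comp c X x) x)"
    by (rule smooth_on_linear_app[OF oS(1), where T = "\<lambda>x h. dd (trans c c') h x"])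
      (auto intro: linear_dd[OF smooth_on_imp_differentiable[OF tr]] smooth_on_dd[OF tr] smooth_on_subset[OF smooth])
  moreover have "trans c' c ` ?S' \<subseteq> ?S"
    using assms(3) c' cinv_in[OF c', of _ \<Omega>] by fastforce
  ultimately have "smooth_on ?S' (\<lambda>x. dd (trans c c') (comp c X (trans c' c x)) (trans c' c x))"
    using smooth_on_compose[OF oS(2) _ _ tr', of ?S "\<lambda>x. dd (trans c c') (comp c X x) x"] by simp
  moreover have "dd (trans c c') (comp c X (trans c' c x)) (trans c' c x) = comp c' X x" if "x \<in> ?S'" for x
  proof -
    obtain p where p: "p \<in> \<Omega>" "c' \<in> charts_at F p" "x = cmap c' p" "cinv c' x = p"
      using cmap_imageE[OF c' \<open>x \<in> ?S'\<close>] .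
    then have "c \<in> charts_at F p" using assms by (auto simp: in_charts_at)
    then show ?thesis using p tan tcomp_tangent[of "X p" p c c'] by (simp add: cinv_cmap)
  qed
  ultimately show "smooth_on ?S' (comp c' X)"
    using smooth_on_cong[OF oS(2), of "\<lambda>x. dd (trans c c') (comp c X (trans c' c x)) (trans c' c x)"] by blast
qed

lemma smooth_funI:
  assumes "c \<in> atlas F" "open \<Omega>" "\<Omega> \<subseteq> cdom c" and smooth: "smooth_on (cmap c ` (cdom c \<inter> \<Omega>)) (f \<circ> cinv c)"
  shows "smooth_fun F \<Omega> f"
  unfolding smooth_fun_def
proof
  fix c' assume c': "c' \<in> atlas F"
  let ?S = "cmap c ` (cdom c \<inter> \<Omega>)" and ?S' = "cmap c' ` (cdom c' \<inter> \<Omega>)"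
  have oS: "open ?S'" using assms(1,2) c' by (auto intro!: open_cmap_image)
  have tr': "smooth_on ?S' (trans c' c)"
    by (rule smooth_on_subset[OF smooth_trans[OF c' assms(1)]]) (use assms(3) in auto)
  moreover have "trans c' c ` ?S' \<subseteq> ?S"
    using assms(3) c' cinv_in[OF c', of _ \<Omega>] by fastforce
  ultimately have "smooth_on ?S' (\<lambda>x. (f \<circ> cinv c) (trans c' c x))"
    using smooth_on_compose[OF oS _ smooth tr'] by blast
  moreover have "(f \<circ> cinv c) (trans c' c x) = (f \<circ> cinv c') x" if "x \<in> ?S'" for x
  proof -
    obtain p where p: "p \<in> \<Omega>" "c' \<in> charts_at F p" "x = cmap c' p" "cinv c' x = p"
      using cmap_imageE[OF c' \<open>x \<in> ?S'\<close>] .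
    then have "c \<in> charts_at F p" using assms by (auto simp: in_charts_at)
    then show ?thesis using p by (simp add: cinv_cmap)
  qed
  ultimately show "smooth_on ?S' (f \<circ> cinv c')"
    using smooth_on_cong[OF oS, of "\<lambda>x. (f \<circ> cinv c) (trans c' c x)"] by blast
qed

lemma smooth_vfield_tangent: "smooth_vfield F \<Omega> X \<Longrightarrow> p \<in> \<Omega> \<Longrightarrow> X p \<in> tangent_space F p"
  by (simp add: smooth_vfield_def)

lemma smooth_comp: "smooth_vfield F \<Omega> X \<Longrightarrow> c \<in> atlas F \<Longrightarrow> smooth_on (cmap c ` (cdom c \<inter> \<Omega>)) (comp c X)"
  by (simp add: smooth_vfield_def comp_def)

lemma smooth_vfield_vec_of:
  assumes "c \<in> atlas F" "open \<Omega>" "\<Omega> \<subseteq> cdom c"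
  shows "smooth_vfield F \<Omega> (\<lambda>q. vec_of F c q y)"
proof (rule smooth_vfieldI[OF assms])
  show "vec_of F c p y \<in> tangent_space F p" if "p \<in> \<Omega>" for p
    using assms that by (intro vec_of_tangent) (auto simp: in_charts_at)
  have "comp c (\<lambda>q. vec_of F c q y) x = y" if "x \<in> cmap c ` (cdom c \<inter> \<Omega>)" for x
    using that assms by (auto elim!: cmap_imageE[OF assms(1)])
  then show "smooth_on (cmap c ` (cdom c \<inter> \<Omega>)) (comp c (\<lambda>q. vec_of F c q y))"
    using smooth_on_cong[OF open_cmap_image[OF assms(1,2)], of "comp c (\<lambda>q. vec_of F c q y)" "\<lambda>x. y"]
    by (simp add: smooth_on_const)
qed

lemma vf_apply_cong:
  assumes "open \<Omega>" "p \<in> \<Omega>" "\<And>q. q \<in> \<Omega> \<Longrightarrow> f q = g q"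
  shows "vf_apply F X f p = vf_apply F X g p"
proof -
  let ?c = "chart_at F p"
  have c: "?c \<in> atlas F" "p \<in> cdom ?c" using chart_at_in by (auto simp: in_charts_at)
  have "dd (f \<circ> cinv ?c) h (cmap ?c p) = dd (g \<circ> cinv ?c) h (cmap ?c p)" for h
    by (rule dd_cong_open[OF open_cmap_image[OF c(1) assms(1)]])
      (use c assms cinv_in[OF c(1), of _ \<Omega>] in auto)
  then show ?thesis by (simp add: vf_apply_def Let_def dd_def)
qed

lemma vf_apply_const [simp]: "vf_apply F X (\<lambda>q. r) p = 0"
proof -
  have "((\<lambda>q. r) \<circ> cinv c) = (\<lambda>x. r)" for c :: "('m, 'n) chart" by auto
  then show ?thesis by (simp only: vf_apply_def Let_def frechet_derivative_const)
qed

end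

section \<open>Affine connections and Chern connections on coordinate fields\<close>

locale chern_chart = pseudo_finsler_manifold F
  for F :: "('m::{t2_space,second_countable_topology}, 'n::finite) finsler" +
  fixes c :: "('m, 'n) chart" and \<Omega> :: "'m set"
  assumes c: "c \<in> atlas F" and open_\<Omega>: "open \<Omega>" and \<Omega>_sub: "\<Omega> \<subseteq> cdom c"
begin

abbreviation "E X \<equiv> (\<lambda>q. vec_of F c q X)"
abbreviation "S \<equiv> cmap c ` (cdom c \<inter> \<Omega>)"

lemma in_\<Omega>: "q \<in> \<Omega> \<Longrightarrow> c \<in> charts_at F q"
  using c \<Omega>_sub by (auto simp: in_charts_at)

lemma cmap_S: "q \<in> \<Omega> \<Longrightarrow> cmap c q \<in> S"
  using \<Omega>_sub by auto

lemma open_S: "open S"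
  by (rule open_cmap_image[OF c open_\<Omega>])

lemma S_E:
  assumes "x \<in> S"
  obtains p where "p \<in> \<Omega>" "c \<in> charts_at F p" "x = cmap c p" "cinv c x = p"
  using cmap_imageE[OF c assms] .

lemma smooth_E: "smooth_vfield F \<Omega> (E X)"
  by (rule smooth_vfield_vec_of[OF c open_\<Omega> \<Omega>_sub])

lemma smooth_compS: "smooth_vfield F \<Omega> X \<Longrightarrow> smooth_on S (comp c X)"
  by (rule smooth_comp[OF _ c])

lemma smooth_funS: "smooth_fun F \<Omega> f \<Longrightarrow> smooth_on S (f \<circ> cinv c)"
  using c by (simp add: smooth_fun_def)

lemma smooth_fun_iff: "smooth_fun F \<Omega> f \<longleftrightarrow> smooth_on S (f \<circ> cinv c)"
  using smooth_funI[OF c open_\<Omega> \<Omega>_sub] smooth_funS by blast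

lemma smooth_vfield_iff:
  "smooth_vfield F \<Omega> X \<longleftrightarrow> (\<forall>p\<in>\<Omega>. X p \<in> tangent_space F p) \<and> smooth_on S (comp c X)"
  using smooth_vfieldI[OF c open_\<Omega> \<Omega>_sub] smooth_compS smooth_vfield_tangent by blast

lemma vf_apply_S:
  assumes "p \<in> \<Omega>" "X p \<in> tangent_space F p" "((f \<circ> cinv c) has_derivative f') (at (cmap c p))"
  shows "vf_apply F X f p = f' (tcomp (X p) c)"
proof -
  have "(f \<circ> cinv c) differentiable (at (cmap c p))" using assms(3) by (auto simp: differentiable_def)
  with dd_eqI[OF assms(3)] show ?thesis
    using vf_apply_chart[where X = X and p = p, OF in_\<Omega>[OF assms(1)] assms(2)] by simp
qed

end

lemma affine_connectionD:
  assumes "affine_connection F \<Omega> D" "smooth_vfield F \<Omega> X" "smooth_vfield F \<Omega> Y"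
  shows affine_smooth: "smooth_vfield F \<Omega> (D X Y)"
    and affine_add: "smooth_vfield F \<Omega> Z \<Longrightarrow> p \<in> \<Omega> \<Longrightarrow> D X (\<lambda>q. Y q + Z q) p = D X Y p + D X Z p"
    and affine_leibniz: "smooth_fun F \<Omega> f \<Longrightarrow> p \<in> \<Omega> \<Longrightarrow>
      D X (\<lambda>q. f q *\<^sub>R Y q) p = vf_apply F X f p *\<^sub>R Y p + f p *\<^sub>R D X Y p"
  using assms unfolding affine_connection_def by auto

context chern_chart
begin

text \<open>Vector fields are total functions, so \<open>D\<close> might depend on values outside
  \<open>\<Omega>\<close>. The indicator of \<open>\<Omega>\<close> is smooth on
  \<open>\<Omega>\<close>, being constant there, and multiplying by it makes the two fields equal
  everywhere; by the Leibniz rule this multiplication does not change the derivative at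
  \<open>p\<close>.\<close>

lemma affine_cong:
  assumes D: "affine_connection F \<Omega> D" and p: "p \<in> \<Omega>"
    and X: "smooth_vfield F \<Omega> X" and Y: "smooth_vfield F \<Omega> Y" and Z: "smooth_vfield F \<Omega> Z"
    and eq: "\<And>q. q \<in> \<Omega> \<Longrightarrow> Y q = Z q"
  shows "D X Y p = D X Z p"
proof -
  let ?f = "indicator \<Omega> :: 'm \<Rightarrow> real"
  have "smooth_on S (?f \<circ> cinv c)"
    by (subst smooth_on_cong[OF open_S, of _ "\<lambda>x. 1"]) (auto elim!: S_E intro: smooth_on_const)
  then have f: "smooth_fun F \<Omega> ?f" by (simp add: smooth_fun_iff)
  have vf: "vf_apply F X ?f p = 0"
    using vf_apply_cong[OF open_\<Omega> p, of ?f "\<lambda>q. 1" X] by simp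
  have leibniz: "D X (\<lambda>q. ?f q *\<^sub>R Y q) p = D X Y p" if "smooth_vfield F \<Omega> Y" for Y
    using affine_leibniz[OF D X that f p] vf p by simp
  have "(\<lambda>q. ?f q *\<^sub>R Y q) = (\<lambda>q. ?f q *\<^sub>R Z q)"
    using eq by (auto simp: indicator_def fun_eq_iff)
  then show ?thesis using leibniz[OF Y] leibniz[OF Z] by simp
qed

lemma smooth_vfield_add:
  assumes "smooth_vfield F \<Omega> X" "smooth_vfield F \<Omega> Y"
  shows "smooth_vfield F \<Omega> (\<lambda>q. X q + Y q)"
  using assms smooth_on_add[OF open_S, of "comp c X" "comp c Y"]
  by (auto simp: smooth_vfield_iff comp_def intro: tangent_space_add)

lemma smooth_vfield_scaleR:
  assumes "smooth_fun F \<Omega> f" "smooth_vfield F \<Omega> X"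
  shows "smooth_vfield F \<Omega> (\<lambda>q. f q *\<^sub>R X q)"
  using assms smooth_on_scaleR[OF open_S, of "f \<circ> cinv c" "comp c X"]
  by (auto simp: smooth_vfield_iff smooth_fun_iff comp_def o_def intro: tangent_space_scaleR)

lemma smooth_vfield_zero: "smooth_vfield F \<Omega> (\<lambda>q. 0)"
  by (auto simp: smooth_vfield_iff comp_def intro: tangent_space_zero smooth_on_const)

lemma smooth_vfield_sum:
  assumes "\<And>i. i \<in> I \<Longrightarrow> smooth_vfield F \<Omega> (X i)"
  shows "smooth_vfield F \<Omega> (\<lambda>q. \<Sum>i\<in>I. X i q)"
  using assms by (induction I rule: infinite_finite_induct) (auto intro: smooth_vfield_zero smooth_vfield_add)

text \<open>Since the coefficients vanish at \<open>p\<close>, the Leibniz rule leaves only their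
  derivatives; the connection of the fields \<open>Y i\<close> does not contribute.\<close>

lemma affine_sum:
  assumes D: "affine_connection F \<Omega> D" and p: "p \<in> \<Omega>" and X: "smooth_vfield F \<Omega> X"
    and "finite I" "\<And>i. i \<in> I \<Longrightarrow> smooth_fun F \<Omega> (h i)" "\<And>i. i \<in> I \<Longrightarrow> smooth_vfield F \<Omega> (Y i)"
    and "\<And>i. i \<in> I \<Longrightarrow> h i p = 0"
  shows "D X (\<lambda>q. \<Sum>i\<in>I. h i q *\<^sub>R Y i q) p = (\<Sum>i\<in>I. vf_apply F X (h i) p *\<^sub>R Y i p)"
  using assms(4-7)
proof (induction I)
  case empty
  \<comment> \<open>Additivity makes this value its own double, hence zero.\<close>
  have "D X (\<lambda>q. 0 + 0) p = D X (\<lambda>q. 0) p + D X (\<lambda>q. 0) p"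
    by (rule affine_add[OF D X smooth_vfield_zero smooth_vfield_zero p])
  then show ?case by simp
next
  case (insert i I)
  let ?Z = "\<lambda>q. \<Sum>i\<in>I. h i q *\<^sub>R Y i q" and ?W = "\<lambda>q. h i q *\<^sub>R Y i q"
  have Z: "smooth_vfield F \<Omega> ?Z" and W: "smooth_vfield F \<Omega> ?W"
    using insert by (auto intro!: smooth_vfield_sum smooth_vfield_scaleR)
  have "D X (\<lambda>q. ?W q + ?Z q) p = D X ?W p + D X ?Z p"
    by (rule affine_add[OF D X W Z p])
  moreover have "D X ?W p = vf_apply F X (h i) p *\<^sub>R Y i p + h i p *\<^sub>R D X (Y i) p"
    using insert.prems by (intro affine_leibniz[OF D X _ _ p]) auto
  moreover have "D X ?Z p = (\<Sum>i\<in>I. vf_apply F X (h i) p *\<^sub>R Y i p)"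
    using insert by blast
  ultimately show ?case using insert.hyps insert.prems(3)[of i] by simp
qed

text \<open>On \<open>\<Omega>\<close>, \<open>V\<close> differs from the field with the constant components \<open>tcomp (V p) c\<close> by a combination of
  coordinate fields whose coefficients vanish at \<open>p\<close>; only the derivatives of these contribute.\<close>

lemma affine_comp:
  assumes D: "affine_connection F \<Omega> D" and p: "p \<in> \<Omega>" and V: "smooth_vfield F \<Omega> V"
  shows "tcomp (D (E X) V p) c =
    dd (comp c V) X (cmap c p) + tcomp (D (E X) (E (tcomp (V p) c)) p) c"
proof -
  let ?y = "tcomp (V p) c"
  define h where "h i q = (tcomp (V q) c - ?y) $ i" for i q
  let ?Z = "\<lambda>q. \<Sum>i\<in>UNIV. h i q *\<^sub>R E (axis i 1) q"
  have hc: "h i \<circ> cinv c = (\<lambda>x. (comp c V x - ?y) $ i)" for i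
    by (auto simp: h_def comp_def)
  have h: "smooth_fun F \<Omega> (h i)" for i
    unfolding smooth_fun_iff hc
    by (intro smooth_on_linear_image[OF open_S bounded_linear_vec_nth] smooth_on_diff[OF open_S]
        smooth_compS V smooth_on_const)
  have Z: "smooth_vfield F \<Omega> ?Z"
    by (intro smooth_vfield_sum smooth_vfield_scaleR h smooth_E)
  have V_eq: "V q = E ?y q + ?Z q" if "q \<in> \<Omega>" for q
  proof (rule tangent_eqI[OF smooth_vfield_tangent[OF V that] _ in_\<Omega>[OF that]])
    show "E ?y q + ?Z q \<in> tangent_space F q"
      using smooth_vfield_tangent[OF smooth_vfield_add[OF smooth_E Z] that] .
    have "(\<Sum>i\<in>UNIV. h i q *\<^sub>R axis i (1::real)) = tcomp (V q) c - ?y"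
      unfolding h_def scalar_mult_eq_scaleR[symmetric] by (rule basis_expansion)
    then show "tcomp (V q) c = tcomp (E ?y q + ?Z q) c"
      using in_\<Omega>[OF that] by (simp add: tcomp_sum)
  qed
  have "D (E X) V p = D (E X) (\<lambda>q. E ?y q + ?Z q) p"
    by (rule affine_cong[OF D p smooth_E V smooth_vfield_add[OF smooth_E Z] V_eq])
  also have "\<dots> = D (E X) (E ?y) p + D (E X) ?Z p"
    by (rule affine_add[OF D smooth_E smooth_E Z p])
  also have "D (E X) ?Z p = (\<Sum>i\<in>UNIV. vf_apply F (E X) (h i) p *\<^sub>R E (axis i 1) p)"
    by (rule affine_sum[OF D p smooth_E]) (auto simp: h smooth_E, simp add: h_def)
  finally have *: "tcomp (D (E X) V p) c = tcomp (D (E X) (E ?y) p) c +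
      (\<Sum>i\<in>UNIV. vf_apply F (E X) (h i) p *\<^sub>R axis i 1)"
    using in_\<Omega>[OF p] by (simp add: tcomp_sum)
  have "vf_apply F (E X) (h i) p = dd (comp c V) X (cmap c p) $ i" for i
  proof -
    have "((\<lambda>x. (comp c V x - ?y) $ i) has_derivative (\<lambda>h. (dd (comp c V) h (cmap c p) - 0) $ i)) (at (cmap c p))"
      by (intro bounded_linear.has_derivative[OF bounded_linear_vec_nth] has_derivative_diff has_derivative_const
          smooth_on_has_derivative[OF smooth_compS[OF V] cmap_S[OF p]])
    from vf_apply_S[where X = "E X" and f = "h i", OF p vec_of_tangent[OF in_\<Omega>[OF p]], unfolded hc, OF this]
    show ?thesis using in_\<Omega>[OF p] by simp
  qed
  then have "(\<Sum>i\<in>UNIV. vf_apply F (E X) (h i) p *\<^sub>R axis i (1::real)) = dd (comp c V) X (cmap c p)"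
    by (simp add: basis_expansion flip: scalar_mult_eq_scaleR)
  with * show ?thesis by (simp add: add.commute)
qed

text \<open>The torsion identity is tested on the coordinate functions. A coordinate field maps them
  to constants, so both second derivatives vanish and the components of the difference are
  zero.\<close>

lemma torsion_free_sym:
  assumes D: "affine_connection F \<Omega> D" "torsion_free F \<Omega> D" and p: "p \<in> \<Omega>"
  shows "tcomp (D (E X) (E Y) p) c = tcomp (D (E Y) (E X) p) c"
proof -
  have "(tcomp (D (E X) (E Y) p) c - tcomp (D (E Y) (E X) p) c) $ i = 0" for i
  proof -
    let ?f = "\<lambda>q. cmap c q $ i"
    have fS: "?f (cinv c x) = x $ i" if "x \<in> S" for x
      using that by (auto elim!: S_E)
    have f: "smooth_fun F \<Omega> ?f"
      unfolding smooth_fun_iff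
      by (subst smooth_on_cong[OF open_S, of _ "\<lambda>x. x $ i"])
        (auto simp: fS intro: smooth_on_bounded_linear[OF bounded_linear_vec_nth])
    have d: "((?f \<circ> cinv c) has_derivative (\<lambda>h. h $ i)) (at (cmap c q))" if "q \<in> \<Omega>" for q
      by (rule has_derivative_transform_within_open[OF _ open_S cmap_S[OF that], of "\<lambda>x. x $ i"])
        (auto simp: fS intro: bounded_linear_imp_has_derivative bounded_linear_vec_nth)
    have vf: "vf_apply F X ?f q = tcomp (X q) c $ i" if "q \<in> \<Omega>" "X q \<in> tangent_space F q" for X q
      by (rule vf_apply_S[where X = X, OF that d[OF that(1)]])
    have 0: "vf_apply F (E X) (vf_apply F (E Y) ?f) p = 0" for X Y
      by (subst vf_apply_cong[OF open_\<Omega> p, of _ "\<lambda>q. Y $ i"])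
        (use vf[of _ "E Y"] in \<open>auto simp: in_\<Omega> vec_of_tangent\<close>)
    have "vf_apply F (\<lambda>q. D (E X) (E Y) q - D (E Y) (E X) q) ?f p = 0"
      using D(2) smooth_E f p 0 unfolding torsion_free_def by force
    moreover have "smooth_vfield F \<Omega> (D (E X) (E Y))" for X Y
      by (rule affine_smooth[OF D(1) smooth_E smooth_E])
    then have "D (E X) (E Y) p - D (E Y) (E X) p \<in> tangent_space F p"
      by (intro tangent_space_diff smooth_vfield_tangent[OF _ p])
    ultimately show ?thesis
      using vf[OF p, of "\<lambda>q. D (E X) (E Y) q - D (E Y) (E X) q"] by simp
  qed
  then show ?thesis by (simp add: vec_eq_iff)
qed

text \<open>The derivative of the metric along a varying reference vector splits into a horizontal
  part, with the vector frozen, and a vertical part, which is twice the Cartan tensor.\<close>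

lemma fund_chain:
  assumes p: "p \<in> \<Omega>" and z: "(cmap c p, v (cmap c p)) \<in> adm_in F c" and v: "(v has_derivative v') (at (cmap c p))"
  shows "((\<lambda>x. fund (lagr_in F c) (x, v x) u w) has_derivative
    (\<lambda>h. fundx (lagr_in F c) (cmap c p, v (cmap c p)) h u w + 2 * cart (lagr_in F c) (cmap c p, v (cmap c p)) (v' h) u w))
    (at (cmap c p))"
proof -
  interpret chart_lagrangian "adm_in F c" "lagr_in F c" by (rule chart_lagrangian[OF c])
  let ?z = "(cmap c p, v (cmap c p))" and ?f = "\<lambda>z. fund (lagr_in F c) z u w"
  have "((\<lambda>x. ?f (x, v x)) has_derivative (\<lambda>h. dd ?f (h, v' h) ?z)) (at (cmap c p))"
    using diff_chain_at[OF has_derivative_Pair[OF has_derivative_ident v] smooth_on_has_derivative[OF smooth_fund z]]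
    by (simp add: o_def)
  moreover have "dd ?f (h, v' h) ?z = fundx (lagr_in F c) ?z h u w + 2 * cart (lagr_in F c) ?z (v' h) u w" for h
    using linear_add[OF linear_dd[OF smooth_on_imp_differentiable[OF smooth_fund[of u w] z]], of "(h, 0)" "(0, v' h)"]
    by (simp add: dd_fund_snd[OF z] fundx_def)
  ultimately show ?thesis by simp
qed

text \<open>On fields with constant components the values of \<open>D\<close> at \<open>p\<close>
  form a symmetric \<open>B\<close> satisfying the compatibility identity of
  \<open>gam_unique\<close> at the vector \<open>V p\<close>; hence nothing but the value of
  \<open>V\<close> at \<open>p\<close> enters.\<close>

theorem chern_connection_chart:
  assumes V: "admissible_vfield F \<Omega> V" and D: "chern_connection F \<Omega> V D" and p: "p \<in> \<Omega>"
  shows "tcomp (D (E X) (E Y) p) c = \<Gamma> c (cmap c p, tcomp (V p) c) X Y"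
proof -
  interpret chart_lagrangian "adm_in F c" "lagr_in F c" by (rule chart_lagrangian[OF c])
  let ?L = "lagr_in F c" and ?z = "(cmap c p, tcomp (V p) c)"
  have Vs: "smooth_vfield F \<Omega> V" and Va: "\<And>q. q \<in> \<Omega> \<Longrightarrow> (q, V q) \<in> adm F"
    using V by (auto simp: admissible_vfield_def)
  have aff: "affine_connection F \<Omega> D" and tor: "torsion_free F \<Omega> D"
    using D by (auto simp: chern_connection_def)
  have z: "?z \<in> adm_in F c" using adm_inD[OF Va[OF p] in_\<Omega>[OF p]] .
  define B where "B X Y = tcomp (D (E X) (E Y) p) c" for X Y
  have sym: "B X Y = B Y X" for X Y
    unfolding B_def by (rule torsion_free_sym[OF aff tor p])
  have tanD: "D X Y p \<in> tangent_space F p" if "smooth_vfield F \<Omega> X" "smooth_vfield F \<Omega> Y" for X Y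
    using smooth_vfield_tangent[OF affine_smooth[OF aff that] p] .
  have "fundx ?L ?z X Y Z = fund ?L ?z (B X Y) Z + fund ?L ?z Y (B X Z) + 2 * cart ?L ?z (B X (snd ?z)) Y Z" for X Y Z
  proof -
    let ?f = "\<lambda>q. fund_tensor F q (V q) (E Y q) (E Z q)"
    have d: "((\<lambda>x. fund ?L (x, comp c V x) Y Z) has_derivative
      (\<lambda>h. fundx ?L ?z h Y Z + 2 * cart ?L ?z (dd (comp c V) h (cmap c p)) Y Z)) (at (cmap c p))"
      using fund_chain[OF p, of "comp c V"] z in_\<Omega>[OF p] smooth_on_has_derivative[OF smooth_compS[OF Vs] cmap_S[OF p]]
      by simp
    have "((?f \<circ> cinv c) has_derivative
      (\<lambda>h. fundx ?L ?z h Y Z + 2 * cart ?L ?z (dd (comp c V) h (cmap c p)) Y Z)) (at (cmap c p))"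
      by (rule has_derivative_transform_within_open[OF d open_S cmap_S[OF p]])
        (auto elim!: S_E simp: fund_tensor_chart[OF Va in_\<Omega>] vec_of_tangent)
    then have "vf_apply F (E X) ?f p = fundx ?L ?z X Y Z + 2 * cart ?L ?z (dd (comp c V) X (cmap c p)) Y Z"
      using vf_apply_S[where X = "E X", OF p vec_of_tangent[OF in_\<Omega>[OF p]]] in_\<Omega>[OF p] by simp
    moreover have "vf_apply F (E X) ?f p = fund_tensor F p (V p) (D (E X) (E Y) p) (E Z p) +
        fund_tensor F p (V p) (E Y p) (D (E X) (E Z) p) + 2 * cartan_tensor F p (V p) (D (E X) V p) (E Y p) (E Z p)"
      using D smooth_E p unfolding chern_connection_def by blast
    moreover have "\<dots> = fund ?L ?z (B X Y) Z + fund ?L ?z Y (B X Z) + 2 * cart ?L ?z (tcomp (D (E X) V p) c) Y Z"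
      using Va[OF p] in_\<Omega>[OF p] tanD smooth_E Vs
      by (simp add: fund_tensor_chart cartan_tensor_chart vec_of_tangent B_def)
    \<comment> \<open>The Cartan term with \<open>dd (comp c V)\<close> arises on both sides, here
      and from \<open>fund_chain\<close>, and cancels.\<close>
    moreover have "tcomp (D (E X) V p) c = dd (comp c V) X (cmap c p) + B X (snd ?z)"
      using affine_comp[OF aff p Vs] by (simp add: B_def)
    ultimately show ?thesis
      by (simp add: linear_add[OF linear_cart[OF z]])
  qed
  then have "B X Y = \<Gamma> c ?z X Y"
    by (rule chr_unique[OF z sym])
  then show ?thesis by (simp add: B_def)
qed

end

section \<open>Existence of the Chern connection of a field with constant components\<close>

context pseudo_finsler_manifold
begin

text \<open>The Chern connection of the field with constant components \<open>y\<close> in the chart \<open>c\<close>.\<close>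

definition conn :: "('m, 'n) chart \<Rightarrow> real ^ 'n \<Rightarrow> ('m, 'n) connection" where
  "conn c y X Y q = vec_of F c q
    (dd (comp c Y) (tcomp (X q) c) (cmap c q) + \<Gamma> c (cmap c q, y) (tcomp (X q) c) (tcomp (Y q) c))"

lemma linear_\<Gamma>:
  assumes "c \<in> atlas F" "z \<in> adm_in F c"
  shows "linear (\<Gamma> c z X)" "linear (\<lambda>X. \<Gamma> c z X Y)"
proof -
  show lin: "linear (\<Gamma> c z X)" for X
    by (rule chart_lagrangian.linear_chr[OF chart_lagrangian[OF assms(1)] assms(2)])
  have "(\<lambda>X. \<Gamma> c z X Y) = \<Gamma> c z Y"
    by (rule ext) (rule chart_lagrangian.chr_sym[OF chart_lagrangian[OF assms(1)] assms(2)])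
  then show "linear (\<lambda>X. \<Gamma> c z X Y)" using lin by simp
qed

lemma \<Gamma>_sym: "c \<in> atlas F \<Longrightarrow> z \<in> adm_in F c \<Longrightarrow> \<Gamma> c z X Y = \<Gamma> c z Y X"
  by (rule chart_lagrangian.chr_sym[OF chart_lagrangian])

lemma smooth_\<Gamma>: "c \<in> atlas F \<Longrightarrow> smooth_on (adm_in F c) (\<lambda>z. \<Gamma> c z X Y)"
  by (rule chart_lagrangian.smooth_chr[OF chart_lagrangian])

end

locale chern_chart_const = chern_chart F c \<Omega>
  for F :: "('m::{t2_space,second_countable_topology}, 'n::finite) finsler" and c \<Omega> +
  fixes y :: "real ^ 'n"
  assumes y_adm: "q \<in> \<Omega> \<Longrightarrow> (cmap c q, y) \<in> adm_in F c"
begin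

lemma tcomp_conn: "p \<in> \<Omega> \<Longrightarrow> tcomp (conn c y X Y p) c =
    dd (comp c Y) (tcomp (X p) c) (cmap c p) + \<Gamma> c (cmap c p, y) (tcomp (X p) c) (tcomp (Y p) c)"
  by (simp add: conn_def in_\<Omega>)

lemma conn_tangent: "p \<in> \<Omega> \<Longrightarrow> conn c y X Y p \<in> tangent_space F p"
  by (simp add: conn_def vec_of_tangent in_\<Omega>)

lemma conn_eqI:
  "p \<in> \<Omega> \<Longrightarrow> w \<in> tangent_space F p \<Longrightarrow> tcomp (conn c y X Y p) c = tcomp w c \<Longrightarrow> conn c y X Y p = w"
  by (rule tangent_eqI[OF conn_tangent _ in_\<Omega>])

lemma comp_differentiable: "smooth_vfield F \<Omega> X \<Longrightarrow> p \<in> \<Omega> \<Longrightarrow> comp c X differentiable (at (cmap c p))"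
  using smooth_on_imp_differentiable[OF smooth_compS cmap_S] .

lemmas comp_has_derivative = has_derivative_dd[OF comp_differentiable]

lemma conn_affine: "affine_connection F \<Omega> (conn c y)"
  unfolding affine_connection_def
proof (intro conjI allI impI ballI)
  fix X Y
  assume XY: "smooth_vfield F \<Omega> X \<and> smooth_vfield F \<Omega> Y"
  have yS: "(x, y) \<in> adm_in F c" if "x \<in> S" for x
    using that y_adm by (auto elim!: S_E)
  have G: "smooth_on S (\<lambda>x. \<Gamma> c (x, y) u v)" for u v
    by (rule smooth_on_compose[OF open_S _ smooth_\<Gamma>[OF c], of "\<lambda>x. (x, y)"])
      (use smooth_on_Pair[OF open_S smooth_on_bounded_linear[OF bounded_linear_ident] smooth_on_const] yS in auto)
  have X: "smooth_on S (comp c X)" and Y: "smooth_on S (comp c Y)" using XY smooth_compS by blast+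
  have "smooth_on S (\<lambda>x. \<Gamma> c (x, y) u (comp c Y x))" for u
    by (rule smooth_on_linear_app[OF open_S linear_\<Gamma>(1)[OF c yS] G Y])
  then have "smooth_on S (\<lambda>x. \<Gamma> c (x, y) (comp c X x) (comp c Y x))"
    by (intro smooth_on_linear_app[where T = "\<lambda>x u. \<Gamma> c (x, y) u (comp c Y x)", OF open_S linear_\<Gamma>(2)[OF c yS] _ X])
  moreover have "smooth_on S (\<lambda>x. dd (comp c Y) (comp c X x) x)"
    by (rule smooth_on_linear_app[where T = "\<lambda>x u. dd (comp c Y) u x",
          OF open_S linear_dd[OF smooth_on_imp_differentiable[OF Y]] smooth_on_dd[OF Y] X])
  ultimately have smooth: "smooth_on S (\<lambda>x. dd (comp c Y) (comp c X x) x + \<Gamma> c (x, y) (comp c X x) (comp c Y x))"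
    by (intro smooth_on_add open_S)
  have eq: "comp c (conn c y X Y) x = dd (comp c Y) (comp c X x) x + \<Gamma> c (x, y) (comp c X x) (comp c Y x)" if "x \<in> S" for x
    using that by (auto elim!: S_E simp: tcomp_conn)
  have "smooth_on S (comp c (conn c y X Y))"
    by (rule iffD2[OF smooth_on_cong[OF open_S eq] smooth])
  then show "smooth_vfield F \<Omega> (conn c y X Y)"
    by (simp add: smooth_vfield_iff conn_tangent)
next
  fix X Y Z p
  assume *: "smooth_vfield F \<Omega> X \<and> smooth_vfield F \<Omega> Y \<and> smooth_vfield F \<Omega> Z" and p: "p \<in> \<Omega>"
  note lin = linear_add[OF linear_\<Gamma>(1)[OF c y_adm[OF p]]] linear_add[OF linear_\<Gamma>(2)[OF c y_adm[OF p]]]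
  show "conn c y (\<lambda>q. X q + Y q) Z p = conn c y X Z p + conn c y Y Z p"
    using * linear_add[OF linear_dd[OF comp_differentiable[OF _ p, of Z]]]
    by (intro conn_eqI[OF p tangent_space_add] conn_tangent p) (simp add: tcomp_conn p lin)
  have "comp c (\<lambda>q. Y q + Z q) = (\<lambda>x. comp c Y x + comp c Z x)"
    by (simp add: comp_def)
  then have "dd (comp c (\<lambda>q. Y q + Z q)) h (cmap c p) = dd (comp c Y) h (cmap c p) + dd (comp c Z) h (cmap c p)" for h
    using * by (auto intro!: dd_eqI has_derivative_add comp_has_derivative p)
  then show "conn c y X (\<lambda>q. Y q + Z q) p = conn c y X Y p + conn c y X Z p"
    by (intro conn_eqI[OF p tangent_space_add] conn_tangent p) (simp add: tcomp_conn p lin)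
next
  fix X Y f p
  assume *: "smooth_vfield F \<Omega> X \<and> smooth_vfield F \<Omega> Y \<and> smooth_fun F \<Omega> f" and p: "p \<in> \<Omega>"
  note lin = linear_scale[OF linear_\<Gamma>(1)[OF c y_adm[OF p]]] linear_scale[OF linear_\<Gamma>(2)[OF c y_adm[OF p]]]
  show "conn c y (\<lambda>q. f q *\<^sub>R X q) Y p = f p *\<^sub>R conn c y X Y p"
    using * linear_scale[OF linear_dd[OF comp_differentiable[OF _ p, of Y]]]
    by (intro conn_eqI[OF p tangent_space_scaleR] conn_tangent p) (simp add: tcomp_conn p lin algebra_simps)
  have f: "(f \<circ> cinv c has_derivative (\<lambda>h. dd (f \<circ> cinv c) h (cmap c p))) (at (cmap c p))"
    using * smooth_on_has_derivative[OF smooth_funS cmap_S[OF p]] by blast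
  have "comp c (\<lambda>q. f q *\<^sub>R Y q) = (\<lambda>x. (f \<circ> cinv c) x *\<^sub>R comp c Y x)"
    by (simp add: comp_def)
  then have "dd (comp c (\<lambda>q. f q *\<^sub>R Y q)) h (cmap c p) =
      (f \<circ> cinv c) (cmap c p) *\<^sub>R dd (comp c Y) h (cmap c p) + dd (f \<circ> cinv c) h (cmap c p) *\<^sub>R comp c Y (cmap c p)" for h
    using * dd_eqI[OF has_derivative_scaleR[OF f comp_has_derivative[OF _ p, of Y]], of h] by simp
  moreover have "vf_apply F X f p = dd (f \<circ> cinv c) (tcomp (X p) c) (cmap c p)"
    by (rule vf_apply_S[where X = X, OF p smooth_vfield_tangent[OF conjunct1[OF *] p] f])
  ultimately show "conn c y X (\<lambda>q. f q *\<^sub>R Y q) p = vf_apply F X f p *\<^sub>R Y p + f p *\<^sub>R conn c y X Y p"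
    using * in_\<Omega>[OF p] smooth_vfield_tangent[OF _ p, of Y]
    by (intro conn_eqI[OF p tangent_space_add] tangent_space_scaleR conn_tangent p)
      (simp_all add: tcomp_conn p lin algebra_simps cinv_cmap)
qed

text \<open>The \<open>\<Gamma>\<close> terms cancel by symmetry, so the difference of covariant
  derivatives has the components of the Lie bracket; on the other side the second derivatives of
  \<open>f\<close> cancel and leave the same bracket.\<close>

lemma conn_torsion_free: "torsion_free F \<Omega> (conn c y)"
  unfolding torsion_free_def
proof (intro allI impI ballI)
  fix X Y f p
  assume *: "smooth_vfield F \<Omega> X \<and> smooth_vfield F \<Omega> Y \<and> smooth_fun F \<Omega> f" and p: "p \<in> \<Omega>"
  let ?f = "f \<circ> cinv c" and ?x = "cmap c p"
  have fS: "smooth_on S ?f" using * smooth_funS by blast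
  have f: "(?f has_derivative (\<lambda>h. dd ?f h (cmap c q))) (at (cmap c q))" if "q \<in> \<Omega>" for q
    using smooth_on_has_derivative[OF fS cmap_S[OF that]] .
  have vf: "vf_apply F X f q = dd ?f (tcomp (X q) c) (cmap c q)" if "q \<in> \<Omega>" "X q \<in> tangent_space F q" for X q
    by (rule vf_apply_S[where X = X, OF that f[OF that(1)]])
  \<comment> \<open>Both \<open>f\<close> and the components of \<open>Y\<close> vary, so the
    product rule gives a second derivative of \<open>f\<close> and a term with the derivative of
    \<open>Y\<close>.\<close>
  have vf2: "vf_apply F X (vf_apply F Y f) p =
      dd (dd ?f (tcomp (Y p) c)) (tcomp (X p) c) ?x + dd ?f (dd (comp c Y) (tcomp (X p) c) ?x) ?x"
    if X: "smooth_vfield F \<Omega> X" and Y: "smooth_vfield F \<Omega> Y" for X Y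
  proof -
    have "((\<lambda>x. dd ?f (comp c Y x) x) has_derivative
        (\<lambda>h. dd (dd ?f (comp c Y ?x)) h ?x + dd ?f (dd (comp c Y) h ?x) ?x)) (at ?x)"
      by (rule dd_linear_app[OF open_S cmap_S[OF p], where T = "\<lambda>x u. dd ?f u x"])
        (auto intro: linear_dd smooth_on_imp_differentiable[OF fS] comp_differentiable[OF Y p]
          smooth_on_imp_differentiable[OF smooth_on_dd[OF fS] cmap_S[OF p]])
    then have "((vf_apply F Y f \<circ> cinv c) has_derivative
        (\<lambda>h. dd (dd ?f (comp c Y ?x)) h ?x + dd ?f (dd (comp c Y) h ?x) ?x)) (at ?x)"
      by (rule has_derivative_transform_within_open[OF _ open_S cmap_S[OF p]])
        (auto elim!: S_E simp: vf[where X = Y] smooth_vfield_tangent[OF Y])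
    from vf_apply_S[where X = X, OF p smooth_vfield_tangent[OF X p] this] show ?thesis
      by (simp add: in_\<Omega>[OF p])
  qed
  have "vf_apply F (\<lambda>q. conn c y X Y q - conn c y Y X q) f p =
      dd ?f (dd (comp c Y) (tcomp (X p) c) ?x - dd (comp c X) (tcomp (Y p) c) ?x) ?x"
    using \<Gamma>_sym[OF c y_adm[OF p]]
    by (subst vf[where X = "\<lambda>q. conn c y X Y q - conn c y Y X q", OF p])
      (auto intro: tangent_space_diff conn_tangent p simp: tcomp_conn[OF p])
  also have "\<dots> = dd ?f (dd (comp c Y) (tcomp (X p) c) ?x) ?x - dd ?f (dd (comp c X) (tcomp (Y p) c) ?x) ?x"
    by (rule linear_diff[OF linear_dd[OF smooth_on_imp_differentiable[OF fS cmap_S[OF p]]]])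
  also have "\<dots> = vf_apply F X (vf_apply F Y f) p - vf_apply F Y (vf_apply F X f) p"
    using * dd_commute[OF open_S fS cmap_S[OF p]] by (simp add: vf2)
  finally show "vf_apply F (\<lambda>q. conn c y X Y q - conn c y Y X q) f p =
      vf_apply F X (vf_apply F Y f) p - vf_apply F Y (vf_apply F X f) p" .
qed

lemma E_admissible: "admissible_vfield F \<Omega> (E y)"
  unfolding admissible_vfield_def
  using smooth_E y_adm in_\<Omega> by (auto simp: adm_in_iff)

text \<open>The metric coefficients, \<open>Y\<close> and \<open>Z\<close> are differentiated by the
  product rule, one slot after the other. The derivatives of \<open>Y\<close> and \<open>Z\<close>
  match those in \<open>conn\<close>, and what remains is \<open>chr_compatible\<close> at the
  vector \<open>y\<close>.\<close>

lemma conn_chern: "chern_connection F \<Omega> (E y) (conn c y)"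
  unfolding chern_connection_def
proof (intro conjI conn_affine conn_torsion_free allI impI ballI)
  fix X Y Z p
  assume *: "smooth_vfield F \<Omega> X \<and> smooth_vfield F \<Omega> Y \<and> smooth_vfield F \<Omega> Z" and p: "p \<in> \<Omega>"
  interpret chart_lagrangian "adm_in F c" "lagr_in F c" by (rule chart_lagrangian[OF c])
  let ?L = "lagr_in F c" and ?x = "cmap c p"
  let ?X = "tcomp (X p) c" and ?Y = "tcomp (Y p) c" and ?Z = "tcomp (Z p) c"
  let ?f = "\<lambda>q. fund_tensor F q (E y q) (Y q) (Z q)"
  have z: "(?x, y) \<in> adm_in F c" by (rule y_adm[OF p])
  have yS: "(x, y) \<in> adm_in F c" if "x \<in> S" for x
    using that y_adm by (auto elim!: S_E)
  have adm: "(q, E y q) \<in> adm F" if "q \<in> \<Omega>" for q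
    using y_adm[OF that] in_\<Omega>[OF that] by (simp add: adm_in_iff)
  have fg: "((\<lambda>x. fund ?L (x, y) u w) has_derivative (\<lambda>h. fundx ?L (?x, y) h u w)) (at ?x)" for u w
    using fund_chain[OF p z has_derivative_const, of u w] linear_0[OF linear_cart[OF z]] by simp
  have lin: "linear (fund ?L (x, y) u)" "linear (\<lambda>u. fund ?L (x, y) u w)" if "x \<in> S" for x u w
    using nondegenerate_form.g_linear[OF nondegenerate_form_fund] nondegenerate_form.g_linear'[OF nondegenerate_form_fund]
      yS[OF that] by auto
  have 1: "((\<lambda>x. fund ?L (x, y) u (comp c Z x)) has_derivative
      (\<lambda>h. fundx ?L (?x, y) h u ?Z + fund ?L (?x, y) u (dd (comp c Z) h ?x))) (at ?x)" for u
    using dd_linear_app[OF open_S cmap_S[OF p], where T = "\<lambda>x. fund ?L (x, y) u", OF lin(1) _ comp_differentiable[OF _ p, of Z]] fg *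
      dd_eqI[OF fg] in_\<Omega>[OF p] by (auto simp: differentiable_def)
  have "((\<lambda>x. fund ?L (x, y) (comp c Y x) (comp c Z x)) has_derivative
      (\<lambda>h. fundx ?L (?x, y) h ?Y ?Z + fund ?L (?x, y) ?Y (dd (comp c Z) h ?x) + fund ?L (?x, y) (dd (comp c Y) h ?x) ?Z)) (at ?x)"
    using dd_linear_app[OF open_S cmap_S[OF p], where T = "\<lambda>x u. fund ?L (x, y) u (comp c Z x)", OF lin(2) _ comp_differentiable[OF _ p, of Y]]
      1 * dd_eqI[OF 1] in_\<Omega>[OF p] by (auto simp: differentiable_def)
  then have "((?f \<circ> cinv c) has_derivative
      (\<lambda>h. fundx ?L (?x, y) h ?Y ?Z + fund ?L (?x, y) ?Y (dd (comp c Z) h ?x) + fund ?L (?x, y) (dd (comp c Y) h ?x) ?Z)) (at ?x)"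
    by (rule has_derivative_transform_within_open[OF _ open_S cmap_S[OF p]])
      (use * in \<open>auto elim!: S_E simp: fund_tensor_chart[OF adm in_\<Omega>] smooth_vfield_tangent\<close>)
  from vf_apply_S[where X = X, OF p smooth_vfield_tangent[OF conjunct1[OF *] p] this]
  have "vf_apply F X ?f p = fundx ?L (?x, y) ?X ?Y ?Z + fund ?L (?x, y) ?Y (dd (comp c Z) ?X ?x)
      + fund ?L (?x, y) (dd (comp c Y) ?X ?x) ?Z" .
  moreover have tan: "X p \<in> tangent_space F p" "Y p \<in> tangent_space F p" "Z p \<in> tangent_space F p"
    using * smooth_vfield_tangent[OF _ p] by blast+
  have ft: "fund_tensor F p (E y p) u w = fund ?L (?x, y) (tcomp u c) (tcomp w c)"
    if "u \<in> tangent_space F p" "w \<in> tangent_space F p" for u w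
    using fund_tensor_chart[OF adm[OF p] in_\<Omega>[OF p] that] in_\<Omega>[OF p] by simp
  have "fund_tensor F p (E y p) (conn c y X Y p) (Z p) =
      fund ?L (?x, y) (dd (comp c Y) ?X ?x) ?Z + fund ?L (?x, y) (\<Gamma> c (?x, y) ?X ?Y) ?Z"
    using linear_add[OF lin(2)[OF cmap_S[OF p]]] by (simp add: ft tan conn_tangent tcomp_conn p)
  moreover have "fund_tensor F p (E y p) (Y p) (conn c y X Z p) =
      fund ?L (?x, y) ?Y (dd (comp c Z) ?X ?x) + fund ?L (?x, y) ?Y (\<Gamma> c (?x, y) ?X ?Z)"
    using linear_add[OF lin(1)[OF cmap_S[OF p]]] by (simp add: ft tan conn_tangent tcomp_conn p)
  moreover have "cartan_tensor F p (E y p) (conn c y X (E y) p) (Y p) (Z p) = cart ?L (?x, y) (\<Gamma> c (?x, y) ?X y) ?Y ?Z"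
  proof -
    \<comment> \<open>\<open>E y\<close> has constant components, so its covariant derivative
      consists of the \<open>\<Gamma>\<close> term alone.\<close>
    have "dd (comp c (E y)) h ?x = dd (\<lambda>x. y) h ?x" for h
      by (rule dd_cong_open[OF open_S cmap_S[OF p]]) (auto elim!: S_E)
    then show ?thesis
      using cartan_tensor_chart[OF adm[OF p] in_\<Omega>[OF p] conn_tangent[OF p] tan(2,3), of X "E y"]
        in_\<Omega>[OF p] by (simp add: tcomp_conn p dd_eqI[OF has_derivative_const])
  qed
  ultimately show "vf_apply F X ?f p = fund_tensor F p (E y p) (conn c y X Y p) (Z p) +
      fund_tensor F p (E y p) (Y p) (conn c y X Z p) + 2 * cartan_tensor F p (E y p) (conn c y X (E y) p) (Y p) (Z p)"
    using chr_compatible[OF z, of ?X ?Y ?Z] by simp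
qed

end

section \<open>Identification and transformation of the Christoffel symbols\<close>

context pseudo_finsler_manifold
begin

text \<open>Because \<open>adm_in F c\<close> is open, the components of \<open>v\<close> remain
  admissible when carried to nearby base points. The set \<open>G\<close> allows shrinking into the
  domain of a second chart.\<close>

lemma chern_chart_const_exists:
  assumes v: "(p, v) \<in> adm F" and c: "c \<in> charts_at F p" and G: "open G" "p \<in> G"
  obtains \<Omega> where "chern_chart_const F c \<Omega> (tcomp v c)" "p \<in> \<Omega>" "\<Omega> \<subseteq> G"
proof -
  let ?\<Omega> = "cdom c \<inter> cmap c -` {x. (x, tcomp v c) \<in> adm_in F c} \<inter> G"
  have ca: "c \<in> atlas F" using c by (simp add: in_charts_at)
  have "open {x. (x, tcomp v c) \<in> adm_in F c}"
    using open_vimage[OF open_adm_in[OF ca], of "\<lambda>x. (x, tcomp v c)"] by (simp add: vimage_def continuous_intros)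
  moreover have "continuous_on (cdom c) (cmap c)"
    using chart_homeomorphism[OF ca] by (simp add: homeomorphism_def)
  ultimately have "open (cdom c \<inter> cmap c -` {x. (x, tcomp v c) \<in> adm_in F c})"
    using open_cdom[OF ca] continuous_open_preimage by blast
  then have "chern_chart_const F c ?\<Omega> (tcomp v c)"
    by unfold_locales (use ca G in auto)
  moreover have "p \<in> ?\<Omega>" using c G adm_inD[OF v c] by (auto simp: in_charts_at)
  ultimately show thesis using that by auto
qed

text \<open>The \<open>\<Gamma>\<close> themselves satisfy \<open>is_christoffel\<close>, so the
  choice does too; testing the chosen symbols on the constant field through \<open>v\<close>, whose
  Chern connection is known, then forces their value at \<open>v\<close>.\<close>

lemma christoffel_eq:
  assumes v: "(p, v) \<in> adm F" and cp: "c \<in> charts_at F p"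
  shows "christoffel F c p v i j k = \<Gamma> c (cmap c p, tcomp v c) (axis j 1) (axis k 1) $ i"
proof -
  have ca: "c \<in> atlas F" using cp by (simp add: in_charts_at)
  have "is_christoffel F c (\<lambda>p v i j k. \<Gamma> c (cmap c p, tcomp v c) (axis j 1) (axis k 1) $ i)"
    unfolding is_christoffel_def
  proof (intro conjI ballI allI impI, safe)
    fix q w i j k assume "(q, w) \<in> adm F" "q \<in> cdom c"
    then show "\<Gamma> c (cmap c q, tcomp w c) (axis j 1) (axis k 1) $ i = \<Gamma> c (cmap c q, tcomp w c) (axis k 1) (axis j 1) $ i"
      using \<Gamma>_sym[OF ca adm_inD] ca by (simp add: in_charts_at)
  next
    fix \<Omega> V D q j k
    assume *: "open \<Omega>" "\<Omega> \<subseteq> cdom c" "admissible_vfield F \<Omega> V" "chern_connection F \<Omega> V D" "q \<in> \<Omega>"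
    then interpret chern_chart F c \<Omega> by unfold_locales (use ca in auto)
    have "affine_connection F \<Omega> D" using * by (simp add: chern_connection_def)
    then have "D (E (axis j 1)) (E (axis k 1)) q \<in> tangent_space F q"
      using smooth_vfield_tangent[OF affine_smooth[OF _ smooth_E smooth_E] *(5)] by blast
    then show "D (E (axis j 1)) (E (axis k 1)) q =
        vec_of F c q (\<chi> i. \<Gamma> c (cmap c q, tcomp (V q) c) (axis j 1) (axis k 1) $ i)"
      using in_\<Omega>[OF *(5)] chern_connection_chart[OF *(3,4,5)]
      by (intro tangent_eqI[of _ q _ c]) (auto intro: vec_of_tangent)
  qed
  then have chr: "is_christoffel F c (christoffel F c)"
    unfolding christoffel_def by (rule someI[of "is_christoffel F c"])
  obtain \<Omega> where "chern_chart_const F c \<Omega> (tcomp v c)" and p: "p \<in> \<Omega>" and "\<Omega> \<subseteq> UNIV"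
    by (rule chern_chart_const_exists[OF v cp open_UNIV UNIV_I])
  then interpret chern_chart_const F c \<Omega> "tcomp v c" by simp
  have "conn c (tcomp v c) (E (axis j 1)) (E (axis k 1)) p = vec_of F c p (\<chi> i. christoffel F c p (E (tcomp v c) p) i j k)"
    using chr open_\<Omega> \<Omega>_sub E_admissible conn_chern p unfolding is_christoffel_def by blast
  moreover have "E (tcomp v c) p = v" by (rule vec_of_tcomp[OF adm_tangent[OF v] cp])
  ultimately have "tcomp (conn c (tcomp v c) (E (axis j 1)) (E (axis k 1)) p) c = (\<chi> i. christoffel F c p v i j k)"
    using cp by simp
  then show ?thesis
    using chern_connection_chart[OF E_admissible conn_chern p, of "axis j 1" "axis k 1"] cp by simp
qed

text \<open>Both sides are the components, in the chart \<open>c'\<close>, of the same covariant derivative.\<close>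

lemma \<Gamma>_transformation:
  assumes v: "(p, v) \<in> adm F" and c: "c \<in> charts_at F p" and c': "c' \<in> charts_at F p"
  shows "dd (trans c c') (\<Gamma> c (cmap c p, tcomp v c) X Y) (cmap c p) =
    \<Gamma> c' (cmap c' p, tcomp v c') (dd (trans c c') X (cmap c p)) (dd (trans c c') Y (cmap c p))
    + dd (dd (trans c c') Y) X (cmap c p)"
proof -
  have ca: "c \<in> atlas F" "p \<in> cdom c" using c by (simp_all add: in_charts_at)
  obtain \<Omega> where "chern_chart_const F c' \<Omega> (tcomp v c')" and p: "p \<in> \<Omega>" and sub: "\<Omega> \<subseteq> cdom c"
    by (rule chern_chart_const_exists[OF v c' open_cdom[OF ca(1)] ca(2)])
  then interpret c': chern_chart_const F c' \<Omega> "tcomp v c'" by simp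
  interpret c: chern_chart F c \<Omega> by unfold_locales (use ca sub c'.open_\<Omega> in auto)
  let ?D = "conn c' (tcomp v c')" and ?\<phi> = "trans c c'" and ?x = "cmap c p"
  have "tcomp (c'.E (tcomp v c') p) c = tcomp v c"
    by (simp add: vec_of_tcomp[OF adm_tangent[OF v] c'])
  \<comment> \<open>Uniqueness in the chart \<open>c\<close>, applied to the connection constructed
    in the chart \<open>c'\<close>; its reference field need not have constant components in
    \<open>c\<close>.\<close>
  then have 1: "tcomp (?D (c.E X) (c.E Y) p) c = \<Gamma> c (?x, tcomp v c) X Y"
    using c.chern_connection_chart[OF c'.E_admissible c'.conn_chern p, of X Y] by simp
  have "comp c' (c.E Y) x = (dd ?\<phi> Y \<circ> trans c' c) x" if "x \<in> c'.S" for x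
    using that by (auto elim!: c'.S_E simp: tcomp_vec_of)
  then have "dd (comp c' (c.E Y)) h (cmap c' p) = dd (dd ?\<phi> Y \<circ> trans c' c) h (cmap c' p)" for h
    by (rule dd_cong_open[OF c'.open_S c'.cmap_S[OF p]])
  also have "dd (dd ?\<phi> Y \<circ> trans c' c) h (cmap c' p) = dd (dd ?\<phi> Y) (dd (trans c' c) h (cmap c' p)) ?x" for h
  proof -
    have "dd ?\<phi> Y differentiable (at ?x)"
      by (rule smooth_on_imp_differentiable[OF smooth_on_dd[OF smooth_trans[of c c']]])
        (use c c' in \<open>auto simp: in_charts_at\<close>)
    then have "(dd ?\<phi> Y has_derivative (\<lambda>h. dd (dd ?\<phi> Y) h ?x)) (at (trans c' c (cmap c' p)))"
      using c' by (simp add: cinv_cmap has_derivative_dd)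
    from dd_eqI[OF diff_chain_at[OF has_derivative_trans[OF c' c] this], of h] show ?thesis
      by (simp add: o_def)
  qed
  finally have "tcomp (?D (c.E X) (c.E Y) p) c' = dd (dd ?\<phi> Y) (dd (trans c' c) (dd ?\<phi> X ?x) (cmap c' p)) ?x
      + \<Gamma> c' (cmap c' p, tcomp v c') (dd ?\<phi> X ?x) (dd ?\<phi> Y ?x)"
    using c' by (simp add: c'.tcomp_conn[OF p] tcomp_vec_of)
  moreover have "tcomp (?D (c.E X) (c.E Y) p) c' = dd ?\<phi> (tcomp (?D (c.E X) (c.E Y) p) c) ?x"
    by (rule tcomp_tangent[OF c'.conn_tangent[OF p] c c'])
  ultimately show ?thesis
    using 1 dd_trans_trans[OF c c' c] dd_trans_self[OF c] by simp
qed

end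

section \<open>Covariant derivatives along curves\<close>

lemma has_vector_derivative_chain:
  assumes "(f has_vector_derivative v) (at t within I)" "(g has_derivative g') (at (f t))"
  shows "((\<lambda>\<tau>. g (f \<tau>)) has_vector_derivative g' v) (at t within I)"
  using has_derivative_compose[OF assms(1)[unfolded has_vector_derivative_def] assms(2)]
    linear_scale[OF has_derivative_linear[OF assms(2)]]
  by (simp add: has_vector_derivative_def)

text \<open>Needed for changing charts along a curve: the new components of a field are the
  derivative of the transition map, with base point and argument both moving.\<close>

lemma has_derivative_dd_joint:
  assumes "open S" "smooth_on S f" "x \<in> S"
  shows "((\<lambda>z. dd f (snd z) (fst z)) has_derivative (\<lambda>h. dd (dd f w) (fst h) x + dd f (snd h) x)) (at (x, w))"
proof -
  have d: "((\<lambda>z. dd f v (fst z)) has_derivative (\<lambda>h. dd (dd f v) (fst h) x)) (at (x, w))" for v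
    using has_derivative_compose[OF has_derivative_fst[OF has_derivative_ident] smooth_on_has_derivative[OF smooth_on_dd[OF assms(2)]], of "(x, w)" v UNIV]
      assms(3) by simp
  have "((\<lambda>z. dd f (snd z) (fst z)) has_derivative
      (\<lambda>h. dd (\<lambda>z. dd f (snd (x, w)) (fst z)) h (x, w) + dd f (dd snd h (x, w)) (fst (x, w)))) (at (x, w))"
  proof (rule dd_linear_app[of "S \<times> UNIV"])
    show "open (S \<times> (UNIV :: 'a set))" using assms(1) by (intro open_Times open_UNIV)
    show "linear (\<lambda>w. dd f w (fst z))" if "z \<in> S \<times> (UNIV :: 'a set)" for z
      using that by (intro linear_dd smooth_on_imp_differentiable[OF assms(2)]) auto
    show "(\<lambda>z. dd f v (fst z)) differentiable at (x, w)" for v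
      using d by (auto simp: differentiable_def)
    show "(snd :: 'a \<times> 'a \<Rightarrow> 'a) differentiable at (x, w)"
      by (intro bounded_linear_imp_differentiable bounded_linear_snd)
  qed (use assms in auto)
  moreover have "dd (snd :: 'a \<times> 'a \<Rightarrow> 'a) h (x, w) = snd h" for h
    by (rule dd_eqI) (intro has_derivative_snd has_derivative_ident)
  ultimately show ?thesis using dd_eqI[OF d] by simp
qed

lemma bilinear_vec_sum:
  fixes f :: "real ^ 'n \<Rightarrow> real ^ 'n \<Rightarrow> real ^ 'n"
  assumes "\<And>Y. linear (\<lambda>X. f X Y)" "\<And>X. linear (f X)"
  shows "f X Y $ i = (\<Sum>j\<in>UNIV. \<Sum>k\<in>UNIV. X $ j * Y $ k * f (axis j 1) (axis k 1) $ i)"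
proof -
  have "f X Y = (\<Sum>j\<in>UNIV. X $ j *\<^sub>R (\<Sum>k\<in>UNIV. Y $ k *\<^sub>R f (axis j 1) (axis k 1)))"
    unfolding linear_vec_sum[OF assms(1), of X Y] by (subst linear_vec_sum[OF assms(2), of _ Y]) simp
  then show ?thesis by (simp add: sum_component sum_distrib_left mult.assoc)
qed

lemma trilinear_vec_sum:
  fixes f :: "real ^ 'n \<Rightarrow> real ^ 'n \<Rightarrow> real ^ 'n \<Rightarrow> real ^ 'n"
  assumes "\<And>Y Z. linear (\<lambda>X. f X Y Z)" "\<And>X Z. linear (\<lambda>Y. f X Y Z)" "\<And>X Y. linear (f X Y)"
  shows "f X Y Z $ i = (\<Sum>j\<in>UNIV. \<Sum>k\<in>UNIV. \<Sum>l\<in>UNIV. X $ j * Y $ k * Z $ l * f (axis j 1) (axis k 1) (axis l 1) $ i)"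
proof -
  have "f X Y Z = (\<Sum>j\<in>UNIV. X $ j *\<^sub>R f (axis j 1) Y Z)"
    by (rule linear_vec_sum[OF assms(1)])
  moreover have "f (axis j 1) Y Z $ i =
      (\<Sum>k\<in>UNIV. \<Sum>l\<in>UNIV. Y $ k * Z $ l * f (axis j 1) (axis k 1) (axis l 1) $ i)" for j
    by (rule bilinear_vec_sum[OF assms(2,3)])
  ultimately show ?thesis
    by (simp add: sum_component sum_distrib_left mult.assoc)
qed

context pseudo_finsler_manifold
begin

text \<open>Continuity of the curve is available only through its coordinates in \<open>c\<close>,
  so the overlap with \<open>cdom c'\<close> is pulled back through the image of the chart
  \<open>c\<close>.\<close>

lemma eventually_in_cdom:
  assumes c: "c \<in> charts_at F (\<alpha> t)" and c': "c' \<in> charts_at F (\<alpha> t)"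
    and "continuous (at t within I) (\<lambda>\<tau>. cmap c (\<alpha> \<tau>))" "\<forall>\<^sub>F \<tau> in at t within I. \<alpha> \<tau> \<in> cdom c"
  shows "\<forall>\<^sub>F \<tau> in at t within I. \<alpha> \<tau> \<in> cdom c'"
proof -
  have ca: "c \<in> atlas F" "c' \<in> atlas F" using c c' by (auto simp: in_charts_at)
  have "\<forall>\<^sub>F \<tau> in at t within I. cmap c (\<alpha> \<tau>) \<in> cmap c ` (cdom c \<inter> cdom c')"
    using topological_tendstoD[OF assms(3)[unfolded continuous_within] open_cmap_image[OF ca(1) open_cdom[OF ca(2)]]] c c'
    by (auto simp: in_charts_at)
  with assms(4) show ?thesis
  proof eventually_elim
    case (elim \<tau>)
    then have "cinv c (cmap c (\<alpha> \<tau>)) = \<alpha> \<tau>" using ca by (intro cinv_cmap) (auto simp: in_charts_at)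
    with cinv_in[OF ca(1) elim(2)] show ?case by simp
  qed
qed

text \<open>The chain rule through the transition map to \<open>chart_at\<close>. The nontrivial
  filter at \<open>t\<close> makes the one-sided derivative unique.\<close>

lemma velocity_chart:
  assumes c: "c \<in> charts_at F (\<alpha> t)" and t: "t \<in> I" "at t within I \<noteq> bot"
    and \<alpha>: "((\<lambda>\<tau>. cmap c (\<alpha> \<tau>)) has_vector_derivative \<xi>) (at t within I)"
    and ev: "\<forall>\<^sub>F \<tau> in at t within I. \<alpha> \<tau> \<in> cdom c"
  shows "velocity F I \<alpha> t = vec_of F c (\<alpha> t) \<xi>"
proof -
  define c' where "c' = chart_at F (\<alpha> t)"
  have c': "c' \<in> charts_at F (\<alpha> t)" by (simp add: c'_def chart_at_in)
  have "((\<lambda>\<tau>. trans c c' (cmap c (\<alpha> \<tau>))) has_vector_derivative dd (trans c c') \<xi> (cmap c (\<alpha> t))) (at t within I)"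
    by (rule has_vector_derivative_chain[OF \<alpha> has_derivative_trans[OF c c']])
  moreover have "\<forall>\<^sub>F \<tau> in at t within I. trans c c' (cmap c (\<alpha> \<tau>)) = cmap c' (\<alpha> \<tau>)"
    using ev by eventually_elim (use c in \<open>auto simp: in_charts_at cinv_cmap\<close>)
  ultimately have "((\<lambda>\<tau>. cmap c' (\<alpha> \<tau>)) has_vector_derivative dd (trans c c') \<xi> (cmap c (\<alpha> t))) (at t within I)"
    using has_derivative_transform_eventually[of "\<lambda>\<tau>. trans c c' (cmap c (\<alpha> \<tau>))" _ t I "\<lambda>\<tau>. cmap c' (\<alpha> \<tau>)"] c t
    by (auto simp: has_vector_derivative_def cinv_cmap)
  then have "vector_derivative (cmap c' \<circ> \<alpha>) (at t within I) = dd (trans c c') \<xi> (cmap c (\<alpha> t))"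
    using vector_derivative_within[OF t(2)] by (simp add: o_def)
  then show ?thesis
    using c c' by (intro tangent_eqI[OF _ _ c'])
      (auto simp: velocity_def Let_def vec_of_tangent tcomp_vec_of[of c' "\<alpha> t" c] simp flip: c'_def)
qed

lemma cov_deriv_tangent: "cov_deriv F I \<alpha> T X t \<in> tangent_space F (\<alpha> t)"
  by (simp add: cov_deriv_def Let_def vec_of_tangent chart_at_in)

text \<open>Differentiating the components of \<open>X\<close> in the chart of the definition
  produces a second derivative of the transition map, and this is exactly the inhomogeneous term in
  the transformation law of \<open>\<Gamma>\<close>.\<close>

lemma cov_deriv_chart:
  assumes c: "c \<in> charts_at F (\<alpha> t)" and t: "t \<in> I" "at t within I \<noteq> bot"
    and \<alpha>: "((\<lambda>\<tau>. cmap c (\<alpha> \<tau>)) has_vector_derivative \<xi>) (at t within I)"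
    and ev: "\<forall>\<^sub>F \<tau> in at t within I. \<alpha> \<tau> \<in> cdom c"
    and T: "(\<alpha> t, T t) \<in> adm F"
    and tan: "\<And>\<tau>. \<tau> \<in> I \<Longrightarrow> X \<tau> \<in> tangent_space F (\<alpha> \<tau>)"
    and X: "((\<lambda>\<tau>. tcomp (X \<tau>) c) has_vector_derivative \<eta>) (at t within I)"
  shows "tcomp (cov_deriv F I \<alpha> T X t) c = \<eta> + \<Gamma> c (cmap c (\<alpha> t), tcomp (T t) c) (tcomp (X t) c) \<xi>"
proof -
  define c' where "c' = chart_at F (\<alpha> t)"
  have c': "c' \<in> charts_at F (\<alpha> t)" by (simp add: c'_def chart_at_in)
  let ?\<phi> = "trans c c'" and ?x = "cmap c (\<alpha> t)" and ?w = "tcomp (X t) c"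
  let ?z' = "(cmap c' (\<alpha> t), tcomp (T t) c')"
  have ca: "c \<in> atlas F" "c' \<in> atlas F" using c c' by (auto simp: in_charts_at)
  have z': "?z' \<in> adm_in F c'" by (rule adm_inD[OF T c'])
  let ?S = "cmap c ` (cdom c \<inter> cdom c')"
  have S: "open ?S" "?x \<in> ?S" using c c' by (auto simp: in_charts_at open_cmap_image open_cdom)
  have \<phi>: "smooth_on ?S ?\<phi>" by (rule smooth_trans[OF ca])
  have ev': "\<forall>\<^sub>F \<tau> in at t within I. \<alpha> \<tau> \<in> cdom c'"
    using has_vector_derivative_continuous[OF \<alpha>] by (rule eventually_in_cdom[OF c c' _ ev])
  have "((\<lambda>\<tau>. dd ?\<phi> (tcomp (X \<tau>) c) (cmap c (\<alpha> \<tau>))) has_vector_derivative dd (dd ?\<phi> ?w) \<xi> ?x + dd ?\<phi> \<eta> ?x) (at t within I)"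
    using has_vector_derivative_chain[OF has_vector_derivative_Pair[OF \<alpha> X] has_derivative_dd_joint[OF S(1) \<phi> S(2)]] by simp
  moreover have "\<forall>\<^sub>F \<tau> in at t within I. dd ?\<phi> (tcomp (X \<tau>) c) (cmap c (\<alpha> \<tau>)) = tcomp (X \<tau>) c'"
  proof -
    have "\<forall>\<^sub>F \<tau> in at t within I. \<tau> \<in> I" by (simp add: eventually_at_filter)
    with ev ev' show ?thesis
      by eventually_elim (intro tcomp_tangent[symmetric] tan, auto simp: in_charts_at ca)
  qed
  moreover have "dd ?\<phi> ?w ?x = tcomp (X t) c'"
    by (rule tcomp_tangent[symmetric]) (intro tan t c c')+
  ultimately have "((\<lambda>\<tau>. tcomp (X \<tau>) c') has_vector_derivative dd (dd ?\<phi> ?w) \<xi> ?x + dd ?\<phi> \<eta> ?x) (at t within I)"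
    using has_derivative_transform_eventually[of "\<lambda>\<tau>. dd ?\<phi> (tcomp (X \<tau>) c) (cmap c (\<alpha> \<tau>))" _ t I "\<lambda>\<tau>. tcomp (X \<tau>) c'"] t
    by (auto simp: has_vector_derivative_def)
  then have vd: "vector_derivative (\<lambda>\<tau>. tcomp (X \<tau>) c') (at t within I) = dd (dd ?\<phi> ?w) \<xi> ?x + dd ?\<phi> \<eta> ?x"
    by (rule vector_derivative_within[OF t(2)])
  have vel: "tcomp (velocity F I \<alpha> t) c' = dd ?\<phi> \<xi> ?x"
    using velocity_chart[OF c t \<alpha> ev] c' by (simp add: tcomp_vec_of)
  have "cov_deriv F I \<alpha> T X t =
      vec_of F c' (\<alpha> t) (dd (dd ?\<phi> ?w) \<xi> ?x + dd ?\<phi> \<eta> ?x + \<Gamma> c' ?z' (dd ?\<phi> ?w ?x) (dd ?\<phi> \<xi> ?x))"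
    unfolding cov_deriv_def Let_def c'_def[symmetric] vd vel christoffel_eq[OF T c']
    by (rule arg_cong[where f = "vec_of F c' (\<alpha> t)"])
      (simp add: vec_eq_iff bilinear_vec_sum[of "\<Gamma> c' ?z'" "tcomp (X t) c'" "dd ?\<phi> \<xi> ?x", OF linear_\<Gamma>(2,1)[OF ca(2) z']] \<open>dd ?\<phi> ?w ?x = tcomp (X t) c'\<close>)
  also have "\<dots> = vec_of F c' (\<alpha> t) (dd ?\<phi> (\<eta> + \<Gamma> c (?x, tcomp (T t) c) ?w \<xi>) ?x)"
    \<comment> \<open>The two second derivatives of the transition map come in opposite orders,
      hence \<open>dd_commute\<close>.\<close>
    using \<Gamma>_transformation[OF T c c', of ?w \<xi>] dd_commute[OF S(1) \<phi> S(2), of ?w \<xi>]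
      linear_add[OF linear_dd_trans[OF c c']] by (simp add: algebra_simps)
  finally show ?thesis
    using c dd_trans_trans[OF c c' c] dd_trans_self[OF c] by (simp add: tcomp_vec_of[OF c])
qed

end

section \<open>The Chern tensor and the Chern curvature\<close>

context pseudo_finsler_manifold
begin

definition d\<Gamma> where "d\<Gamma> c z h X Y = dd (\<lambda>z. \<Gamma> c z X Y) h z"

context
  fixes c z
  assumes c: "c \<in> atlas F" and z: "z \<in> adm_in F c"
begin

lemma \<Gamma>_differentiable: "(\<lambda>z. \<Gamma> c z X Y) differentiable (at z)"
  by (rule smooth_on_imp_differentiable[OF smooth_\<Gamma>[OF c] z])

lemma linear_d\<Gamma>_dir: "linear (\<lambda>h. d\<Gamma> c z h X Y)"
  unfolding d\<Gamma>_def by (rule linear_dd[OF \<Gamma>_differentiable])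

lemma d\<Gamma>_sym: "d\<Gamma> c z h X Y = d\<Gamma> c z h Y X"
  unfolding d\<Gamma>_def by (rule dd_cong_open[OF open_adm_in[OF c] z \<Gamma>_sym[OF c]])

lemma linear_d\<Gamma>: "linear (d\<Gamma> c z h X)" "linear (\<lambda>X. d\<Gamma> c z h X Y)"
proof -
  show 1: "linear (d\<Gamma> c z h X)" for X
  proof
    fix Y Y' :: "real ^ 'n" and r :: real
    have "d\<Gamma> c z h X (Y + Y') = dd (\<lambda>z. \<Gamma> c z X Y + \<Gamma> c z X Y') h z"
      unfolding d\<Gamma>_def by (rule dd_cong_open[OF open_adm_in[OF c] z]) (rule linear_add[OF linear_\<Gamma>(1)[OF c]])
    also have "\<dots> = d\<Gamma> c z h X Y + d\<Gamma> c z h X Y'"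
      unfolding d\<Gamma>_def by (rule dd_eqI[OF has_derivative_add[OF has_derivative_dd has_derivative_dd]]) (rule \<Gamma>_differentiable)+
    finally show "d\<Gamma> c z h X (Y + Y') = d\<Gamma> c z h X Y + d\<Gamma> c z h X Y'" .
    have "d\<Gamma> c z h X (r *\<^sub>R Y) = dd (\<lambda>z. r *\<^sub>R \<Gamma> c z X Y) h z"
      unfolding d\<Gamma>_def by (rule dd_cong_open[OF open_adm_in[OF c] z]) (rule linear_scale[OF linear_\<Gamma>(1)[OF c]])
    also have "\<dots> = r *\<^sub>R d\<Gamma> c z h X Y"
      unfolding d\<Gamma>_def by (rule dd_linear_image[OF \<Gamma>_differentiable bounded_linear_scaleR_right])
    finally show "d\<Gamma> c z h X (r *\<^sub>R Y) = r *\<^sub>R d\<Gamma> c z h X Y" .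
  qed
  show "linear (\<lambda>X. d\<Gamma> c z h X Y)"
    using 1[of Y] by (subst d\<Gamma>_sym) simp
qed

text \<open>Along a curve the base vector and both arguments of \<open>\<Gamma>\<close> move.
  \<open>dd_linear_app\<close> is applied first to the last argument and then to the middle
  one.\<close>

lemma has_derivative_\<Gamma>_joint:
  "((\<lambda>q. \<Gamma> c (fst q) (fst (snd q)) (snd (snd q))) has_derivative
    (\<lambda>h. d\<Gamma> c z (fst h) w u + \<Gamma> c z (fst (snd h)) u + \<Gamma> c z w (snd (snd h)))) (at (z, w, u))"
proof -
  let ?Q = "adm_in F c \<times> (UNIV :: ((real ^ 'n) \<times> (real ^ 'n)) set)"
  have Q: "open ?Q" "(z, w, u) \<in> ?Q" using open_adm_in[OF c] z by (auto intro: open_Times)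
  have lin: "linear (\<Gamma> c (fst q) X)" "linear (\<lambda>X. \<Gamma> c (fst q) X Y)" if "q \<in> ?Q" for q X Y
    using that linear_\<Gamma>[OF c] by auto
  have d0: "((\<lambda>q. \<Gamma> c (fst q) X Y) has_derivative (\<lambda>h. d\<Gamma> c z (fst h) X Y)) (at (z, w, u))" for X Y
    unfolding d\<Gamma>_def
    by (rule has_derivative_compose[OF has_derivative_fst[OF has_derivative_ident]])
      (simp add: has_derivative_dd[OF \<Gamma>_differentiable])
  have sn: "((\<lambda>q. snd (snd q)) has_derivative (\<lambda>h. snd (snd h))) (at (z, w, u))"
    by (intro has_derivative_snd has_derivative_ident)
  have fs: "((\<lambda>q. fst (snd q)) has_derivative (\<lambda>h. fst (snd h))) (at (z, w, u))"
    by (intro has_derivative_fst has_derivative_snd has_derivative_ident)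
  have d1: "((\<lambda>q. \<Gamma> c (fst q) X (snd (snd q))) has_derivative (\<lambda>h. d\<Gamma> c z (fst h) X u + \<Gamma> c z X (snd (snd h)))) (at (z, w, u))" for X
    using dd_linear_app[OF Q, where T = "\<lambda>q. \<Gamma> c (fst q) X", OF lin(1), where u = "\<lambda>q. snd (snd q)"]
      d0 sn dd_eqI[OF d0] dd_eqI[OF sn] by (auto simp: differentiable_def)
  show ?thesis
    using dd_linear_app[OF Q, where T = "\<lambda>q X. \<Gamma> c (fst q) X (snd (snd q))", OF lin(2), where u = "\<lambda>q. fst (snd q)"]
      d1 fs dd_eqI[OF d1] dd_eqI[OF fs] by (auto simp: differentiable_def algebra_simps)
qed

end

lemma has_vector_derivative_\<Gamma>:
  assumes "c \<in> atlas F" "\<zeta> t \<in> adm_in F c" "(\<zeta> has_vector_derivative \<zeta>') (at t within I)"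
    "(w has_vector_derivative w') (at t within I)" "(u has_vector_derivative u') (at t within I)"
  shows "((\<lambda>\<tau>. \<Gamma> c (\<zeta> \<tau>) (w \<tau>) (u \<tau>)) has_vector_derivative
    d\<Gamma> c (\<zeta> t) \<zeta>' (w t) (u t) + \<Gamma> c (\<zeta> t) w' (u t) + \<Gamma> c (\<zeta> t) (w t) u') (at t within I)"
  using has_vector_derivative_chain[OF has_vector_derivative_Pair[OF assms(3) has_vector_derivative_Pair[OF assms(4,5)]]
    has_derivative_\<Gamma>_joint[OF assms(1,2)]] by simp

lemma Gam_eq:
  assumes "c \<in> atlas F" "(x, y) \<in> adm_in F c"
  shows "Gam F c x y i j k = \<Gamma> c (x, y) (axis j 1) (axis k 1) $ i"
proof -
  obtain p where p: "c \<in> charts_at F p" "x = cmap c p" "(p, vec_of F c p y) \<in> adm F"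
    using adm_inE[OF assms] .
  then show ?thesis by (simp add: Gam_def cinv_cmap christoffel_eq)
qed

text \<open>\<open>Gam\<close> is known to equal \<open>\<Gamma>\<close> only over admissible
  vectors, which covers all small \<open>h\<close>.\<close>

lemma deriv_Gam:
  assumes c: "c \<in> atlas F" and z: "(x, y) \<in> adm_in F c"
  shows "deriv (\<lambda>h. Gam F c (x + h *\<^sub>R X) (y + h *\<^sub>R Y) i j k) 0 = d\<Gamma> c (x, y) (X, Y) (axis j 1) (axis k 1) $ i"
proof -
  let ?f = "\<lambda>z. \<Gamma> c z (axis j 1) (axis k 1) $ i"
  have f: "?f differentiable (at (x, y))"
    by (rule differentiableI[OF bounded_linear.has_derivative[OF bounded_linear_vec_nth has_derivative_dd[OF \<Gamma>_differentiable[OF c z]]]])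
  have "\<forall>\<^sub>F h in nhds 0. Gam F c (x + h *\<^sub>R X) (y + h *\<^sub>R Y) i j k = ?f ((x, y) + h *\<^sub>R (X, Y))"
    using eventually_line[OF open_adm_in[OF c] z, of "(X, Y)"] by eventually_elim (simp add: Gam_eq[OF c])
  then have "deriv (\<lambda>h. Gam F c (x + h *\<^sub>R X) (y + h *\<^sub>R Y) i j k) 0 = deriv (\<lambda>h. ?f ((x, y) + h *\<^sub>R (X, Y))) 0"
    by (intro deriv_cong_ev) auto
  also have "\<dots> = dd ?f (X, Y) (x, y)" by (rule deriv_line[OF f])
  also have "\<dots> = d\<Gamma> c (x, y) (X, Y) (axis j 1) (axis k 1) $ i"
    unfolding d\<Gamma>_def by (rule dd_linear_image[OF \<Gamma>_differentiable[OF c z] bounded_linear_vec_nth])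
  finally show ?thesis .
qed

lemma dy_Gam_eq:
  assumes "c \<in> atlas F" "(x, y) \<in> adm_in F c"
  shows "dy_Gam F c x y l i j k = d\<Gamma> c (x, y) (0, axis l 1) (axis j 1) (axis k 1) $ i"
  using deriv_Gam[OF assms, of 0 "axis l 1"] by (simp add: dy_Gam_def)

text \<open>The operator \<open>\<delta>/\<delta>x\<close> is the derivative in the direction whose
  base part is a coordinate vector and whose fibre part is minus the nonlinear connection, that is,
  minus \<open>\<Gamma>\<close> applied to \<open>y\<close> and this vector.\<close>

lemma delta_Gam_eq:
  assumes c: "c \<in> atlas F" and z: "(x, y) \<in> adm_in F c"
  shows "delta_Gam F c x y l i j k =
    d\<Gamma> c (x, y) (axis l 1, - \<Gamma> c (x, y) y (axis l 1)) (axis j 1) (axis k 1) $ i"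
proof -
  let ?N = "\<Gamma> c (x, y) y (axis l 1)" and ?d = "\<lambda>h. d\<Gamma> c (x, y) h (axis j 1) (axis k 1)"
  have N: "nonlin F c x y h l = ?N $ h" for h
    using linear_vec_sum[OF linear_\<Gamma>(2)[OF assms], of y "axis l 1"]
    by (simp add: nonlin_def Gam_eq[OF assms] sum_component)
  have "linear (\<lambda>w. ?d (0, w))"
    using linear_compose[of "\<lambda>w. (0, w)" ?d] linear_d\<Gamma>_dir[OF assms] by (simp add: o_def linear_iff)
  from linear_vec_sum[OF this, of ?N]
  have "?d (0, ?N) $ i = (\<Sum>h\<in>UNIV. nonlin F c x y h l * dy_Gam F c x y h i j k)"
    by (simp add: N dy_Gam_eq[OF assms] sum_component)
  moreover have "?d (axis l 1, - ?N) = ?d (axis l 1, 0) - ?d (0, ?N)"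
    using linear_diff[OF linear_d\<Gamma>_dir[OF assms], of "(axis l 1, 0)" "(0, ?N)"] by simp
  ultimately show ?thesis
    using deriv_Gam[OF assms, of "axis l 1" 0] by (simp add: delta_Gam_def)
qed

lemma chern_tensor_eq:
  assumes v: "(p, v) \<in> adm F" and c: "c = chart_at F p"
  shows "chern_tensor F p v X Y Z =
    vec_of F c p (d\<Gamma> c (cmap c p, tcomp v c) (0, tcomp Z c) (tcomp X c) (tcomp Y c))"
proof -
  have cp: "c \<in> charts_at F p" and ca: "c \<in> atlas F" using chart_at_in c by (auto simp: in_charts_at)
  let ?z = "(cmap c p, tcomp v c)"
  have z: "?z \<in> adm_in F c" by (rule adm_inD[OF v cp])
  let ?f = "\<lambda>X Y Z. d\<Gamma> c ?z (0, Z) X Y"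
  have 1: "linear (?f X Y)" for X Y
    using linear_compose[of "\<lambda>w. (0, w)"  "\<lambda>h. d\<Gamma> c ?z h X Y"] linear_d\<Gamma>_dir[OF ca z] by (simp add: o_def linear_iff)
  show ?thesis
    unfolding chern_tensor_def Let_def c[symmetric]
    by (rule arg_cong[where f = "vec_of F c p"])
      (simp add: vec_eq_iff dy_Gam_eq[OF ca z] trilinear_vec_sum[of ?f "tcomp X c" "tcomp Y c" "tcomp Z c", OF linear_d\<Gamma>(2,1)[OF ca z] 1])
qed

text \<open>The coordinate formula without indices: \<open>Z\<close> takes the first lower index of
  the symbols, while \<open>X\<close> and \<open>Y\<close> take the second one and the horizontal
  direction. The expression is trilinear, so basis vectors suffice.\<close>

lemma chern_curvature_eq:
  assumes v: "(p, v) \<in> adm F" and c: "c = chart_at F p"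
    and z: "z = (cmap c p, tcomp v c)" and XYZ: "X' = tcomp X c" "Y' = tcomp Y c" "Z' = tcomp Z c"
  shows "chern_curvature F p v X Y Z = vec_of F c p
    (d\<Gamma> c z (X', - \<Gamma> c z (snd z) X') Z' Y' - d\<Gamma> c z (Y', - \<Gamma> c z (snd z) Y') Z' X'
     + \<Gamma> c z (\<Gamma> c z Z' Y') X' - \<Gamma> c z (\<Gamma> c z Z' X') Y')"
proof -
  have cp: "c \<in> charts_at F p" and ca: "c \<in> atlas F" using chart_at_in c by (auto simp: in_charts_at)
  have za: "z \<in> adm_in F c" unfolding z by (rule adm_inD[OF v cp])
  note G = linear_\<Gamma>[OF ca za]
  define f where "f X Y Z = d\<Gamma> c z (X, - \<Gamma> c z (snd z) X) Z Y - d\<Gamma> c z (Y, - \<Gamma> c z (snd z) Y) Z X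
     + \<Gamma> c z (\<Gamma> c z Z Y) X - \<Gamma> c z (\<Gamma> c z Z X) Y" for X Y Z
  have h: "linear (\<lambda>X. d\<Gamma> c z (X, - \<Gamma> c z (snd z) X) Z Y)" for Y Z
    using linear_compose[of "\<lambda>X. (X, - \<Gamma> c z (snd z) X)" "\<lambda>h. d\<Gamma> c z h Z Y"] linear_d\<Gamma>_dir[OF ca za]
      linear_add[OF G(1)] linear_scale[OF G(1)] by (simp add: o_def linear_iff)
  note lin = linear_compose[OF G(1) G(2), unfolded o_def] linear_compose[OF G(2) G(2), unfolded o_def]
  have f: "linear (\<lambda>X. f X Y Z)" "linear (\<lambda>Y. f X Y Z)" "linear (f X Y)" for X Y Z
    unfolding f_def by (intro linear_compose_add linear_compose_sub h linear_d\<Gamma>[OF ca za] G lin)+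
  have "curv_coeff F c (fst z) (snd z) j i k l = f (axis k 1) (axis l 1) (axis j 1) $ i" for i j k l
  proof -
    have "(\<Sum>h\<in>UNIV. Gam F c (fst z) (snd z) i h k * Gam F c (fst z) (snd z) h j l) =
        \<Gamma> c z (\<Gamma> c z (axis j 1) (axis l 1)) (axis k 1) $ i" for k l
      using linear_vec_sum[OF G(2), of "\<Gamma> c z (axis j 1) (axis l 1)" "axis k 1"] za
      by (simp add: Gam_eq[OF ca] sum_component mult.commute)
    then show ?thesis
      using delta_Gam_eq[OF ca, of "fst z" "snd z"] za by (simp add: curv_coeff_def f_def)
  qed
  then have "chern_curvature F p v X Y Z = vec_of F c p (f X' Y' Z')"
    unfolding chern_curvature_def Let_def c[symmetric] XYZ[symmetric]
    by (intro arg_cong[where f = "vec_of F c p"])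
      (simp add: vec_eq_iff z trilinear_vec_sum[of f X' Y' Z', OF f])
  then show ?thesis by (simp add: f_def)
qed

end

section \<open>Two parameter maps\<close>

context pseudo_finsler_manifold
begin

lemma velocity_cong:
  assumes "\<And>\<tau>. \<tau> \<in> I \<Longrightarrow> \<alpha> \<tau> = \<beta> \<tau>" "t \<in> I"
  shows "velocity F I \<alpha> t = velocity F I \<beta> t"
proof -
  have "vector_derivative (cmap c \<circ> \<alpha>) (at t within I) = vector_derivative (cmap c \<circ> \<beta>) (at t within I)" for c :: "('m, 'n) chart"
    by (rule vector_derivative_cong_eq) (use assms in auto)
  with assms show ?thesis by (simp add: velocity_def)
qed

lemma cov_deriv_cong:
  assumes "\<And>\<tau>. \<tau> \<in> I \<Longrightarrow> \<alpha> \<tau> = \<beta> \<tau>" "\<And>\<tau>. \<tau> \<in> I \<Longrightarrow> X \<tau> = Y \<tau>" "T t = T' t" "t \<in> I"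
  shows "cov_deriv F I \<alpha> T X t = cov_deriv F I \<beta> T' Y t"
proof -
  have "vector_derivative (\<lambda>\<tau>. tcomp (X \<tau>) c) (at t within I) = vector_derivative (\<lambda>\<tau>. tcomp (Y \<tau>) c) (at t within I)" for c :: "('m, 'n) chart"
    by (rule vector_derivative_cong_eq) (use assms in auto)
  with assms velocity_cong[of I \<alpha> \<beta> t] show ?thesis by (simp add: cov_deriv_def)
qed

end

lemma has_vector_derivative_transform_ev:
  assumes "(f has_vector_derivative v) (at t within I)" "\<forall>\<^sub>F \<tau> in nhds t. \<tau> \<in> I \<longrightarrow> f \<tau> = g \<tau>" "t \<in> I"
  shows "(g has_vector_derivative v) (at t within I)"
  using assms has_vector_derivative_cong_ev[OF assms(2)] eventually_nhds_x_imp_x[OF assms(2)] by blast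

text \<open>\<open>x\<close> is smooth on an open set that may reach beyond the parameter rectangle,
  and represents \<open>\<Lambda>\<close> only where both meet. Thus one-sided derivatives of
  \<open>\<Lambda>\<close> at an end point are ordinary partial derivatives of \<open>x\<close>, and
  these commute.\<close>

locale two_param_chart = pseudo_finsler_manifold F
  for F :: "('m::{t2_space,second_countable_topology}, 'n::finite) finsler" +
  fixes a b \<epsilon> :: real and \<Lambda> :: "real \<Rightarrow> real \<Rightarrow> 'm" and c :: "('m, 'n) chart"
    and U :: "(real \<times> real) set" and x :: "real \<times> real \<Rightarrow> real ^ 'n"
  assumes ab: "a < b"
    and adm: "t \<in> {a..b} \<Longrightarrow> s \<in> {-\<epsilon><..<\<epsilon>} \<Longrightarrow> (\<Lambda> t s, Lam_t F a b \<Lambda> t s) \<in> adm F"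
    and c: "c \<in> atlas F" and U: "open U" and x: "smooth_on U x"
    and \<Lambda>_x: "t \<in> {a..b} \<Longrightarrow> s \<in> {-\<epsilon><..<\<epsilon>} \<Longrightarrow> (t, s) \<in> U \<Longrightarrow> \<Lambda> t s \<in> cdom c \<and> cmap c (\<Lambda> t s) = x (t, s)"
begin

abbreviation "I \<equiv> {a..b}"
abbreviation "J \<equiv> {-\<epsilon><..<\<epsilon>}"
abbreviation dt where "dt f \<equiv> dd f (1, 0)"
abbreviation ds where "ds f \<equiv> dd f (0, 1)"

lemma I_limit: "t \<in> I \<Longrightarrow> at t within I \<noteq> bot"
  using ab by (simp add: trivial_limit_within)

lemma J_limit: "s \<in> J \<Longrightarrow> at s within J \<noteq> bot"
  by (simp add: at_within_open[OF _ open_greaterThanLessThan])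

lemma U_slices:
  assumes "(t, s) \<in> U"
  shows "\<forall>\<^sub>F \<tau> in nhds t. (\<tau>, s) \<in> U" "\<forall>\<^sub>F \<sigma> in nhds s. (t, \<sigma>) \<in> U"
proof -
  have "((\<lambda>\<tau>. (\<tau>, s)) \<longlongrightarrow> (t, s)) (nhds t)" "((\<lambda>\<sigma>. (t, \<sigma>)) \<longlongrightarrow> (t, s)) (nhds s)"
    by (intro tendsto_intros filterlim_ident)+
  then show "\<forall>\<^sub>F \<tau> in nhds t. (\<tau>, s) \<in> U" "\<forall>\<^sub>F \<sigma> in nhds s. (t, \<sigma>) \<in> U"
    using topological_tendstoD[OF _ U assms] by auto
qed

lemma slice_derivatives:
  assumes "smooth_on U f" "(t, s) \<in> U"
  shows "((\<lambda>\<tau>. f (\<tau>, s)) has_vector_derivative dt f (t, s)) (at t within I)"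
    and "((\<lambda>\<sigma>. f (t, \<sigma>)) has_vector_derivative ds f (t, s)) (at s within J)"
proof -
  have d: "((\<lambda>\<tau>. (\<tau>, s)) has_vector_derivative (1, 0)) (at t within I)"
    "((\<lambda>\<sigma>. (t, \<sigma>)) has_vector_derivative (0, 1)) (at s within J)"
    by (auto intro!: has_vector_derivative_Pair derivative_intros)
  show "((\<lambda>\<tau>. f (\<tau>, s)) has_vector_derivative dt f (t, s)) (at t within I)"
    by (rule has_vector_derivative_chain[where f = "\<lambda>\<tau>. (\<tau>, s)", OF d(1) smooth_on_has_derivative[OF assms]])
  show "((\<lambda>\<sigma>. f (t, \<sigma>)) has_vector_derivative ds f (t, s)) (at s within J)"
    by (rule has_vector_derivative_chain[where f = "\<lambda>\<sigma>. (t, \<sigma>)", OF d(2) smooth_on_has_derivative[OF assms]])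
qed

lemma slice_transform_t:
  assumes "t \<in> I" "(t, s) \<in> U" "(f has_vector_derivative v) (at t within I)"
    and "\<And>\<tau>. \<tau> \<in> I \<Longrightarrow> (\<tau>, s) \<in> U \<Longrightarrow> f \<tau> = g \<tau>"
  shows "(g has_vector_derivative v) (at t within I)"
proof (rule has_vector_derivative_transform_ev[OF assms(3) _ assms(1)])
  show "\<forall>\<^sub>F \<tau> in nhds t. \<tau> \<in> I \<longrightarrow> f \<tau> = g \<tau>"
    using U_slices(1)[OF assms(2)] by eventually_elim (use assms(4) in blast)
qed

lemma slice_transform_s:
  assumes "s \<in> J" "(t, s) \<in> U" "(f has_vector_derivative v) (at s within J)"
    and "\<And>\<sigma>. \<sigma> \<in> J \<Longrightarrow> (t, \<sigma>) \<in> U \<Longrightarrow> f \<sigma> = g \<sigma>"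
  shows "(g has_vector_derivative v) (at s within J)"
proof (rule has_vector_derivative_transform_ev[OF assms(3) _ assms(1)])
  show "\<forall>\<^sub>F \<sigma> in nhds s. \<sigma> \<in> J \<longrightarrow> f \<sigma> = g \<sigma>"
    using U_slices(2)[OF assms(2)] by eventually_elim (use assms(4) in blast)
qed

lemma \<Lambda>_derivatives:
  assumes "t \<in> I" "s \<in> J" "(t, s) \<in> U"
  shows "((\<lambda>\<tau>. cmap c (\<Lambda> \<tau> s)) has_vector_derivative dt x (t, s)) (at t within I)"
    and "((\<lambda>\<sigma>. cmap c (\<Lambda> t \<sigma>)) has_vector_derivative ds x (t, s)) (at s within J)"
  by (rule slice_transform_t[OF assms(1,3) slice_derivatives(1)[OF x assms(3)]]; use \<Lambda>_x assms(2) in simp)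
    (rule slice_transform_s[OF assms(2,3) slice_derivatives(2)[OF x assms(3)]]; use \<Lambda>_x assms(1) in simp)

lemma \<Lambda>_eventually:
  assumes "t \<in> I" "s \<in> J" "(t, s) \<in> U"
  shows "\<forall>\<^sub>F \<tau> in at t within I. \<Lambda> \<tau> s \<in> cdom c" "\<forall>\<^sub>F \<sigma> in at s within J. \<Lambda> t \<sigma> \<in> cdom c"
proof -
  show "\<forall>\<^sub>F \<tau> in at t within I. \<Lambda> \<tau> s \<in> cdom c"
    unfolding eventually_at_filter using U_slices(1)[OF assms(3)] by eventually_elim (use \<Lambda>_x assms in auto)
  show "\<forall>\<^sub>F \<sigma> in at s within J. \<Lambda> t \<sigma> \<in> cdom c"
    unfolding eventually_at_filter using U_slices(2)[OF assms(3)] by eventually_elim (use \<Lambda>_x assms in auto)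
qed

lemma c_chart: "t \<in> I \<Longrightarrow> s \<in> J \<Longrightarrow> (t, s) \<in> U \<Longrightarrow> c \<in> charts_at F (\<Lambda> t s)"
  using \<Lambda>_x c by (auto simp: in_charts_at)

lemma Lam_tcomp:
  assumes "t \<in> I" "s \<in> J" "(t, s) \<in> U"
  shows "tcomp (Lam_t F a b \<Lambda> t s) c = dt x (t, s)" "tcomp (Lam_s F \<epsilon> \<Lambda> t s) c = ds x (t, s)"
  using velocity_chart[OF c_chart[OF assms] assms(1) I_limit[OF assms(1)] \<Lambda>_derivatives(1)[OF assms] \<Lambda>_eventually(1)[OF assms]]
    velocity_chart[OF c_chart[OF assms] assms(2) J_limit[OF assms(2)] \<Lambda>_derivatives(2)[OF assms] \<Lambda>_eventually(2)[OF assms]]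
    c_chart[OF assms]
  by (simp_all add: Lam_t_def Lam_s_def)

text \<open>The reference vector \<open>\<Lambda>\<^sub>t\<close> in the coordinates of the tangent
  bundle; every \<open>\<Gamma>\<close> below is evaluated at it.\<close>

definition "\<zeta> q = (x q, dt x q)"

lemma smooth_\<zeta>: "smooth_on U \<zeta>"
  unfolding \<zeta>_def[abs_def] by (intro smooth_on_Pair U x smooth_on_dd)

lemma dd_\<zeta>: "q \<in> U \<Longrightarrow> dd \<zeta> h q = (dd x h q, dd (dt x) h q)"
  unfolding \<zeta>_def[abs_def]
  by (rule dd_eqI[OF has_derivative_Pair]) (auto intro: smooth_on_has_derivative[OF x] smooth_on_has_derivative[OF smooth_on_dd[OF x]])

lemma \<zeta>_adm:
  assumes "t \<in> I" "s \<in> J" "(t, s) \<in> U"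
  shows "\<zeta> (t, s) \<in> adm_in F c"
  using adm_inD[OF adm[OF assms(1,2)] c_chart[OF assms]] \<Lambda>_x[OF assms] Lam_tcomp[OF assms] by (simp add: \<zeta>_def)

lemma D_gam_tcomp:
  assumes "t \<in> I" "s \<in> J" "(t, s) \<in> U" and tan: "\<And>\<tau>. \<tau> \<in> I \<Longrightarrow> W \<tau> s \<in> tangent_space F (\<Lambda> \<tau> s)"
    and W: "((\<lambda>\<tau>. tcomp (W \<tau> s) c) has_vector_derivative \<eta>) (at t within I)"
  shows "tcomp (D_gam F a b \<Lambda> W t s) c = \<eta> + \<Gamma> c (\<zeta> (t, s)) (tcomp (W t s) c) (dt x (t, s))"
  using cov_deriv_chart[where \<alpha> = "\<lambda>\<tau>. \<Lambda> \<tau> s" and T = "\<lambda>\<tau>. Lam_t F a b \<Lambda> \<tau> s" and X = "\<lambda>\<tau>. W \<tau> s",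
      OF c_chart[OF assms(1-3)] assms(1) I_limit[OF assms(1)] \<Lambda>_derivatives(1)[OF assms(1-3)] \<Lambda>_eventually(1)[OF assms(1-3)]
        adm[OF assms(1,2)] tan W]
    \<Lambda>_x[OF assms(1-3)] Lam_tcomp[OF assms(1-3)]
  by (simp add: D_gam_def \<zeta>_def)

lemma D_bet_tcomp:
  assumes "t \<in> I" "s \<in> J" "(t, s) \<in> U" and tan: "\<And>\<sigma>. \<sigma> \<in> J \<Longrightarrow> W t \<sigma> \<in> tangent_space F (\<Lambda> t \<sigma>)"
    and W: "((\<lambda>\<sigma>. tcomp (W t \<sigma>) c) has_vector_derivative \<eta>) (at s within J)"
  shows "tcomp (D_bet F a b \<epsilon> \<Lambda> W t s) c = \<eta> + \<Gamma> c (\<zeta> (t, s)) (tcomp (W t s) c) (ds x (t, s))"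
  using cov_deriv_chart[where \<alpha> = "\<lambda>\<sigma>. \<Lambda> t \<sigma>" and T = "\<lambda>\<sigma>. Lam_t F a b \<Lambda> t \<sigma>" and X = "\<lambda>\<sigma>. W t \<sigma>",
      OF c_chart[OF assms(1-3)] assms(2) J_limit[OF assms(2)] \<Lambda>_derivatives(2)[OF assms(1-3)] \<Lambda>_eventually(2)[OF assms(1-3)]
        adm[OF assms(1,2)] tan W]
    \<Lambda>_x[OF assms(1-3)] Lam_tcomp[OF assms(1-3)]
  by (simp add: D_bet_def \<zeta>_def)

lemma D_tangent:
  "D_gam F a b \<Lambda> W t s \<in> tangent_space F (\<Lambda> t s)" "D_bet F a b \<epsilon> \<Lambda> W t s \<in> tangent_space F (\<Lambda> t s)"
  unfolding D_gam_def D_bet_def by (rule cov_deriv_tangent)+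

text \<open>The reference vector moves with both parameters, so the chain rule differentiates
  \<open>\<Gamma>\<close> also in the fibre direction; the second derivatives of \<open>x\<close> in
  the first two terms record this.\<close>

lemma R_Lam_tcomp:
  assumes ts: "t \<in> I" "s \<in> J" "(t, s) \<in> U" and w: "smooth_on U w"
    and tan: "\<And>t s. t \<in> I \<Longrightarrow> s \<in> J \<Longrightarrow> W t s \<in> tangent_space F (\<Lambda> t s)"
    and W_w: "\<And>t s. t \<in> I \<Longrightarrow> s \<in> J \<Longrightarrow> (t, s) \<in> U \<Longrightarrow> tcomp (W t s) c = w (t, s)"
  shows "tcomp (R_Lam F a b \<epsilon> \<Lambda> W t s) c =
    d\<Gamma> c (\<zeta> (t, s)) (dt x (t, s), dt (dt x) (t, s)) (w (t, s)) (ds x (t, s))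
    - d\<Gamma> c (\<zeta> (t, s)) (ds x (t, s), ds (dt x) (t, s)) (w (t, s)) (dt x (t, s))
    + \<Gamma> c (\<zeta> (t, s)) (\<Gamma> c (\<zeta> (t, s)) (w (t, s)) (ds x (t, s))) (dt x (t, s))
    - \<Gamma> c (\<zeta> (t, s)) (\<Gamma> c (\<zeta> (t, s)) (w (t, s)) (dt x (t, s))) (ds x (t, s))"
proof -
  note der = slice_derivatives[OF _ ts(3)]
  have W_derivatives: "((\<lambda>\<tau>. tcomp (W \<tau> s) c) has_vector_derivative dt w (t, s)) (at t within I)"
    "((\<lambda>\<sigma>. tcomp (W t \<sigma>) c) has_vector_derivative ds w (t, s)) (at s within J)"
    if "t \<in> I" "s \<in> J" "(t, s) \<in> U" for t s
    by (rule slice_transform_t[OF that(1,3) slice_derivatives(1)[OF w that(3)]]; use W_w that(2) in simp)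
      (rule slice_transform_s[OF that(2,3) slice_derivatives(2)[OF w that(3)]]; use W_w that(1) in simp)
  \<comment> \<open>Holding on all of \<open>U\<close>, not just at the given point, these formulas
    can be differentiated once more.\<close>
  have bet: "tcomp (D_bet F a b \<epsilon> \<Lambda> W t s) c = ds w (t, s) + \<Gamma> c (\<zeta> (t, s)) (w (t, s)) (ds x (t, s))"
    and gam: "tcomp (D_gam F a b \<Lambda> W t s) c = dt w (t, s) + \<Gamma> c (\<zeta> (t, s)) (w (t, s)) (dt x (t, s))"
    if "t \<in> I" "s \<in> J" "(t, s) \<in> U" for t s
    using D_bet_tcomp[where W = W, OF that tan[OF that(1)] W_derivatives(2)[OF that]]
      D_gam_tcomp[where W = W, OF that tan[OF _ that(2)] W_derivatives(1)[OF that]] that by (simp_all add: W_w)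
  let ?z = "\<zeta> (t, s)" and ?w = "w (t, s)" and ?u = "dt x (t, s)" and ?v = "ds x (t, s)"
  have z: "?z \<in> adm_in F c" by (rule \<zeta>_adm[OF ts])
  have "((\<lambda>\<tau>. tcomp (D_bet F a b \<epsilon> \<Lambda> W \<tau> s) c) has_vector_derivative
      dt (ds w) (t, s) + (d\<Gamma> c ?z (dt \<zeta> (t, s)) ?w ?v + \<Gamma> c ?z (dt w (t, s)) ?v + \<Gamma> c ?z ?w (dt (ds x) (t, s)))) (at t within I)"
    by (rule slice_transform_t[OF ts(1,3) has_vector_derivative_add[OF der(1)
          has_vector_derivative_\<Gamma>[where t = t and \<zeta> = "\<lambda>\<tau>. \<zeta> (\<tau>, s)" and w = "\<lambda>\<tau>. w (\<tau>, s)" and u = "\<lambda>\<tau>. ds x (\<tau>, s)", OF c z der(1) der(1) der(1)]]])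
      (use ts in \<open>auto intro: smooth_on_dd w x smooth_\<zeta> simp: bet\<close>)
  from D_gam_tcomp[where W = "D_bet F a b \<epsilon> \<Lambda> W", OF ts D_tangent(2) this]
  have 1: "tcomp (D_gam F a b \<Lambda> (D_bet F a b \<epsilon> \<Lambda> W) t s) c =
      dt (ds w) (t, s) + (d\<Gamma> c ?z (dt \<zeta> (t, s)) ?w ?v + \<Gamma> c ?z (dt w (t, s)) ?v + \<Gamma> c ?z ?w (dt (ds x) (t, s)))
      + \<Gamma> c ?z (ds w (t, s) + \<Gamma> c ?z ?w ?v) ?u"
    using ts by (simp add: bet)
  have "((\<lambda>\<sigma>. tcomp (D_gam F a b \<Lambda> W t \<sigma>) c) has_vector_derivative
      ds (dt w) (t, s) + (d\<Gamma> c ?z (ds \<zeta> (t, s)) ?w ?u + \<Gamma> c ?z (ds w (t, s)) ?u + \<Gamma> c ?z ?w (ds (dt x) (t, s)))) (at s within J)"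
    by (rule slice_transform_s[OF ts(2,3) has_vector_derivative_add[OF der(2)
          has_vector_derivative_\<Gamma>[where t = s and \<zeta> = "\<lambda>\<sigma>. \<zeta> (t, \<sigma>)" and w = "\<lambda>\<sigma>. w (t, \<sigma>)" and u = "\<lambda>\<sigma>. dt x (t, \<sigma>)", OF c z der(2) der(2) der(2)]]])
      (use ts in \<open>auto intro: smooth_on_dd w x smooth_\<zeta> simp: gam\<close>)
  from D_bet_tcomp[where W = "D_gam F a b \<Lambda> W", OF ts D_tangent(1) this]
  have 2: "tcomp (D_bet F a b \<epsilon> \<Lambda> (D_gam F a b \<Lambda> W) t s) c =
      ds (dt w) (t, s) + (d\<Gamma> c ?z (ds \<zeta> (t, s)) ?w ?u + \<Gamma> c ?z (ds w (t, s)) ?u + \<Gamma> c ?z ?w (ds (dt x) (t, s)))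
      + \<Gamma> c ?z (dt w (t, s) + \<Gamma> c ?z ?w ?u) ?v"
    using ts by (simp add: gam)
  \<comment> \<open>Besides the commuting second derivatives, the terms with first derivatives of
    \<open>w\<close> cancel crosswise between the product rule and the outer covariant
    derivative.\<close>
  show ?thesis
    unfolding R_Lam_def tcomp_simps 1 2 dd_commute[OF U w ts(3), of "(0, 1)" "(1, 0)"] dd_commute[OF U x ts(3), of "(0, 1)" "(1, 0)"]
    using linear_add[OF linear_\<Gamma>(2)[OF c z]] dd_\<zeta>[OF ts(3)] by (simp add: algebra_simps)
qed

text \<open>Taking \<open>c\<close> to be \<open>chart_at\<close> at the point lets the curvature
  and the Chern tensor unfold in the same chart; no invariance of these two under changes of chart
  is then required.\<close>

theorem R_Lam_formula:
  assumes ts: "t \<in> I" "s \<in> J" "(t, s) \<in> U" and w: "smooth_on U w"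
    and tan: "\<And>t s. t \<in> I \<Longrightarrow> s \<in> J \<Longrightarrow> W t s \<in> tangent_space F (\<Lambda> t s)"
    and W_w: "\<And>t s. t \<in> I \<Longrightarrow> s \<in> J \<Longrightarrow> (t, s) \<in> U \<Longrightarrow> tcomp (W t s) c = w (t, s)"
    and c_def: "c = chart_at F (\<Lambda> t s)"
  shows "R_Lam F a b \<epsilon> \<Lambda> W t s =
      chern_curvature F (\<Lambda> t s) (Lam_t F a b \<Lambda> t s) (Lam_t F a b \<Lambda> t s) (Lam_s F \<epsilon> \<Lambda> t s) (W t s)
      + chern_tensor F (\<Lambda> t s) (Lam_t F a b \<Lambda> t s) (Lam_s F \<epsilon> \<Lambda> t s) (W t s) (D_gam F a b \<Lambda> (Lam_t F a b \<Lambda>) t s)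
      - chern_tensor F (\<Lambda> t s) (Lam_t F a b \<Lambda> t s) (Lam_t F a b \<Lambda> t s) (W t s) (D_gam F a b \<Lambda> (Lam_s F \<epsilon> \<Lambda>) t s)"
    (is "_ = ?rhs")
proof (rule tangent_eqI[OF _ _ c_chart[OF ts]])
  show "R_Lam F a b \<epsilon> \<Lambda> W t s \<in> tangent_space F (\<Lambda> t s)"
    unfolding R_Lam_def by (intro tangent_space_diff D_tangent)
  note adm = adm[OF ts(1,2)]
  note eqs = chern_curvature_eq[OF adm c_def refl refl refl refl] chern_tensor_eq[OF adm c_def]
  show "?rhs \<in> tangent_space F (\<Lambda> t s)"
    unfolding eqs by (intro tangent_space_add tangent_space_diff vec_of_tangent c_chart ts)
  let ?z = "\<zeta> (t, s)" and ?w = "w (t, s)" and ?u = "dt x (t, s)" and ?v = "ds x (t, s)"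
  have z: "?z \<in> adm_in F c" by (rule \<zeta>_adm[OF ts])
  have Lam: "Lam_t F a b \<Lambda> \<tau> s \<in> tangent_space F (\<Lambda> \<tau> s)" "Lam_s F \<epsilon> \<Lambda> \<tau> s \<in> tangent_space F (\<Lambda> \<tau> s)" for \<tau>
    by (simp_all add: Lam_t_def Lam_s_def velocity_def Let_def vec_of_tangent chart_at_in)
  have "((\<lambda>\<tau>. tcomp (Lam_t F a b \<Lambda> \<tau> s) c) has_vector_derivative dt (dt x) (t, s)) (at t within I)"
    by (rule slice_transform_t[OF ts(1,3) slice_derivatives(1)[OF smooth_on_dd[OF x] ts(3)]]) (use ts in \<open>simp add: Lam_tcomp\<close>)
  from D_gam_tcomp[where W = "Lam_t F a b \<Lambda>", OF ts Lam(1) this]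
  have 1: "tcomp (D_gam F a b \<Lambda> (Lam_t F a b \<Lambda>) t s) c = dt (dt x) (t, s) + \<Gamma> c ?z ?u ?u"
    using ts by (simp add: Lam_tcomp)
  have "((\<lambda>\<tau>. tcomp (Lam_s F \<epsilon> \<Lambda> \<tau> s) c) has_vector_derivative dt (ds x) (t, s)) (at t within I)"
    by (rule slice_transform_t[OF ts(1,3) slice_derivatives(1)[OF smooth_on_dd[OF x] ts(3)]]) (use ts in \<open>simp add: Lam_tcomp\<close>)
  from D_gam_tcomp[where W = "Lam_s F \<epsilon> \<Lambda>", OF ts Lam(2) this]
  have 2: "tcomp (D_gam F a b \<Lambda> (Lam_s F \<epsilon> \<Lambda>) t s) c = ds (dt x) (t, s) + \<Gamma> c ?z ?u ?v"
    using dd_commute[OF U x ts(3), of "(0, 1)" "(1, 0)"] \<Gamma>_sym[OF c z] ts by (simp add: Lam_tcomp)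
  \<comment> \<open>With \<open>Z\<close> equal to \<open>\<Gamma>\<close> of the reference vector
    and \<open>X\<close>, the first direction is horizontal and gives the curvature. The second is
    vertical, and \<open>Y + Z\<close> becomes the covariant derivative along
    \<open>\<gamma>\<close> of \<open>\<Lambda>\<^sub>t\<close> or of
    \<open>\<Lambda>\<^sub>s\<close>, for \<open>X\<close> the respective velocity.\<close>
  have split: "d\<Gamma> c ?z (X, Y) A B = d\<Gamma> c ?z (X, - Z) A B + d\<Gamma> c ?z (0, Y + Z) A B" for X Y Z A B
    using linear_add[OF linear_d\<Gamma>_dir[OF c z], of "(X, - Z)" "(0, Y + Z)"] by simp
  have \<zeta>: "(cmap c (\<Lambda> t s), dt x (t, s)) = ?z" using \<Lambda>_x[OF ts] by (simp add: \<zeta>_def)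
  have "tcomp ?rhs c = d\<Gamma> c ?z (?u, - \<Gamma> c ?z ?u ?u) ?w ?v - d\<Gamma> c ?z (?v, - \<Gamma> c ?z ?u ?v) ?w ?u
      + \<Gamma> c ?z (\<Gamma> c ?z ?w ?v) ?u - \<Gamma> c ?z (\<Gamma> c ?z ?w ?u) ?v
      + d\<Gamma> c ?z (0, dt (dt x) (t, s) + \<Gamma> c ?z ?u ?u) ?v ?w - d\<Gamma> c ?z (0, ds (dt x) (t, s) + \<Gamma> c ?z ?u ?v) ?u ?w"
    unfolding eqs using ts by (simp add: c_chart Lam_tcomp W_w \<zeta> 1 2) (simp add: \<zeta>_def)
  moreover have "tcomp (R_Lam F a b \<epsilon> \<Lambda> W t s) c = d\<Gamma> c ?z (?u, dt (dt x) (t, s)) ?w ?v - d\<Gamma> c ?z (?v, ds (dt x) (t, s)) ?w ?u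
      + \<Gamma> c ?z (\<Gamma> c ?z ?w ?v) ?u - \<Gamma> c ?z (\<Gamma> c ?z ?w ?u) ?v"
    by (rule R_Lam_tcomp[where W = W and w = w, OF ts w tan W_w])
  ultimately show "tcomp (R_Lam F a b \<epsilon> \<Lambda> W t s) c = tcomp ?rhs c"
    using split[of ?u "dt (dt x) (t, s)" ?w ?v "\<Gamma> c ?z ?u ?u"] split[of ?v "ds (dt x) (t, s)" ?w ?u "\<Gamma> c ?z ?u ?v"]
      d\<Gamma>_sym[OF c z, of _ ?w] by simp
qed

end

section \<open>The formula along the given curve\<close>

theorem theorem1p1:
  fixes F :: "('m::{t2_space,second_countable_topology}, 'n::finite) finsler"
    and a b \<epsilon> :: real
    and \<gamma> :: "real \<Rightarrow> 'm"
    and \<Lambda> :: "real \<Rightarrow> real \<Rightarrow> 'm"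
    and W :: "real \<Rightarrow> real \<Rightarrow> ('m, 'n) tvec"
  assumes "pseudo_finsler F"
    and "a < b" and "0 < \<epsilon>"
    and "admissible_curve F {a..b} \<gamma>"
    and "admissible_two_param_map F a b \<epsilon> \<Lambda>"
    and "\<forall>t\<in>{a..b}. \<Lambda> t 0 = \<gamma> t"
    and "smooth_field_along F ({a..b} \<times> {-\<epsilon><..<\<epsilon>}) (\<lambda>(t, s). \<Lambda> t s) (\<lambda>(t, s). W t s)"
  shows "let \<gamma>' = velocity F {a..b} \<gamma>;
             U = (\<lambda>t. Lam_s F \<epsilon> \<Lambda> t 0);
             D\<gamma>' = cov_deriv F {a..b} \<gamma> \<gamma>' \<gamma>';
             DU = cov_deriv F {a..b} \<gamma> \<gamma>' U
         in \<forall>t\<in>{a..b}. R_Lam F a b \<epsilon> \<Lambda> W t 0 =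
              chern_curvature F (\<gamma> t) (\<gamma>' t) (\<gamma>' t) (U t) (W t 0)
              + chern_tensor F (\<gamma> t) (\<gamma>' t) (U t) (W t 0) (D\<gamma>' t)
              - chern_tensor F (\<gamma> t) (\<gamma>' t) (\<gamma>' t) (W t 0) (DU t)"
  unfolding Let_def
proof
  fix t assume t: "t \<in> {a..b}"
  interpret pseudo_finsler_manifold F by unfold_locales (rule assms(1))
  have \<gamma>\<Lambda>: "\<gamma> \<tau> = \<Lambda> \<tau> 0" if "\<tau> \<in> {a..b}" for \<tau> using assms(6) that by simp
  have vel: "velocity F {a..b} \<gamma> \<tau> = Lam_t F a b \<Lambda> \<tau> 0" if "\<tau> \<in> {a..b}" for \<tau>
    unfolding Lam_t_def by (rule velocity_cong[OF \<gamma>\<Lambda> that])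
  \<comment> \<open>\<open>\<gamma>\<close> and the base curve of \<open>\<Lambda>\<close> agree on
    \<open>[a,b]\<close> only, which is all that derivatives within this interval see.\<close>
  have D: "cov_deriv F {a..b} \<gamma> (velocity F {a..b} \<gamma>) (velocity F {a..b} \<gamma>) t = D_gam F a b \<Lambda> (Lam_t F a b \<Lambda>) t 0"
    "cov_deriv F {a..b} \<gamma> (velocity F {a..b} \<gamma>) (\<lambda>t. Lam_s F \<epsilon> \<Lambda> t 0) t = D_gam F a b \<Lambda> (Lam_s F \<epsilon> \<Lambda>) t 0"
    unfolding D_gam_def by (rule cov_deriv_cong; use \<gamma>\<Lambda> vel t in simp)+
  define c where "c = chart_at F (\<Lambda> t 0)"
  have c: "c \<in> charts_at F (\<Lambda> t 0)" by (simp add: c_def chart_at_in)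
  have 0: "0 \<in> {-\<epsilon><..<\<epsilon>}" using assms(3) by simp
  obtain a' b' \<Lambda>' where \<Lambda>': "a' < a" "b < b'" "smooth_map F ({a'<..<b'} \<times> {-\<epsilon><..<\<epsilon>}) \<Lambda>'"
    "\<And>t s. t \<in> {a..b} \<Longrightarrow> s \<in> {-\<epsilon><..<\<epsilon>} \<Longrightarrow> \<Lambda>' (t, s) = \<Lambda> t s"
    using assms(5) unfolding admissible_two_param_map_def two_param_map_def by metis
  have "(t, 0) \<in> {a'<..<b'} \<times> {-\<epsilon><..<\<epsilon>}" "c \<in> charts_at F (\<Lambda>' (t, 0))"
    using \<Lambda>'(1,2) t 0 c \<Lambda>'(4)[OF t 0] by auto
  then obtain U1 x where rep: "open U1" "(t, 0) \<in> U1" "smooth_on U1 x"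
    "\<And>y. y \<in> U1 \<inter> ({a'<..<b'} \<times> {-\<epsilon><..<\<epsilon>}) \<Longrightarrow> \<Lambda>' y \<in> cdom c \<and> cmap c (\<Lambda>' y) = x y"
    using \<Lambda>'(3) unfolding smooth_map_def by meson
  have \<Lambda>x: "\<Lambda> \<tau> \<sigma> \<in> cdom c \<and> cmap c (\<Lambda> \<tau> \<sigma>) = x (\<tau>, \<sigma>)" if "\<tau> \<in> {a..b}" "\<sigma> \<in> {-\<epsilon><..<\<epsilon>}" "(\<tau>, \<sigma>) \<in> U1" for \<tau> \<sigma>
    using rep(4)[of "(\<tau>, \<sigma>)"] \<Lambda>' that by simp
  have "(t, 0) \<in> {a..b} \<times> {-\<epsilon><..<\<epsilon>}" "c \<in> charts_at F (case (t, 0) of (t, s) \<Rightarrow> \<Lambda> t s)"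
    using t 0 c by auto
  then obtain U2 w where w: "open U2" "(t, 0) \<in> U2" "smooth_on U2 w"
    "\<And>y. y \<in> U2 \<inter> ({a..b} \<times> {-\<epsilon><..<\<epsilon>}) \<Longrightarrow> tcomp (case y of (t, s) \<Rightarrow> W t s) c = w y"
    using assms(7) unfolding smooth_field_along_def by meson
  have tan: "W \<tau> \<sigma> \<in> tangent_space F (\<Lambda> \<tau> \<sigma>)" if "\<tau> \<in> {a..b}" "\<sigma> \<in> {-\<epsilon><..<\<epsilon>}" for \<tau> \<sigma>
    using assms(7) that unfolding smooth_field_along_def by auto
  \<comment> \<open>The intersection is one open set carrying both representatives:
    \<open>x\<close>, coming from the extended map, and \<open>w\<close>, coming from the
    field.\<close>
  interpret two_param_chart F a b \<epsilon> \<Lambda> c "U1 \<inter> U2" x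
  proof
    show "smooth_on (U1 \<inter> U2) x" by (rule smooth_on_subset[OF rep(3)]) auto
  qed (use assms(2,5) c rep(1) w(1) \<Lambda>x in \<open>auto simp: admissible_two_param_map_def in_charts_at\<close>)
  have w': "smooth_on (U1 \<inter> U2) w" by (rule smooth_on_subset[OF w(3)]) auto
  have "tcomp (W \<tau> \<sigma>) c = w (\<tau>, \<sigma>)" if "\<tau> \<in> {a..b}" "\<sigma> \<in> {-\<epsilon><..<\<epsilon>}" "(\<tau>, \<sigma>) \<in> U1 \<inter> U2" for \<tau> \<sigma>
    using w(4)[of "(\<tau>, \<sigma>)"] that by simp
  from R_Lam_formula[OF t 0 _ w' tan this c_def] rep(2) w(2)
  show "R_Lam F a b \<epsilon> \<Lambda> W t 0 =
      chern_curvature F (\<gamma> t) (velocity F {a..b} \<gamma> t) (velocity F {a..b} \<gamma> t) (Lam_s F \<epsilon> \<Lambda> t 0) (W t 0)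
      + chern_tensor F (\<gamma> t) (velocity F {a..b} \<gamma> t) (Lam_s F \<epsilon> \<Lambda> t 0) (W t 0)
          (cov_deriv F {a..b} \<gamma> (velocity F {a..b} \<gamma>) (velocity F {a..b} \<gamma>) t)
      - chern_tensor F (\<gamma> t) (velocity F {a..b} \<gamma> t) (velocity F {a..b} \<gamma> t) (W t 0)
          (cov_deriv F {a..b} \<gamma> (velocity F {a..b} \<gamma>) (\<lambda>t. Lam_s F \<epsilon> \<Lambda> t 0) t)"
    unfolding D vel[OF t] \<gamma>\<Lambda>[OF t] by simp
qed

end
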